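(* There exists an absolute constant $C>0$ such that for any non-real zero $\beta'+i\gamma'$ of $\zeta'(s)$ (with $\beta',\gamma'$ real) we have $$ |\gamma_c-\gamma'|\le C\, |\beta'-\tfrac{1}{2}|^{\frac{1}{2}}. $$
   Context: $\zeta(s)$ is the Riemann zeta-function and $\zeta'(s)$ its derivative. The non-trivial zeros of $\zeta(s)$ are those in the critical strip $0\le \Re s\le 1$. For a zero $\beta'+i\gamma'$ of $\zeta'(s)$, $\gamma_c$ denotes the one among all ordinates (imaginary parts) of non-trivial zeros of $\zeta(s)$ for which $|\gamma_c-\gamma'|$ is smallest (if there is more than one such zero of $\zeta(s)$, $\gamma_c$ is the imaginary part of any one of them). The Riemann hypothesis is not assumed. *)

theory Defs
  imports "HOL-Complex_Analysis.Complex_Analysis"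
begin

text \<open>The continuation is built from
  \<open>\<Sum>n\<ge>1. (n + 1) powr (1 - s) - n powr (1 - s) = - 1\<close>: expanding each difference by
  Taylor's formula to order \<open>m\<close> expresses \<open>(s - 1) * \<zeta>(s)\<close> through the shifts \<open>\<zeta>(s + j - 1)\<close>, \<open>2 \<le> j \<le> m\<close>,
  and a remainder series that converges for \<open>Re s > 1 - m\<close>.\<close>

definition dirichlet_zeta :: "complex \<Rightarrow> complex" where "dirichlet_zeta s = (\<Sum>n. of_nat (Suc n) powr (-s))"
definition taylor_rem :: "nat \<Rightarrow> nat \<Rightarrow> complex \<Rightarrow> complex" where
  "taylor_rem m n s = of_nat (Suc n) powr (1 - s) * ((1 + 1 / of_nat (Suc n)) powr (1 - s)
     - (\<Sum>j\<le>m. ((1 - s) gchoose j) * (1 / of_nat (Suc n)) ^ j))"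

lemma norm_Suc_powr: "norm ((of_nat (Suc n) :: complex) powr a) = real (Suc n) powr Re a"
  using norm_powr_real_powr[of "of_nat (Suc n)" a] by simp

lemma gbinomial_Suc_mult: fixes a :: complex
  shows "of_nat (Suc i) * (a gchoose Suc i) = (a gchoose i) * (a - of_nat i)"
proof -
  have "of_nat (Suc i) * (p / (of_nat (Suc i) * q)) = p / (q :: complex)" for p q
    by (simp del: of_nat_Suc)
  then show ?thesis
    by (simp only: gbinomial_prod_rev fact_Suc prod.atLeast0_lessThan_Suc times_divide_eq_left)
qed

lemma dirichlet_zeta_sums: assumes "Re s > 1" shows "(\<lambda>n. of_nat (Suc n) powr (-s)) sums dirichlet_zeta s"
proof -
  have "summable (\<lambda>n. real n powr (- Re s))" using assms by (simp add: summable_real_powr_iff)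
  then have "summable (\<lambda>n. real (Suc n) powr (- Re s))" by (subst summable_Suc_iff)
  then have "summable (\<lambda>n. norm ((of_nat (Suc n) :: complex) powr (-s)))"
    by (simp only: norm_Suc_powr uminus_complex.sel)
  then show ?thesis unfolding dirichlet_zeta_def by (rule summable_sums[OF summable_norm_cancel])
qed

lemma powr_taylor_deriv:
  fixes a z :: complex
  assumes nz: "1 + z \<notin> \<real>\<^sub>\<le>\<^sub>0"
  shows "((\<lambda>z. fact i * (a gchoose i) * (1 + z) powr (a - of_nat i)) has_field_derivative
     fact (Suc i) * (a gchoose Suc i) * (1 + z) powr (a - of_nat (Suc i))) (at z within S)"
proof -
  have "((\<lambda>w. w powr (a - of_nat i)) has_field_derivative
      (a - of_nat i) * (1 + z) powr (a - of_nat i - 1)) (at (1 + z))"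
    by (rule has_field_derivative_powr[OF nz])
  moreover have "((\<lambda>z. 1 + z) has_field_derivative 0 + 1) (at z within S)"
    by (rule DERIV_add[OF DERIV_const DERIV_ident])
  ultimately have "((\<lambda>z. (1 + z) powr (a - of_nat i)) has_field_derivative
      (a - of_nat i) * (1 + z) powr (a - of_nat i - 1) * (0 + 1)) (at z within S)"
    by (rule DERIV_chain2)
  then have D: "((\<lambda>z. fact i * (a gchoose i) * (1 + z) powr (a - of_nat i)) has_field_derivative
      (fact i * (a gchoose i)) * ((a - of_nat i) * (1 + z) powr (a - of_nat i - 1) * (0 + 1))) (at z within S)"
    by (rule DERIV_cmult)
  have e: "a - of_nat i - 1 = a - of_nat (Suc i)" by simp
  have "fact (Suc i) * (a gchoose Suc i) = fact i * (of_nat (Suc i) * (a gchoose Suc i))"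
    by (simp add: algebra_simps)
  then have A: "fact (Suc i) * (a gchoose Suc i) = fact i * ((a gchoose i) * (a - of_nat i))"
    by (simp only: gbinomial_Suc_mult)
  have E: "(fact i * (a gchoose i)) * ((a - of_nat i) * (1 + z) powr (a - of_nat i - 1) * (0 + 1))
      = fact (Suc i) * (a gchoose Suc i) * (1 + z) powr (a - of_nat (Suc i))"
    by (simp only: A e mult.assoc add_0 mult_1_right)
  show ?thesis using D by (simp only: E)
qed

lemma powr_taylor_bound:
  fixes a :: complex and x :: real
  assumes x: "0 \<le> x" "x \<le> 1"
    and B: "norm ((a gchoose (Suc m)) :: complex) \<le> B" "norm a \<le> K"
  shows "norm ((1 + of_real x) powr a - (\<Sum>j\<le>m. (a gchoose j) * of_real x ^ j))
    \<le> (fact (Suc m) * B * 2 powr (K + real (Suc m))) * x ^ Suc m / fact m"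
proof -
  let ?S = "closed_segment 0 (1::complex)"
  let ?f = "\<lambda>i z. fact i * (a gchoose i) * (1 + z) powr (a - of_nat i)"
  have S: "\<exists>u. z = of_real u \<and> 0 \<le> u \<and> u \<le> 1" if "z \<in> ?S" for z
    using that by (auto simp: in_segment scaleR_conv_of_real)
  have "norm (?f 0 (of_real x) - (\<Sum>i\<le>m. ?f i 0 * (of_real x - 0) ^ i / fact i))
     \<le> (fact (Suc m) * B * 2 powr (K + real (Suc m))) * norm (of_real x - 0 :: complex) ^ Suc m / fact m"
  proof (rule complex_Taylor[where f = ?f and S = ?S])
    show "convex ?S" by simp
    show "0 \<in> ?S" "of_real x \<in> ?S" using x by (auto simp: in_segment scaleR_conv_of_real)
    fix z assume "z \<in> ?S"
    then obtain u where u: "z = of_real u" "0 \<le> u" "u \<le> 1" using S by blast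
    have nz: "1 + z \<notin> \<real>\<^sub>\<le>\<^sub>0" using u by (auto simp: complex_nonpos_Reals_iff)
    show "(?f i has_field_derivative ?f (Suc i) z) (at z within ?S)" for i
      by (rule powr_taylor_deriv[OF nz])
    have "norm ((1 + z) powr (a - of_nat (Suc m))) = (1 + u) powr (Re a - real (Suc m))"
      using u norm_powr_real_powr[of "1 + z" "a - of_nat (Suc m)"] by simp
    also have "\<dots> \<le> (1 + u) powr (K + real (Suc m))"
      using u B(2) complex_Re_le_cmod[of a] by (intro powr_mono) auto
    also have "\<dots> \<le> 2 powr (K + real (Suc m))"
      using u B(2) norm_ge_zero[of a] by (intro powr_mono2) (auto simp del: norm_ge_zero)
    finally show "norm (?f (Suc m) z) \<le> fact (Suc m) * B * 2 powr (K + real (Suc m))"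
      unfolding norm_mult norm_fact using B order_trans[OF norm_ge_zero B(1)]
      by (intro mult_mono mult_nonneg_nonneg) auto
  qed
  then show ?thesis using x by simp
qed

lemma taylor_rem_holomorphic: "taylor_rem m n holomorphic_on A"
proof -
  have "1 + 1 / of_nat (Suc n) \<noteq> (0::complex)"
    by (metis add.commute divide_eq_0_iff of_nat_Suc of_nat_neq_0 add_divide_distrib divide_self_if)
  then show ?thesis unfolding taylor_rem_def gbinomial_prod_rev
    by (intro holomorphic_intros) auto
qed

lemma taylor_rem_sum_holomorphic: "(\<lambda>s. \<Sum>n. taylor_rem m n s) holomorphic_on {s. Re s > 1 - real m}"
proof (rule holomorphic_uniform_sequence[where f = "\<lambda>N s. \<Sum>n<N. taylor_rem m n s"])
  show op: "open {s. Re s > 1 - real m}" by (simp add: open_halfspace_Re_gt)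
  show "(\<lambda>s. \<Sum>n<N. taylor_rem m n s) holomorphic_on {s. Re s > 1 - real m}" for N
    by (intro holomorphic_intros taylor_rem_holomorphic)
  fix s0 assume s0: "s0 \<in> {s. Re s > 1 - real m}"
  define e where "e = (Re s0 - (1 - real m)) / 2"
  have e: "e > 0" using s0 by (simp add: e_def)
  have ball: "Re s \<ge> 1 - real m + e" if "s \<in> cball s0 e" for s
  proof -
    have "\<bar>Re (s0 - s)\<bar> \<le> e" using that abs_Re_le_cmod[of "s0 - s"] by (simp add: dist_norm)
    then have "Re s \<ge> Re s0 - e" by simp
    then show ?thesis by (simp add: e_def field_simps)
  qed
  have "compact ((\<lambda>s. (1 - s) gchoose (Suc m)) ` cball s0 e)"
    unfolding gbinomial_prod_rev by (intro compact_continuous_image continuous_intros) (auto simp del: of_nat_Suc)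
  then obtain B where B: "\<And>s. s \<in> cball s0 e \<Longrightarrow> norm ((1 - s) gchoose (Suc m)) \<le> B"
    by (meson bounded_iff compact_imp_bounded imageI)
  have "compact ((\<lambda>s. 1 - s) ` cball s0 e)"
    by (intro compact_continuous_image continuous_intros) auto
  then obtain K where K: "\<And>s. s \<in> cball s0 e \<Longrightarrow> norm (1 - s) \<le> K"
    by (meson bounded_iff compact_imp_bounded imageI)
  define D where "D = (fact (Suc m) * B * 2 powr (K + real (Suc m))) / fact m"
  have D0: "D \<ge> 0" unfolding D_def
    using B[of s0] e by (auto intro!: mult_nonneg_nonneg divide_nonneg_nonneg intro: order_trans[OF norm_ge_zero])
  have "uniform_limit (cball s0 e) (\<lambda>N s. \<Sum>n<N. taylor_rem m n s) (\<lambda>s. \<Sum>n. taylor_rem m n s) sequentially"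
  proof (intro uniform_limit_suminf Weierstrass_m_test'[where M = "\<lambda>n. D * real (Suc n) powr (- 1 - e)"])
    have "summable (\<lambda>n. real n powr (- 1 - e))" using e by (simp add: summable_real_powr_iff)
    then have "summable (\<lambda>n. real (Suc n) powr (- 1 - e))" by (subst summable_Suc_iff)
    then show "summable (\<lambda>n. D * real (Suc n) powr (- 1 - e))" by (rule summable_mult)
  next
    fix n s assume s: "s \<in> cball s0 e"
    have "norm (taylor_rem m n s) = real (Suc n) powr (1 - Re s) *
        norm ((1 + of_real (1 / real (Suc n))) powr (1 - s)
           - (\<Sum>j\<le>m. ((1 - s) gchoose j) * of_real (1 / real (Suc n)) ^ j))"
      unfolding taylor_rem_def norm_mult norm_Suc_powr by simp
    also have "\<dots> \<le> real (Suc n) powr (1 - Re s) *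
       ((fact (Suc m) * B * 2 powr (K + real (Suc m))) * (1 / real (Suc n)) ^ Suc m / fact m)"
      using B[OF s] K[OF s] by (intro mult_left_mono powr_taylor_bound) auto
    also have "\<dots> = D * (real (Suc n) powr (1 - Re s) * (1 / real (Suc n)) ^ Suc m)"
      by (simp add: D_def)
    also have "(1 / real (Suc n)) ^ Suc m = real (Suc n) powr (- real (Suc m))"
      by (simp only: powr_minus powr_realpow of_nat_0_less_iff zero_less_Suc power_one_over inverse_eq_divide)
    also have "real (Suc n) powr (1 - Re s) * real (Suc n) powr (- real (Suc m))
        = real (Suc n) powr (- Re s - real m)"
      by (simp flip: powr_add)
    also have "D * \<dots> \<le> D * real (Suc n) powr (- 1 - e)"
      using ball[OF s] D0 by (intro mult_left_mono powr_mono) auto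
    finally show "norm (taylor_rem m n s) \<le> D * real (Suc n) powr (- 1 - e)" .
  qed
  moreover have "cball s0 e \<subseteq> {s. Re s > 1 - real m}"
    using ball e by fastforce
  ultimately show "\<exists>d>0. cball s0 d \<subseteq> {s. Re s > 1 - real m} \<and>
      uniform_limit (cball s0 d) (\<lambda>N s. \<Sum>n<N. taylor_rem m n s) (\<lambda>s. \<Sum>n. taylor_rem m n s) sequentially"
    using e by blast
qed

lemma taylor_rem_eq:
  assumes "m \<ge> 1"
  shows "taylor_rem m n s = (of_nat (Suc (Suc n)) powr (1 - s) - of_nat (Suc n) powr (1 - s))
     - (1 - s) * of_nat (Suc n) powr (- s)
     - (\<Sum>j=2..m. ((1 - s) gchoose j) * of_nat (Suc n) powr (- (s + of_nat j - 1)))"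
proof -
  let ?N = "of_nat (Suc n) :: complex"
  have 1: "?N powr (1 - s) * (1 + 1 / ?N) powr (1 - s) = of_nat (Suc (Suc n)) powr (1 - s)"
  proof -
    have "(of_real (real (Suc n)) * of_real (1 + 1 / real (Suc n)) :: complex) powr (1 - s)
       = of_real (real (Suc n)) powr (1 - s) * of_real (1 + 1 / real (Suc n)) powr (1 - s)"
      by (rule powr_times_real) auto
    moreover have "(of_real (real (Suc n)) * of_real (1 + 1 / real (Suc n)) :: complex) = of_nat (Suc (Suc n))"
      by (simp add: field_simps del: of_nat_Suc) (simp add: algebra_simps)
    ultimately show ?thesis by simp
  qed
  have 2: "?N powr (1 - s) * (c * (1 / ?N) ^ j) = c * ?N powr (- (s + of_nat j - 1))" for c j
  proof -
    have "?N powr (- (s + of_nat j - 1)) = ?N powr ((1 - s) - of_nat j)" by (simp add: algebra_simps)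
    also have "\<dots> = ?N powr (1 - s) / ?N ^ j" by (simp add: powr_diff powr_nat' del: of_nat_Suc)
    finally show ?thesis by (simp add: power_one_over del: of_nat_Suc)
  qed
  have "{..m} = insert 0 (insert 1 {2..m})" using assms by auto
  then have 3: "(\<Sum>j\<le>m. h j) = h 0 + (h 1 + (\<Sum>j=2..m. h j))" for h :: "nat \<Rightarrow> complex"
    by simp
  show ?thesis
    unfolding taylor_rem_def right_diff_distrib 1
    unfolding sum_distrib_left 2
    unfolding 3 by simp
qed

lemma dirichlet_zeta_rec:
  assumes m: "m \<ge> 1" and s: "Re s > 1"
  shows "(s - 1) * dirichlet_zeta s = 1 + (\<Sum>n. taylor_rem m n s)
    + (\<Sum>j=2..m. ((1 - s) gchoose j) * dirichlet_zeta (s + of_nat j - 1))"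
proof -
  have lim: "(\<lambda>n. of_nat (Suc n) powr (1 - s) :: complex) \<longlonglongrightarrow> 0"
  proof (rule tendsto_norm_zero_cancel)
    have "(\<lambda>n. real n powr (1 - Re s)) \<longlonglongrightarrow> 0"
      using s by (intro tendsto_neg_powr filterlim_real_sequentially) auto
    then have "(\<lambda>n. real (Suc n) powr (1 - Re s)) \<longlonglongrightarrow> 0" by (rule LIMSEQ_Suc)
    then show "(\<lambda>n. norm (of_nat (Suc n) powr (1 - s) :: complex)) \<longlonglongrightarrow> 0"
      by (simp only: norm_Suc_powr minus_complex.sel one_complex.sel)
  qed
  have "taylor_rem m n s = (of_nat (Suc (Suc n)) powr (1 - s) - of_nat (Suc n) powr (1 - s))
     - (1 - s) * of_nat (Suc n) powr (- s)
     - (\<Sum>j=2..m. ((1 - s) gchoose j) * of_nat (Suc n) powr (- (s + of_nat j - 1)))" for n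
    by (rule taylor_rem_eq[OF m])
  moreover have "(\<lambda>n. (of_nat (Suc (Suc n)) powr (1 - s) - of_nat (Suc n) powr (1 - s))
     - (1 - s) * of_nat (Suc n) powr (- s)
     - (\<Sum>j=2..m. ((1 - s) gchoose j) * of_nat (Suc n) powr (- (s + of_nat j - 1)) :: complex))
     sums ((0 - of_nat (Suc 0) powr (1 - s)) - (1 - s) * dirichlet_zeta s - (\<Sum>j=2..m. ((1 - s) gchoose j) * dirichlet_zeta (s + of_nat j - 1)))"
    using s by (intro sums_diff sums_mult sums_sum dirichlet_zeta_sums telescope_sums lim) auto
  ultimately have "(\<lambda>n. taylor_rem m n s) sums ((0 - of_nat (Suc 0) powr (1 - s)) - (1 - s) * dirichlet_zeta s - (\<Sum>j=2..m. ((1 - s) gchoose j) * dirichlet_zeta (s + of_nat j - 1)))"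
    by simp
  from sums_unique[OF this] show ?thesis by (simp add: algebra_simps)
qed

lemma sign_aux: "- A / J * (- b * c) = A * b / J * (c :: complex)"
  by simp

lemma dirichlet_zeta_extend_halfplane: "\<exists>g. g holomorphic_on {s. Re s > - real m} \<and> (\<forall>s. Re s > 1 \<longrightarrow> g s = (s - 1) * dirichlet_zeta s)"
proof (induction m)
  case 0
  have "(\<lambda>s. 1 + (\<Sum>n. taylor_rem 1 n s)) holomorphic_on {s. Re s > - real 0}"
    using taylor_rem_sum_holomorphic[of 1] by (intro holomorphic_on_add holomorphic_on_const) simp
  moreover have "1 + (\<Sum>n. taylor_rem 1 n s) = (s - 1) * dirichlet_zeta s" if "Re s > 1" for s
    using dirichlet_zeta_rec[of 1 s] that by simp
  ultimately show ?case by blast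
next
  case (Suc m)
  then obtain g where g: "g holomorphic_on {s. Re s > - real m}"
    and gZ: "\<And>s. Re s > 1 \<Longrightarrow> g s = (s - 1) * dirichlet_zeta s" by blast
  let ?m = "m + 2"
  define h where "h = (\<lambda>s. 1 + (\<Sum>n. taylor_rem ?m n s) +
     (\<Sum>j=2..?m. - ((1 - s) gchoose (j - 1)) / of_nat j * (g \<circ> (\<lambda>s. s + of_nat j - 1)) s))"
  have h1: "(\<lambda>s. \<Sum>n. taylor_rem ?m n s) holomorphic_on {s. Re s > - real (Suc m)}"
    by (rule holomorphic_on_subset[OF taylor_rem_sum_holomorphic]) auto
  have h2: "(\<lambda>s. - ((1 - s) gchoose (j - 1)) / of_nat j * (g \<circ> (\<lambda>s. s + of_nat j - 1)) s)
      holomorphic_on {s. Re s > - real (Suc m)}" if j: "j \<in> {2..?m}" for j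
  proof (rule holomorphic_on_mult)
    show "(\<lambda>s. - ((1 - s) gchoose (j - 1)) / of_nat j) holomorphic_on {s. Re s > - real (Suc m)}"
      using j unfolding gbinomial_prod_rev by (intro holomorphic_intros) auto
    have "(\<lambda>s. s + of_nat j - 1) holomorphic_on {s. Re s > - real (Suc m)}"
      by (intro holomorphic_intros)
    then show "(g \<circ> (\<lambda>s. s + of_nat j - 1)) holomorphic_on {s. Re s > - real (Suc m)}"
      by (rule holomorphic_on_compose_gen[OF _ g]) (use j in auto)
  qed
  have "h holomorphic_on {s. Re s > - real (Suc m)}"
    unfolding h_def by (rule holomorphic_on_add[OF holomorphic_on_add[OF holomorphic_on_const h1]
          holomorphic_on_sum[OF h2]])
  moreover have "h s = (s - 1) * dirichlet_zeta s" if s: "Re s > 1" for s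
  proof -
    have "((1 - s) gchoose j) * dirichlet_zeta (s + of_nat j - 1) =
       - ((1 - s) gchoose (j - 1)) / of_nat j * (g \<circ> (\<lambda>s. s + of_nat j - 1)) s" if j: "j \<in> {2..?m}" for j
    proof -
      obtain i where i: "j = Suc i" using j by (cases j) auto
      have a: "of_nat (Suc i) * ((1 - s) gchoose Suc i) = ((1 - s) gchoose i) * (1 - s - of_nat i)"
        by (rule gbinomial_Suc_mult)
      define w where "w = s + of_nat j - 1"
      have "g w = (w - 1) * dirichlet_zeta w"
        using s j by (intro gZ) (auto simp: w_def)
      also have "w - 1 = - (1 - s - of_nat i)" by (simp add: w_def i)
      finally have gw: "g w = - (1 - s - of_nat i) * dirichlet_zeta w" .
      have "- ((1 - s) gchoose (j - 1)) / of_nat j * (g \<circ> (\<lambda>s. s + of_nat j - 1)) s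
         = - ((1 - s) gchoose i) / of_nat (Suc i) * g w"
        by (simp add: w_def i)
      also have "\<dots> = ((1 - s) gchoose i) * (1 - s - of_nat i) / of_nat (Suc i) * dirichlet_zeta (s + of_nat j - 1)"
        unfolding gw w_def[symmetric] by (rule sign_aux)
      also have "\<dots> = ((1 - s) gchoose j) * dirichlet_zeta (s + of_nat j - 1)"
        unfolding a[symmetric] i by (simp del: of_nat_Suc)
      finally show ?thesis by simp
    qed
    then have "(\<Sum>j=2..?m. ((1 - s) gchoose j) * dirichlet_zeta (s + of_nat j - 1)) =
        (\<Sum>j=2..?m. - ((1 - s) gchoose (j - 1)) / of_nat j * (g \<circ> (\<lambda>s. s + of_nat j - 1)) s)"
      by (intro sum.cong refl)
    then show ?thesis unfolding h_def using dirichlet_zeta_rec[of ?m s] s by simp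
  qed
  ultimately show ?case by blast
qed

lemma dirichlet_zeta_extend: "\<exists>F. F holomorphic_on UNIV \<and> (\<forall>s. Re s > 1 \<longrightarrow> F s = (s - 1) * dirichlet_zeta s)"
proof -
  obtain g where g: "\<And>m. g m holomorphic_on {s. Re s > - real m}"
    and gZ: "\<And>m s. Re s > 1 \<Longrightarrow> g m s = (s - 1) * dirichlet_zeta s"
    using dirichlet_zeta_extend_halfplane by metis
  have eq: "g m s = g k s" if "Re s > - real m" "m \<le> k" for m k s
  proof (rule analytic_continuation_open[of "{s. Re s > 1}" "{s. Re s > - real m}" "g m" "g k"])
    show "g k holomorphic_on {s. Re s > - real m}"
      using that by (intro holomorphic_on_subset[OF g[of k]]) auto
    have "(2::complex) \<in> {s. Re s > 1}" by simp
    then show "{s. Re s > 1} \<noteq> {}" by blast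
  qed (use that g gZ in \<open>auto simp: open_halfspace_Re_gt convex_connected convex_halfspace_Re_gt\<close>)
  define F where "F = (\<lambda>s. g (nat \<lceil>- Re s\<rceil> + 1) s)"
  have F: "F s = g m s" if "Re s > - real m" for m s
  proof -
    let ?k = "nat \<lceil>- Re s\<rceil> + 1"
    have "Re s > - real ?k" by linarith
    then show ?thesis unfolding F_def using eq that nat_le_linear by metis
  qed
  have "F holomorphic_on (\<Union>m::nat. {s. Re s > - real m})"
  proof (rule holomorphic_on_UN_open)
    show "F holomorphic_on {s. Re s > - real m}" for m
      by (rule holomorphic_transform[OF g[of m]]) (auto simp: F)
  qed (auto simp: open_halfspace_Re_gt)
  moreover have "(\<Union>m::nat. {s. Re s > - real m}) = UNIV"
    by auto (metis reals_Archimedean2 minus_less_iff)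
  moreover have "F s = (s - 1) * dirichlet_zeta s" if "Re s > 1" for s
    using F[of 0 s] gZ[of s 0] that by simp
  ultimately show ?thesis by auto
qed

lemma zeta_ex1:
  "\<exists>!f. f holomorphic_on (- {1}) \<and> f 1 = 0 \<and>
        (\<forall>s. Re s > 1 \<longrightarrow> (\<lambda>n. 1 / of_nat (Suc n) powr s) sums (f s :: complex))"
proof (rule ex_ex1I)
  obtain F where F: "F holomorphic_on UNIV" "\<And>s. Re s > 1 \<Longrightarrow> F s = (s - 1) * dirichlet_zeta s"
    using dirichlet_zeta_extend by blast
  define f where "f = (\<lambda>s. if s = 1 then 0 else F s / (s - 1))"
  have "(\<lambda>s. F s / (s - 1)) holomorphic_on (- {1})"
    by (intro holomorphic_intros holomorphic_on_subset[OF F(1)]) auto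
  then have "f holomorphic_on (- {1})"
    by (rule holomorphic_transform) (auto simp: f_def)
  moreover have "(\<lambda>n. 1 / of_nat (Suc n) powr s) sums f s" if "Re s > 1" for s
  proof -
    have "f s = dirichlet_zeta s" using that F(2)[of s] by (auto simp: f_def)
    then show ?thesis using dirichlet_zeta_sums[OF that] by (simp add: powr_minus inverse_eq_divide)
  qed
  ultimately show "\<exists>f. f holomorphic_on (- {1}) \<and> f 1 = 0 \<and>
        (\<forall>s. Re s > 1 \<longrightarrow> (\<lambda>n. 1 / of_nat (Suc n) powr s) sums (f s :: complex))"
    by (intro exI[of _ f]) (simp add: f_def)
next
  fix f g :: "complex \<Rightarrow> complex"
  assume f: "f holomorphic_on (- {1}) \<and> f 1 = 0 \<and>
        (\<forall>s. Re s > 1 \<longrightarrow> (\<lambda>n. 1 / of_nat (Suc n) powr s) sums f s)"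
    and g: "g holomorphic_on (- {1}) \<and> g 1 = 0 \<and>
        (\<forall>s. Re s > 1 \<longrightarrow> (\<lambda>n. 1 / of_nat (Suc n) powr s) sums g s)"
  show "f = g"
  proof
    fix s show "f s = g s"
    proof (cases "s = 1")
      case False
      show ?thesis
      proof (rule analytic_continuation_open[of "{s. Re s > 1}" "- {1}" f g])
        show "connected (- {1 :: complex})"
          by (simp add: connected_punctured_universe)
        have "(2::complex) \<in> {s. Re s > 1}" by simp
    then show "{s. Re s > 1} \<noteq> {}" by blast
        show "f z = g z" if "z \<in> {s. Re s > 1}" for z
        proof (rule sums_unique2)
          show "(\<lambda>n. 1 / of_nat (Suc n) powr z) sums f z" using f that by blast
          show "(\<lambda>n. 1 / of_nat (Suc n) powr z) sums g z" using g that by blast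
        qed
      qed (use f g False in \<open>auto simp: open_halfspace_Re_gt\<close>)
    qed (use f g in simp)
  qed
qed

text \<open>The continuation is unique away from the pole at \<open>1\<close>, where the value is set
  to \<open>0\<close> by convention.\<close>

definition zeta :: "complex \<Rightarrow> complex" where
  "zeta = (THE f. f holomorphic_on (- {1}) \<and> f 1 = 0 \<and>
                  (\<forall>s. Re s > 1 \<longrightarrow> (\<lambda>n. 1 / of_nat (Suc n) powr s) sums f s))"

lemma
  shows zeta_holomorphic: "zeta holomorphic_on (- {1})"
    and zeta_1: "zeta 1 = 0"
    and zeta_sums: "Re s > 1 \<Longrightarrow> (\<lambda>n. 1 / of_nat (Suc n) powr s) sums zeta s"
  using theI'[OF zeta_ex1, folded zeta_def] by blast+

text \<open>The condition \<open>\<rho> \<noteq> 1\<close> discards the conventional value of \<^const>\<open>zeta\<close> at its pole.\<close>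

definition nontrivial_zeta_zeros :: "complex set" where
  "nontrivial_zeta_zeros = {\<rho>. \<rho> \<noteq> 1 \<and> zeta \<rho> = 0 \<and> 0 \<le> Re \<rho> \<and> Re \<rho> \<le> 1}"

text \<open>A relation rather than a function, since two ordinates can be equally close to \<open>t\<close>.\<close>

definition nearest_ordinate :: "real \<Rightarrow> real \<Rightarrow> bool" where
  "nearest_ordinate t \<gamma> \<longleftrightarrow>
     \<gamma> \<in> Im ` nontrivial_zeta_zeros \<and>
     (\<forall>\<gamma>' \<in> Im ` nontrivial_zeta_zeros. \<bar>\<gamma> - t\<bar> \<le> \<bar>\<gamma>' - t\<bar>)"

end

theory Submission
  imports Defs "HOL-Real_Asymp.Real_Asymp"
begin

text \<open>
  Put \<open>\<xi>(s) = \<pi> powr (-s/2) * \<Gamma>(s/2) * \<zeta>(s)\<close> and \<open>L = \<xi>'/\<xi>\<close>. The functional equation together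
  with reflection in the real axis makes \<open>\<xi>\<close> real on the critical line, so \<open>Re L\<close> vanishes there.
  At a zero \<open>1/2 + x + iT\<close> of \<open>\<zeta>'\<close> that is not a zero of \<open>\<zeta>\<close>, the term \<open>\<zeta>'/\<zeta>\<close> of \<open>L\<close> drops out
  and only the Gamma factor remains, whose real part is about \<open>(ln T)/2\<close>. So \<open>Re L\<close> grows from \<open>0\<close> to
  about \<open>(ln T)/2\<close> along a horizontal segment of length \<open>\<bar>x\<bar>\<close>. On the other hand \<open>L'\<close> equals
  \<open>- \<Sum> 1/(s - \<rho>)\<^sup>2\<close> over the zeros in a fixed disc up to an error \<open>O(ln T)\<close>, and there are \<open>O(ln T)\<close>
  such zeros; if every ordinate has distance at least \<open>d\<close> from \<open>T\<close>, then
  \<open>L' = O((1 + 1/d\<^sup>2) ln T)\<close> on the segment. Comparing the two gives \<open>1 = O(\<bar>x\<bar> (1 + 1/d\<^sup>2))\<close>, that is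
  \<open>d\<^sup>2 = O(\<bar>x\<bar>)\<close> as long as \<open>d\<close> is bounded (\<open>log_deriv_Re_bound\<close>, \<open>large_ordinates\<close>).

  That \<open>d\<close> is bounded follows from the same estimate in a large disc: if the disc of radius \<open>R/3\<close> around
  \<open>2 + iT\<close> contained no zero, then \<open>L' = O(ln T / R)\<close> between \<open>1/2 + iT\<close> and \<open>2 + iT\<close>, with an absolute
  constant, although \<open>Re L\<close> grows by about \<open>(ln T)/2\<close> there. For a fixed large \<open>R\<close> this is absurd
  (\<open>uniform_gap\<close>).

  Below a fixed height the distances are bounded and \<open>\<zeta>'\<close> has only finitely many zeros in the critical
  strip, so the constant can be adapted to all of them that are off the critical line. A zero \<open>1/2 + it\<close>
  of \<open>\<zeta>'\<close>, however, has to be a zero of \<open>\<zeta>\<close>. Otherwise the real part of the Gamma term of \<open>L\<close> vanishes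
  at it, i.e. \<open>Re \<psi>(1/4 + it/2) = ln \<pi>\<close>. The left side increases with \<open>t\<close>, so this happens at a single
  \<open>t > 0\<close>, which is close to \<open>6.29\<close>; a numerical evaluation by Euler--Maclaurin summation shows
  \<open>\<zeta>' \<noteq> 0\<close> around that point (\<open>zeta_deriv_nonzero_near\<close>, \<open>deriv_zeta_critical_line\<close>).

  The functional equation is obtained on the interval \<open>(-1, 0)\<close> by evaluating
  \<open>\<integral> t powr (s-1) * (1/(exp t - 1) + 1/2 - 1/t)\<close> in two ways: as a sum of errors of the trapezoidal rule, and
  by the partial fractions of the hyperbolic cotangent. All terms are nonnegative, so every exchange of
  sums and integrals is an instance of Tonelli's theorem. The identity theorem does the rest.
\<close>

section \<open>Euler--Maclaurin summation to third order\<close>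

text \<open>The error is the integral of \<open>F4\<close> against the kernel \<open>w(u) = u (1 - u) (1 - 2 u) / 12\<close>, one sixth of
  the third Bernoulli polynomial. The kernel changes sign only at the midpoint, so comparing with its
  primitive on the two halves gives \<open>\<integral> \<bar>w\<bar> = 1/192\<close>; the comparison is done with derivatives, which
  avoids integrals altogether.\<close>

lemma euler_maclaurin_step:
  fixes F0 F1 F2 F3 F4 :: "real \<Rightarrow> complex"
  assumes der: "\<And>x. x \<in> {a..a+1} \<Longrightarrow> (F0 has_vector_derivative F1 x) (at x)"
               "\<And>x. x \<in> {a..a+1} \<Longrightarrow> (F1 has_vector_derivative F2 x) (at x)"
               "\<And>x. x \<in> {a..a+1} \<Longrightarrow> (F2 has_vector_derivative F3 x) (at x)"
               "\<And>x. x \<in> {a..a+1} \<Longrightarrow> (F3 has_vector_derivative F4 x) (at x)"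
    and bound: "\<And>x. x \<in> {a..a+1} \<Longrightarrow> norm (F4 x) \<le> K"
  shows "norm ((F1 a + F1 (a+1)) / 2 - (F0 (a+1) - F0 a) - (F2 (a+1) - F2 a) / 12) \<le> K / 192"
proof -
  define w where "w = (\<lambda>u::real. u * (1 - u) * (1 - 2 * u) / 12)"
  define w1 where "w1 = (\<lambda>u::real. (u ^ 2 - u + 1 / 6) / 2)"
  define G where "G = (\<lambda>x. w (x - a) *\<^sub>R F3 x - w1 (x - a) *\<^sub>R F2 x + (x - a - 1 / 2) *\<^sub>R F1 x - F0 x)"
  define W where "W = (\<lambda>x. K * ((x - a)^2 * (1 - (x - a))^2 / 24))"
  have K: "K \<ge> 0" using bound[of a] norm_ge_zero[of "F4 a"] by (simp del: norm_ge_zero)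
  have dw: "((\<lambda>x. w (x - a)) has_real_derivative w1 (x - a)) (at x)" for x
    unfolding w_def w1_def by (rule derivative_eq_intros refl | simp)+ (simp add: field_simps power2_eq_square)
  have dw1: "((\<lambda>x. w1 (x - a)) has_real_derivative (x - a - 1 / 2)) (at x)" for x
    unfolding w1_def by (rule derivative_eq_intros refl | simp)+
  have dG: "(G has_vector_derivative w (x - a) *\<^sub>R F4 x) (at x)" if "x \<in> {a..a+1}" for x
  proof -
    have "((\<lambda>x. x - a - 1/2) has_real_derivative 1) (at x)"
      by (rule derivative_eq_intros refl | simp)+
    note D = has_vector_derivative_diff[OF has_vector_derivative_add[OF has_vector_derivative_diff[OF
        has_vector_derivative_scaleR[OF dw der(4)[OF that]]
        has_vector_derivative_scaleR[OF dw1 der(3)[OF that]]]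
        has_vector_derivative_scaleR[OF this der(2)[OF that]]] der(1)[OF that]]
    show ?thesis unfolding G_def by (rule has_vector_derivative_eq_rhs[OF D]) simp
  qed
  have dW: "(W has_real_derivative K * w (x - a)) (at x)" for x
    unfolding W_def w_def by (rule derivative_eq_intros refl | simp)+ (simp add: field_simps power2_eq_square)
  have cont: "continuous_on S G" if "S \<subseteq> {a..a+1}" for S
    using dG that by (intro continuous_at_imp_continuous_on)
       (meson has_vector_derivative_continuous subsetD ballI)
  have h: "a \<le> a + 1/2" "a + 1/2 \<le> a + 1" by auto
  \<comment> \<open>On the first half of the interval the kernel is nonnegative, on the second half nonpositive.\<close>
  have 1: "norm (G (a + 1/2) - G a) \<le> W (a + 1/2) - W a"
  proof (rule differentiable_bound_general[where f' = "\<lambda>x. w (x - a) *\<^sub>R F4 x" and \<phi>' = "\<lambda>x. K * w (x - a)"])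
    show "continuous_on {a..a + 1/2} G" by (rule cont) auto
    show "continuous_on {a..a + 1/2} W" unfolding W_def by (auto intro!: continuous_intros)
    fix x assume x: "a < x" "x < a + 1/2"
    show "(G has_vector_derivative w (x - a) *\<^sub>R F4 x) (at x)" using dG x by auto
    show "(W has_vector_derivative K * w (x - a)) (at x)"
      using dW by (simp add: has_real_derivative_iff_has_vector_derivative)
    have "w (x - a) \<ge> 0" using x by (simp add: w_def)
    then show "norm (w (x - a) *\<^sub>R F4 x) \<le> K * w (x - a)"
      using bound[of x] x by (simp add: mult.commute mult_right_mono)
  qed auto
  have 2: "norm (G (a + 1) - G (a + 1/2)) \<le> (- W (a + 1)) - (- W (a + 1/2))"
  proof (rule differentiable_bound_general[where f' = "\<lambda>x. w (x - a) *\<^sub>R F4 x" and \<phi>' = "\<lambda>x. - (K * w (x - a))"])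
    show "continuous_on {a + 1/2..a + 1} G" by (rule cont) auto
    show "continuous_on {a + 1/2..a + 1} (\<lambda>x. - W x)" unfolding W_def by (auto intro!: continuous_intros)
    fix x assume x: "a + 1/2 < x" "x < a + 1"
    show "(G has_vector_derivative w (x - a) *\<^sub>R F4 x) (at x)" using dG x by auto
    show "((\<lambda>x. - W x) has_vector_derivative - (K * w (x - a))) (at x)"
      using DERIV_minus[OF dW] by (simp add: has_real_derivative_iff_has_vector_derivative)
    have "w (x - a) \<le> 0" using x unfolding w_def
      by (simp add: mult_nonneg_nonpos)
    then show "norm (w (x - a) *\<^sub>R F4 x) \<le> - (K * w (x - a))"
      using bound[of x] x mult_left_mono[of "norm (F4 x)" K "- w (x - a)"] by (simp add: mult.commute)
  qed auto
  have "G (a + 1) - G a = (F1 a + F1 (a+1)) / 2 - (F0 (a+1) - F0 a) - (F2 (a+1) - F2 a) / 12"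
    by (simp add: G_def w_def w1_def scaleR_conv_of_real field_simps)
  moreover have "norm (G (a + 1) - G a) \<le> norm (G (a + 1) - G (a + 1/2)) + norm (G (a + 1/2) - G a)"
    using norm_triangle_ineq[of "G (a + 1) - G (a + 1/2)" "G (a + 1/2) - G a"] by simp
  moreover have "W (a + 1/2) = K / 384" "W (a + 1) = 0" "W a = 0" by (simp_all add: W_def power2_eq_square)
  ultimately show ?thesis using 1 2 by simp
qed

section \<open>The Euler--Maclaurin formula for \<open>\<zeta>\<close> and \<open>\<zeta>'\<close>\<close>

text \<open>The error of one Euler--Maclaurin step for \<open>x powr (-s)\<close> on \<open>[x, x + 1]\<close>; writing it in closed form makes
  it visibly holomorphic in \<open>s\<close>.\<close>

definition em_term :: "complex \<Rightarrow> real \<Rightarrow> complex" where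
  "em_term s x = (of_real x powr (-s) + of_real (x + 1) powr (-s)) / 2
     - (of_real (x + 1) powr (1 - s) - of_real x powr (1 - s)) / (1 - s)
     + s * (of_real (x + 1) powr (- s - 1) - of_real x powr (- s - 1)) / 12"

text \<open>The same error for \<open>x powr (-s) * ln x\<close>, which is minus the derivative of the former with respect
  to \<open>s\<close>; \<open>F0\<close> is a primitive and \<open>F2\<close> the derivative of the summand \<open>F1\<close>.\<close>

definition em_term_ln :: "complex \<Rightarrow> real \<Rightarrow> complex" where
  "em_term_ln s x =
     (let F0 = \<lambda>x. of_real x powr (1 - s) * (of_real (ln x) / (1 - s) - 1 / (1 - s) ^ 2);
          F1 = \<lambda>x. of_real x powr (-s) * of_real (ln x);
          F2 = \<lambda>x. of_real x powr (- s - 1) * (1 - s * of_real (ln x))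
      in (F1 x + F1 (x + 1)) / 2 - (F0 (x + 1) - F0 x) - (F2 (x + 1) - F2 x) / 12)"

lemma powr_vector_derivative:
  assumes "x > 0" "b = a - 1"
  shows "((\<lambda>x. of_real x powr a :: complex) has_vector_derivative a * of_real x powr b) (at x)"
proof (rule has_vector_derivative_real_field)
  show "((\<lambda>z. z powr a) has_field_derivative a * of_real x powr b) (at (of_real x))"
    unfolding assms(2) using assms(1) by (intro has_field_derivative_powr) auto
qed

lemma powr_ln_vector_derivative:
  fixes A B :: complex
  assumes "x > 0" "b = a - 1"
  shows "((\<lambda>x. of_real x powr a * (A + B * of_real (ln x))) has_vector_derivative
    of_real x powr b * ((a * A + B) + a * B * of_real (ln x))) (at x)"
proof -
  have x: "complex_of_real x \<notin> \<real>\<^sub>\<le>\<^sub>0" using assms by auto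
  have b: "of_real x powr b = of_real x powr a / of_real x" unfolding assms(2) using assms(1)
    by (simp add: powr_diff)
  have "((\<lambda>z. z powr a * (A + B * Ln z)) has_field_derivative
      (a * of_real x powr (a - 1)) * (A + B * Ln (of_real x)) + (0 + B * (1 / of_real x)) * of_real x powr a) (at (of_real x))"
    by (intro DERIV_mult DERIV_add DERIV_const DERIV_cmult has_field_derivative_powr[OF x])
       (use has_field_derivative_Ln[OF x] in \<open>simp add: inverse_eq_divide\<close>)
  then have "((\<lambda>z. z powr a * (A + B * Ln z)) has_field_derivative
      of_real x powr b * ((a * A + B) + a * B * of_real (ln x))) (at (of_real x))"
    by (rule DERIV_cong) (use assms in \<open>simp add: b powr_diff Ln_of_real field_simps\<close>)
  then have "((\<lambda>x. of_real x powr a * (A + B * Ln (of_real x))) has_vector_derivative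
    of_real x powr b * ((a * A + B) + a * B * of_real (ln x))) (at x)"
    by (rule has_vector_derivative_real_field)
  then show ?thesis
    by (rule has_vector_derivative_transform_within_open[where S = "{0<..}"])
       (use assms in \<open>auto simp: Ln_of_real\<close>)
qed

lemma norm_of_real_powr: "x > 0 \<Longrightarrow> norm (of_real x powr a :: complex) = x powr Re a"
  by (subst norm_powr_real_powr) auto

lemma em_term_bound:
  assumes x: "x > 0" and s: "s \<noteq> 1" "Re s \<ge> - 3"
  shows "norm (em_term s x) \<le> norm (s * (s + 1) * (s + 2)) * x powr (- Re s - 3) / 192"
proof -
  define F0 where "F0 = (\<lambda>x::real. of_real x powr (1 - s) / (1 - s))"
  define F1 where "F1 = (\<lambda>x::real. of_real x powr (- s) :: complex)"
  define F2 where "F2 = (\<lambda>x::real. (- s) * of_real x powr (- s - 1))"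
  define F3 where "F3 = (\<lambda>x::real. (- s) * ((- s - 1) * of_real x powr (- s - 2)))"
  define F4 where "F4 = (\<lambda>x::real. (- s) * ((- s - 1) * ((- s - 2) * of_real x powr (- s - 3))))"
  have "norm ((F1 x + F1 (x+1)) / 2 - (F0 (x+1) - F0 x) - (F2 (x+1) - F2 x) / 12)
     \<le> (norm (s * (s + 1) * (s + 2)) * x powr (- Re s - 3)) / 192"
  proof (rule euler_maclaurin_step)
    fix u assume u: "u \<in> {x..x+1}"
    then have u0: "u > 0" using x by auto
    have "((\<lambda>x. of_real x powr (1 - s) / (1 - s)) has_vector_derivative
        ((1 - s) * of_real u powr (- s)) / (1 - s)) (at u)"
      by (rule has_vector_derivative_divide) (rule powr_vector_derivative[OF u0], simp)
    then show "(F0 has_vector_derivative F1 u) (at u)" using s by (simp add: F0_def F1_def)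
    show "(F1 has_vector_derivative F2 u) (at u)" unfolding F1_def F2_def
      by (rule powr_vector_derivative[OF u0]) simp
    show "(F2 has_vector_derivative F3 u) (at u)" unfolding F2_def F3_def
      by (intro has_vector_derivative_mult_right powr_vector_derivative[OF u0]) simp
    show "(F3 has_vector_derivative F4 u) (at u)" unfolding F3_def F4_def
      by (intro has_vector_derivative_mult_right powr_vector_derivative[OF u0]) simp
    have "norm (F4 u) = norm (s * (s + 1) * (s + 2)) * u powr (- Re s - 3)"
    proof -
      have "F4 u = - (s * (s + 1) * (s + 2)) * of_real u powr (- s - 3)" by (simp add: F4_def algebra_simps)
      then show ?thesis using u0 by (simp only: norm_mult norm_minus_cancel norm_of_real_powr) simp
    qed
    also have "\<dots> \<le> norm (s * (s + 1) * (s + 2)) * x powr (- Re s - 3)"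
      using u x s by (intro mult_left_mono powr_mono2') auto
    finally show "norm (F4 u) \<le> norm (s * (s + 1) * (s + 2)) * x powr (- Re s - 3)" .
  qed
  also have "(F1 x + F1 (x+1)) / 2 - (F0 (x+1) - F0 x) - (F2 (x+1) - F2 x) / 12 = em_term s x"
    by (simp add: em_term_def F0_def F1_def F2_def diff_divide_distrib right_diff_distrib)
  finally show ?thesis .
qed

lemma em_term_ln_bound:
  assumes x: "x > 0" and s: "s \<noteq> 1"
    and K: "\<And>u. u \<in> {x..x+1} \<Longrightarrow>
      u powr (- Re s - 3) * (norm (3 * s ^ 2 + 6 * s + 2) + norm (s * (s + 1) * (s + 2)) * \<bar>ln u\<bar>) \<le> K"
  shows "norm (em_term_ln s x) \<le> K / 192"
  unfolding em_term_ln_def Let_def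
proof (rule euler_maclaurin_step)
  fix u assume u: "u \<in> {x..x+1}"
  then have u0: "u > 0" using x by auto
  note D = powr_ln_vector_derivative[OF u0]
  show "((\<lambda>x. of_real x powr (1 - s) * (of_real (ln x) / (1 - s) - 1 / (1 - s) ^ 2)) has_vector_derivative
      of_real u powr (- s) * of_real (ln u)) (at u)"
    using D[of "- s" "1 - s" "- 1 / (1 - s) ^ 2" "1 / (1 - s)"] s by (simp add: power2_eq_square)
  show "((\<lambda>x. of_real x powr (- s) * of_real (ln x)) has_vector_derivative
      of_real u powr (- s - 1) * (1 - s * of_real (ln u))) (at u)"
    using D[of "- s - 1" "- s" 0 1] by simp
  show "((\<lambda>x. of_real x powr (- s - 1) * (1 - s * of_real (ln x))) has_vector_derivative
      of_real u powr (- s - 2) * (- (2 * s + 1) + s * (s + 1) * of_real (ln u))) (at u)"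
    using D[of "- s - 2" "- s - 1" 1 "- s"] by (simp add: algebra_simps)
  show "((\<lambda>x. of_real x powr (- s - 2) * (- (2 * s + 1) + s * (s + 1) * of_real (ln x))) has_vector_derivative
      of_real u powr (- s - 3) * ((3 * s ^ 2 + 6 * s + 2) - s * (s + 1) * (s + 2) * of_real (ln u))) (at u)"
    using D[of "- s - 3" "- s - 2" "- (2 * s + 1)" "s * (s + 1)"] by (simp add: algebra_simps power2_eq_square)
  have "norm (of_real u powr (- s - 3) * ((3 * s ^ 2 + 6 * s + 2) - s * (s + 1) * (s + 2) * of_real (ln u)))
    \<le> u powr (- Re s - 3) * (norm (3 * s ^ 2 + 6 * s + 2) + norm (s * (s + 1) * (s + 2)) * \<bar>ln u\<bar>)"
    unfolding norm_mult[of "of_real u powr _"] using u0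
    by (auto simp: norm_of_real_powr norm_mult intro!: mult_left_mono order.trans[OF norm_triangle_ineq4])
  with K[OF u] show "norm (of_real u powr (- s - 3) * ((3 * s ^ 2 + 6 * s + 2) - s * (s + 1) * (s + 2) * of_real (ln u))) \<le> K"
    by simp
qed

lemma em_term_deriv:
  assumes x: "x > 0" and s: "s \<noteq> 1"
  shows "((\<lambda>s. em_term s x) has_field_derivative - em_term_ln s x) (at s)"
proof -
  have P: "((\<lambda>s. of_real u powr (c - s)) has_field_derivative - (of_real u powr (c - s) * of_real (ln u))) (at s)"
    if "u > 0" for u :: real and c :: complex
  proof -
    have "((\<lambda>s. of_real u powr (c - s)) has_field_derivative
        (Ln (of_real u) * of_real u powr (c - s)) * (0 - 1)) (at s)"
      using that by (intro DERIV_chain2[OF has_field_derivative_powr_right] DERIV_diff) auto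
    then show ?thesis using that by (simp add: Ln_of_real mult.commute)
  qed
  have x1: "x + 1 > 0" using x by simp
  have m: "- 1 - s = - s - 1" for s :: complex by simp
  have E: "em_term s x = (of_real x powr (0 - s) + of_real (x + 1) powr (0 - s)) / 2
     - (of_real (x + 1) powr (1 - s) - of_real x powr (1 - s)) / (1 - s)
     + s * (of_real (x + 1) powr (- 1 - s) - of_real x powr (- 1 - s)) / 12" for s
    unfolding em_term_def m diff_0 ..
  have aux: "(- (p0 * L) + - (q0 * M)) / 2
      - ((- (q1 * M) - - (p1 * L)) * r - (q1 - p1) * (0 - 1)) / (r * r)
      + (1 * (q2 - p2) + (- (q2 * M) - - (p2 * L)) * s) / 12
    = - ((p0 * L + q0 * M) / 2 - (q1 * (M / r - 1 / r ^ 2) - p1 * (L / r - 1 / r ^ 2))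
      - (q2 * (1 - s * M) - p2 * (1 - s * L)) / 12)"
    if "r \<noteq> 0" for p0 q0 p1 q1 p2 q2 L M r :: complex
  proof -
    have "((- (q1 * M) - - (p1 * L)) * r - (q1 - p1) * (0 - 1)) / (r * r)
      = - (q1 * (M / r - 1 / r ^ 2) - p1 * (L / r - 1 / r ^ 2))"
      using that by (simp add: field_simps power2_eq_square)
    then show ?thesis by (simp only:) (simp add: algebra_simps add_divide_distrib diff_divide_distrib)
  qed
  have "1 - s \<noteq> 0" using s by simp
  have "((\<lambda>s. em_term s x) has_field_derivative
      (- (of_real x powr (0 - s) * of_real (ln x)) + - (of_real (x + 1) powr (0 - s) * of_real (ln (x + 1)))) / 2
      - ((- (of_real (x + 1) powr (1 - s) * of_real (ln (x + 1))) - - (of_real x powr (1 - s) * of_real (ln x))) * (1 - s)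
         - (of_real (x + 1) powr (1 - s) - of_real x powr (1 - s)) * (0 - 1)) / ((1 - s) * (1 - s))
      + (1 * (of_real (x + 1) powr (- 1 - s) - of_real x powr (- 1 - s))
         + (- (of_real (x + 1) powr (- 1 - s) * of_real (ln (x + 1))) - - (of_real x powr (- 1 - s) * of_real (ln x))) * s) / 12) (at s)"
    unfolding E using \<open>1 - s \<noteq> 0\<close>
    by (intro DERIV_add DERIV_diff DERIV_divide DERIV_mult DERIV_cdivide DERIV_ident DERIV_const P x x1)
  then show ?thesis unfolding aux[OF \<open>1 - s \<noteq> 0\<close>] by (simp only: em_term_ln_def Let_def m diff_0)
qed

text \<open>The explicit part of the Euler--Maclaurin formula for \<open>\<zeta>(s)\<close> when the summation is cut at \<open>N\<close>.\<close>

definition em_head :: "nat \<Rightarrow> complex \<Rightarrow> complex" where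
  "em_head N s = (\<Sum>n=1..<N. of_nat n powr (- s)) + of_nat N powr (- s) / 2
     + of_nat N powr (1 - s) / (s - 1) + s * of_nat N powr (- s - 1) / 12"

lemma zeta_sums_powr: "Re s > 1 \<Longrightarrow> (\<lambda>n. of_nat (Suc n) powr (- s)) sums zeta s"
  using zeta_sums[of s] by (simp add: powr_minus inverse_eq_divide)

lemma em_term_of_nat: "em_term s (real n) = (of_nat n powr (-s) + of_nat (n + 1) powr (-s)) / 2
     - (of_nat (n + 1) powr (1 - s) - of_nat n powr (1 - s)) / (1 - s)
     + s * (of_nat (n + 1) powr (- s - 1) - of_nat n powr (- s - 1)) / 12"
  by (simp add: em_term_def add.commute)

lemma em_head_step:
  assumes "N \<ge> 1"
  shows "em_head (Suc N) s - em_head N s = em_term s (real N)"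
proof -
  have "(\<Sum>n=1..<Suc N. of_nat n powr (- s)) = (\<Sum>n=1..<N. of_nat n powr (- s)) + (of_nat N powr (- s) :: complex)"
    using assms by simp
  moreover have "S + p + q / 2 + b / (s - 1) + s * v / 12 - (S + p / 2 + a / (s - 1) + s * u / 12)
     = (p + q) / 2 - (b - a) / (1 - s) + s * (v - u) / 12" for S p q a b u v :: complex
  proof -
    have "(b - a) / (1 - s) = - ((b - a) / (s - 1))" by (metis minus_diff_eq divide_minus_right)
    then show ?thesis by (simp only:) (simp add: diff_divide_distrib right_diff_distrib)
  qed
  ultimately show ?thesis unfolding em_head_def em_term_of_nat by (simp only: Suc_eq_plus1)
qed

lemma powr_of_nat_tendsto_0:
  assumes "Re a < 0" shows "(\<lambda>n. of_nat n powr a :: complex) \<longlonglongrightarrow> 0"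
proof (rule tendsto_norm_zero_cancel)
  have "(\<lambda>n. real n powr Re a) \<longlonglongrightarrow> 0"
    using assms by (intro tendsto_neg_powr filterlim_real_sequentially) auto
  then show "(\<lambda>n. norm (of_nat n powr a :: complex)) \<longlonglongrightarrow> 0"
    by (rule Lim_transform_eventually)
       (use eventually_gt_at_top[of 0] in eventually_elim, simp add: norm_powr_real_powr)
qed

lemma em_head_tendsto:
  assumes s: "Re s > 1"
  shows "(\<lambda>N. em_head N s) \<longlonglongrightarrow> zeta s"
proof -
  have "(\<lambda>N. \<Sum>n<N. of_nat (Suc n) powr (- s)) \<longlonglongrightarrow> zeta s"
    using zeta_sums_powr[OF s] by (simp add: sums_def)
  then have "(\<lambda>N. \<Sum>n<N. of_nat (Suc n) powr (- s)) \<longlonglongrightarrow> zeta s" .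
  moreover have "(\<Sum>n<N. of_nat (Suc n) powr (- s)) = (\<Sum>n=1..<Suc N. of_nat n powr (- s) :: complex)" for N
    by (rule sum.reindex_bij_witness[of _ "\<lambda>n. n - 1" Suc]) auto
  ultimately have "(\<lambda>N. \<Sum>n=1..<Suc N. of_nat n powr (- s) :: complex) \<longlonglongrightarrow> zeta s" by simp
  then have "(\<lambda>N. \<Sum>n=1..<N. of_nat n powr (- s) :: complex) \<longlonglongrightarrow> zeta s"
    by (rule LIMSEQ_imp_Suc)
  moreover have "(\<lambda>N. of_nat N powr (- s) / 2 :: complex) \<longlonglongrightarrow> 0 / 2"
    using s by (intro tendsto_divide powr_of_nat_tendsto_0) auto
  moreover have "(\<lambda>N. of_nat N powr (1 - s) / (s - 1) :: complex) \<longlonglongrightarrow> 0 / (s - 1)"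
    using s by (intro tendsto_divide powr_of_nat_tendsto_0) (auto simp: complex_eq_iff)
  moreover have "(\<lambda>N. s * of_nat N powr (- s - 1) / 12 :: complex) \<longlonglongrightarrow> s * 0 / 12"
    using s by (intro tendsto_divide tendsto_mult powr_of_nat_tendsto_0) auto
  ultimately have "(\<lambda>N. em_head N s) \<longlonglongrightarrow> zeta s + 0 / 2 + 0 / (s - 1) + s * 0 / 12"
    unfolding em_head_def by (intro tendsto_add)
  then show ?thesis by simp
qed

text \<open>For \<open>Re s > 1\<close> the explicit part tends to \<open>\<zeta>(s)\<close> and its increments are the errors of the single steps,
  so the formula is a telescoping sum.\<close>

lemma em_term_sums_right:
  assumes "Re s > 1" "N \<ge> 1"
  shows "(\<lambda>k. em_term s (real (N + k))) sums (zeta s - em_head N s)"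
proof -
  have "(\<lambda>k. em_head (N + k) s) \<longlonglongrightarrow> zeta s"
    using LIMSEQ_ignore_initial_segment[OF em_head_tendsto[OF assms(1)], of N] by (simp add: add.commute)
  then have "(\<lambda>k. em_head (N + Suc k) s - em_head (N + k) s) sums (zeta s - em_head (N + 0) s)"
    by (rule telescope_sums)
  moreover have "em_head (N + Suc k) s - em_head (N + k) s = em_term s (real (N + k))" for k
    using em_head_step[of "N + k" s] assms by simp
  ultimately show ?thesis by (simp only: add_0_right)
qed

text \<open>A step costs \<open>O(n powr (- Re s - 3))\<close>, which is summable, locally uniformly, as soon as \<open>Re s > -2\<close>.\<close>

lemma em_term_local_bound:
  assumes N: "N \<ge> 1" and s0: "s0 \<in> {s. Re s > - 2} - {1}"
  shows "\<exists>d h. 0 < d \<and> summable h \<and> (\<forall>\<^sub>F n in sequentially. \<forall>s\<in>ball s0 d \<inter> ({s. Re s > - 2} - {1}). norm (em_term s (real (N + n))) \<le> h n)"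
proof -
  define d where "d = (Re s0 + 2) / 2"
  define B where "B = (norm s0 + d + 2) ^ 3 / 192"
  define h where "h = (\<lambda>n. B * real (Suc n) powr (- 1 - d))"
  have d: "d > 0" using s0 by (simp add: d_def)
  have "summable (\<lambda>n. real n powr (- 1 - d))" using d by (simp add: summable_real_powr_iff)
  then have "summable (\<lambda>n. real (Suc n) powr (- 1 - d))" by (subst summable_Suc_iff)
  then have "summable h" unfolding h_def by (rule summable_mult)
  moreover have "norm (em_term s (real (N + n))) \<le> h n" if s: "s \<in> ball s0 d \<inter> ({s. Re s > - 2} - {1})" for n s
  proof -
    have ns: "norm s \<le> norm s0 + d"
      using s norm_triangle_ineq[of s0 "s - s0"] by (simp add: dist_norm norm_minus_commute)
    have "\<bar>Re (s0 - s)\<bar> \<le> norm (s0 - s)" by (rule abs_Re_le_cmod)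
    moreover have "norm (s0 - s) < d" using s by (simp add: dist_norm)
    ultimately have "Re s \<ge> Re s0 - d" unfolding minus_complex.sel by linarith
    then have R: "Re s \<ge> d - 2" by (simp add: d_def field_simps)
    have "norm (s * (s + 1) * (s + 2)) \<le> (norm s0 + d + 2) * (norm s0 + d + 2) * (norm s0 + d + 2)"
      unfolding norm_mult using ns d norm_triangle_ineq[of s 1] norm_triangle_ineq[of s 2]
      by (intro mult_mono) (auto intro: mult_nonneg_nonneg)
    then have n3: "norm (s * (s + 1) * (s + 2)) / 192 \<le> B" by (simp add: B_def power3_eq_cube)
    have "norm (em_term s (real (N + n))) \<le> norm (s * (s + 1) * (s + 2)) * real (N + n) powr (- Re s - 3) / 192"
      using s N by (intro em_term_bound) auto
    also have "\<dots> = norm (s * (s + 1) * (s + 2)) / 192 * real (N + n) powr (- Re s - 3)" by simp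
    also have "\<dots> \<le> B * real (Suc n) powr (- 1 - d)"
    proof (intro mult_mono n3)
      have "real (N + n) powr (- Re s - 3) \<le> real (N + n) powr (- 1 - d)"
        using R N by (intro powr_mono) auto
      also have "\<dots> \<le> real (Suc n) powr (- 1 - d)"
        using N d by (intro powr_mono2') auto
      finally show "real (N + n) powr (- Re s - 3) \<le> real (Suc n) powr (- 1 - d)" .
    next
      show "0 \<le> B" using order.trans[OF _ n3] by simp
    qed simp
    finally show ?thesis by (simp add: h_def)
  qed
  ultimately show ?thesis using d by (intro exI[of _ d] exI[of _ h]) auto
qed

lemma of_nat_powr_field_derivative:
  assumes "n > 0"
  shows "((\<lambda>s. of_nat n powr (c - s)) has_field_derivative - (of_nat n powr (c - s) * of_real (ln (real n)))) (at (s::complex))"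
proof -
  have "((\<lambda>s. of_nat n powr (c - s)) has_field_derivative
      (Ln (of_nat n) * of_nat n powr (c - s)) * (0 - 1)) (at s)"
    using assms by (intro DERIV_chain2[OF has_field_derivative_powr_right] DERIV_diff) auto
  moreover have "Ln (of_nat n :: complex) = of_real (ln (real n))"
    using assms Ln_of_real[of "real n"] by simp
  ultimately show ?thesis by (simp add: mult.commute)
qed

text \<open>The explicit part for \<open>-\<zeta>'(s)\<close>.\<close>

definition em_head_ln :: "nat \<Rightarrow> complex \<Rightarrow> complex" where
  "em_head_ln N s = (\<Sum>n=1..<N. of_nat n powr (- s) * of_real (ln (real n)))
     + of_nat N powr (- s) * of_real (ln (real N)) / 2
     + of_nat N powr (1 - s) * (of_real (ln (real N)) / (s - 1) + 1 / (s - 1) ^ 2)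
     + of_nat N powr (- s - 1) * (s * of_real (ln (real N)) - 1) / 12"

lemma em_head_deriv:
  assumes N: "N \<ge> 1" and s: "s \<noteq> 1"
  shows "(em_head N has_field_derivative - em_head_ln N s) (at s)"
proof -
  have m: "- 1 - s = - s - 1" for s :: complex by simp
  have N0: "N > 0" using N by simp
  have E: "em_head N = (\<lambda>s. (\<Sum>n=1..<N. of_nat n powr (0 - s)) + of_nat N powr (0 - s) / 2
     + of_nat N powr (1 - s) / (s - 1) + s * of_nat N powr (- 1 - s) / 12)"
    unfolding em_head_def m diff_0 ..
  have s1: "s - 1 \<noteq> 0" using s by simp
  have D: "(em_head N has_field_derivative
     (\<Sum>n=1..<N. - (of_nat n powr (0 - s) * of_real (ln (real n))))
     + - (of_nat N powr (0 - s) * of_real (ln (real N))) / 2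
     + (- (of_nat N powr (1 - s) * of_real (ln (real N))) * (s - 1) - of_nat N powr (1 - s) * (1 - 0)) / ((s - 1) * (s - 1))
     + (1 * of_nat N powr (- 1 - s) + - (of_nat N powr (- 1 - s) * of_real (ln (real N))) * s) / 12) (at s)"
    unfolding E using s1
    by (intro DERIV_add DERIV_diff DERIV_divide DERIV_mult DERIV_cdivide DERIV_ident DERIV_const DERIV_sum
        of_nat_powr_field_derivative N0) auto
  have "- A + - (p * L) / 2 + (- (q * L) * r - q * (1 - 0)) / (r * r) + (1 * v + - (v * L) * s) / 12
     = - (A + p * L / 2 + q * (L / r + 1 / r ^ 2) + v * (s * L - 1) / 12)" if "r \<noteq> 0" for A p L q r v :: complex
  proof -
    have "(- (q * L) * r - q * (1 - 0)) / (r * r) = - (q * (L / r + 1 / r ^ 2))"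
      using that by (simp add: field_simps power2_eq_square)
    then show ?thesis by (simp only:) (simp add: algebra_simps add_divide_distrib diff_divide_distrib)
  qed
  note A = this[OF s1]
  show ?thesis using D unfolding em_head_ln_def sum_negf A unfolding m diff_0 .
qed

text \<open>Both series converge locally uniformly on \<open>Re s > -2\<close>, so the identity known for \<open>Re s > 1\<close> extends by
  the identity theorem and may be differentiated term by term.\<close>

lemma zeta_euler_maclaurin:
  assumes s: "Re s > - 2" "s \<noteq> 1" and N: "N \<ge> 1"
  shows "(\<lambda>k. em_term s (real (N + k))) sums (zeta s - em_head N s)"
    and "(\<lambda>k. em_term_ln s (real (N + k))) sums (- deriv zeta s - em_head_ln N s)"
proof -
  define S where "S = {s. Re s > - 2} - {1::complex}"
  have op: "open S" unfolding S_def by (intro open_Diff open_halfspace_Re_gt) auto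
  have con: "connected S" unfolding S_def
    by (rule connected_open_delete) (auto simp: open_halfspace_Re_gt convex_connected convex_halfspace_Re_gt)
  have hfd: "((\<lambda>s. em_term s (real (N + n))) has_field_derivative - em_term_ln x (real (N + n))) (at x)" if "x \<in> S" for n x
    using that N by (intro em_term_deriv) (auto simp: S_def)
  obtain g g' where g: "\<And>x. x \<in> S \<Longrightarrow> ((\<lambda>n. em_term x (real (N + n))) sums g x) \<and>
      ((\<lambda>n. - em_term_ln x (real (N + n))) sums g' x) \<and> (g has_field_derivative g' x) (at x)"
    using series_and_derivative_comparison_local[OF op hfd em_term_local_bound[OF N, folded S_def]] by metis
  have dh: "(em_head N has_field_derivative - em_head_ln N x) (at x)" if "x \<in> S" for x
    using that N by (intro em_head_deriv) (auto simp: S_def)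
  have sub: "S \<subseteq> - {1}" by (auto simp: S_def)
  have dz: "(zeta has_field_derivative deriv zeta x) (at x)" if "x \<in> S" for x
    using that sub by (intro holomorphic_derivI[OF zeta_holomorphic]) auto
  have sS: "s \<in> S" using s by (simp add: S_def)
  have eq: "g x = zeta x - em_head N x" if "x \<in> S" for x
  proof (rule analytic_continuation_open[of "{s. Re s > 1}" S g "\<lambda>x. zeta x - em_head N x"])
    have "(2::complex) \<in> {s. Re s > 1}" by simp
    then show "{s. Re s > 1} \<noteq> {}" by blast
    show "g holomorphic_on S" using g op by (auto simp: holomorphic_on_open)
    show "(\<lambda>x. zeta x - em_head N x) holomorphic_on S"
      using DERIV_diff[OF dz dh] op by (auto simp: holomorphic_on_open)
    show "g x = zeta x - em_head N x" if "x \<in> {s. Re s > 1}" for x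
    proof (rule sums_unique2)
      show "(\<lambda>n. em_term x (real (N + n))) sums g x" 
      proof -
        have "x \<in> S" using that by (auto simp: S_def)
        then show ?thesis using g by blast
      qed
      show "(\<lambda>n. em_term x (real (N + n))) sums (zeta x - em_head N x)"
        using that N by (intro em_term_sums_right) auto
    qed
    show "{s. Re s > 1} \<subseteq> S" by (auto simp: S_def)
  qed (simp_all only: op con that open_halfspace_Re_gt)
  show "(\<lambda>k. em_term s (real (N + k))) sums (zeta s - em_head N s)"
    using g[OF sS] eq[OF sS] by simp
  have "(g has_field_derivative deriv zeta s - - em_head_ln N s) (at s)"
  proof (rule has_field_derivative_transform_within_open[OF DERIV_diff[OF dz[OF sS] dh[OF sS]] op sS])
  qed (simp add: eq)
  then have "g' s = deriv zeta s + em_head_ln N s" using g[OF sS] DERIV_unique by fastforce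
  then have "(\<lambda>k. - em_term_ln s (real (N + k))) sums (deriv zeta s + em_head_ln N s)" using g[OF sS] by simp
  from sums_minus[OF this] show "(\<lambda>k. em_term_ln s (real (N + k))) sums (- deriv zeta s - em_head_ln N s)" by simp
qed

section \<open>The zeta function has no zeros with real part above 1\<close>

lemma powr_summable_on:
  assumes s: "Re s > 1"
  shows "(\<lambda>n. real n powr (- Re s)) summable_on UNIV"
    and "(\<lambda>n. of_nat n powr (- s) :: complex) summable_on A"
proof -
  have n: "norm (of_nat n powr (- s) :: complex) = real n powr (- Re s)" for n
    by (cases "n = 0") (auto simp: norm_powr_real_powr)
  have "summable (\<lambda>n. real n powr (- Re s))" using s by (simp add: summable_real_powr_iff)
  then show 1: "(\<lambda>n. real n powr (- Re s)) summable_on UNIV"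
    by (intro norm_summable_imp_summable_on) simp
  then have "(\<lambda>n. of_nat n powr (- s) :: complex) summable_on UNIV"
    unfolding n[symmetric] by (rule abs_summable_summable)
  then show "(\<lambda>n. of_nat n powr (- s) :: complex) summable_on A"
    by (rule summable_on_subset_banach) simp
qed

lemma zeta_eq_infsum:
  assumes s: "Re s > 1"
  shows "zeta s = infsum (\<lambda>n. of_nat n powr (- s)) UNIV"
proof -
  have "(\<lambda>n. of_nat n powr (- s)) sums (infsum (\<lambda>n. of_nat n powr (- s)) UNIV :: complex)"
    using powr_summable_on(2)[OF s] by (intro has_sum_imp_sums has_sum_infsum)
  then have "(\<lambda>n. of_nat (Suc n) powr (- s)) sums (infsum (\<lambda>n. of_nat n powr (- s)) UNIV :: complex)"
    by (subst sums_Suc_iff) simp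
  then show ?thesis using zeta_sums_powr[OF s] sums_unique2 by blast
qed

text \<open>Sieving by all primes up to \<open>M\<close> leaves \<open>1\<close> and numbers beyond \<open>M\<close> only. This finite form of the Euler
  product needs no infinite products.\<close>

definition sieved :: "nat set \<Rightarrow> nat set" where "sieved P = {n. \<forall>p\<in>P. \<not> p dvd n}"

text \<open>A number without prime factors in \<open>P\<close> either avoids \<open>p\<close> as well or is \<open>p\<close> times another such number.\<close>

lemma sieved_step:
  assumes "prime p" "p \<notin> P" and P: "\<And>q. q \<in> P \<Longrightarrow> prime q"
  shows "sieved P = sieved (insert p P) \<union> (\<lambda>m. p * m) ` sieved P"
proof (intro equalityI subsetI)
  fix n assume n: "n \<in> sieved P"
  show "n \<in> sieved (insert p P) \<union> (\<lambda>m. p * m) ` sieved P"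
  proof (cases "p dvd n")
    case True
    then obtain m where m: "n = p * m" by (rule dvdE)
    have "\<not> q dvd m" if "q \<in> P" for q
      using n that dvd_mult[of q m p] unfolding m sieved_def by auto
    then have "m \<in> sieved P" unfolding sieved_def by simp
    then have "p * m \<in> (\<lambda>m. p * m) ` sieved P" by (rule imageI)
    then show ?thesis unfolding m by (rule UnI2)
  next
    case False
    then have "n \<in> sieved (insert p P)" using n by (simp add: sieved_def)
    then show ?thesis by (rule UnI1)
  qed
next
  fix n assume "n \<in> sieved (insert p P) \<union> (\<lambda>m. p * m) ` sieved P"
  then consider "n \<in> sieved (insert p P)" | m where "m \<in> sieved P" "n = p * m" by (elim UnE imageE)
  then show "n \<in> sieved P"
  proof cases
    case 2
    have "\<not> q dvd n" if q: "q \<in> P" for q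
    proof -
      have "q \<noteq> p" using q assms by auto
      then have "\<not> q dvd p" using primes_dvd_imp_eq[OF P[OF q] assms(1)] by auto
      moreover have "\<not> q dvd m" using 2 q by (auto simp: sieved_def)
      ultimately show ?thesis using prime_dvd_multD[OF P[OF q], of p m] 2(2) by auto
    qed
    then show ?thesis by (simp add: sieved_def)
  next
    case 1
    then show ?thesis by (simp add: sieved_def)
  qed
qed

lemma sieved_disjoint: "sieved (insert p P) \<inter> (\<lambda>m. p * m) ` sieved P = {}"
  by (auto simp: sieved_def)

lemma sieve_infsum:
  assumes s: "Re s > 1" and P: "finite P" "\<And>p. p \<in> P \<Longrightarrow> prime p"
  shows "infsum (\<lambda>n. of_nat n powr (- s)) (sieved P) = (\<Prod>p\<in>P. 1 - of_nat p powr (- s)) * zeta s"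
  using P
proof (induction P rule: finite_induct)
  case empty
  then show ?case by (simp add: zeta_eq_infsum[OF s] sieved_def)
next
  case (insert p P)
  define f where "f = (\<lambda>n::nat. of_nat n powr (- s) :: complex)"
  have f: "f summable_on A" for A unfolding f_def by (rule powr_summable_on(2)[OF s])
  have p: "prime p" using insert.prems by simp
  have P: "\<And>q. q \<in> P \<Longrightarrow> prime q" using insert.prems by simp
  define a b where "a = infsum f (sieved P)" and "b = infsum f (sieved (insert p P))"
  have mult: "f (p * m) = f p * f m" for m
    using powr_times_real[of "of_nat p" "of_nat m" "- s"] by (simp add: f_def)
  have "a = b + infsum f ((\<lambda>m. p * m) ` sieved P)"
    unfolding a_def b_def
    using sieved_step[OF p insert.hyps(2) P] infsum_Un_disjoint[OF f f sieved_disjoint, of p P] by simp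
  also have "infsum f ((\<lambda>m. p * m) ` sieved P) = infsum (\<lambda>m. f p * f m) (sieved P)"
    using prime_gt_0_nat[OF p] by (subst infsum_reindex) (simp_all add: inj_on_def o_def mult)
  also have "\<dots> = f p * a"
    unfolding a_def by (rule infsum_cmult_right[OF f])
  finally have "b = (1 - f p) * a" by (simp add: left_diff_distrib eq_diff_eq)
  moreover have "a = (\<Prod>p\<in>P. 1 - f p) * zeta s"
    using insert.IH[OF P] by (simp add: a_def f_def)
  ultimately have "b = (\<Prod>p\<in>insert p P. 1 - f p) * zeta s"
    using insert.hyps by simp
  then show ?case by (simp add: b_def f_def)
qed

text \<open>If \<open>\<zeta>(s)\<close> vanished, so would the sum over the sieved numbers for every finite set of primes. But with all
  primes up to \<open>M\<close> this sum is \<open>1\<close> plus a part of the tail of an absolutely convergent series.\<close>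

lemma zeta_nonzero_Re_gt_1:
  assumes s: "Re s > 1"
  shows "zeta s \<noteq> 0"
proof
  assume z: "zeta s = 0"
  let ?f = "\<lambda>n::nat. of_nat n powr (- s) :: complex"
  let ?g = "\<lambda>n::nat. real n powr (- Re s)"
  have n: "norm (?f n) = ?g n" for n by (cases "n = 0") (auto simp: norm_powr_real_powr)
  have gs: "?g summable_on A" for A
    by (rule summable_on_subset_banach[OF powr_summable_on(1)[OF s]]) simp
  have "summable ?g" using s by (simp add: summable_real_powr_iff)
  then obtain N where N: "norm (\<Sum>i. ?g (i + N)) < 1"
    using suminf_exist_split[of 1 ?g] by auto
  define M where "M = Suc N"
  define P where "P = {p. prime p \<and> p \<le> M}"
  have fP: "finite P" by (rule finite_subset[of _ "{..M}"]) (auto simp: P_def)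
  define A where "A = sieved P"
  have one: "1 \<in> A" by (auto simp: A_def sieved_def P_def)
  have sub: "A - {1} \<subseteq> {N..}"
  proof
    fix n assume n: "n \<in> A - {1}"
    then obtain p where p: "prime p" "p dvd n" using prime_factor_nat[of n] by auto
    have "n \<noteq> 0"
    proof
      assume "n = 0"
      moreover have "2 \<in> P \<or> M < 2" by (auto simp: P_def two_is_prime_nat)
      moreover have "M < 2 \<Longrightarrow> False"
      proof -
        assume "M < 2"
        then have "N = 0" by (simp add: M_def)
        then have "norm (\<Sum>i. ?g i) < 1" using N by simp
        moreover have "?g 1 \<le> (\<Sum>i. ?g i)"
          using sum_le_suminf[OF \<open>summable ?g\<close>, of "{1}"] by simp
        ultimately show False by simp
      qed
      ultimately show False using n by (auto simp: A_def sieved_def)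
    qed
    have "p \<notin> P" using n p by (auto simp: A_def sieved_def)
    then have "p > M" using p by (auto simp: P_def)
    moreover have "p \<le> n" using p \<open>n \<noteq> 0\<close> by (intro dvd_imp_le) auto
    ultimately show "n \<in> {N..}" by (simp add: M_def)
  qed
  have "infsum ?f A = 0" using sieve_infsum[OF s fP] z by (simp add: A_def P_def)
  moreover have "infsum ?f A = infsum ?f {1} + infsum ?f (A - {1})"
    using one by (subst infsum_Un_disjoint[symmetric]) (auto intro: powr_summable_on(2)[OF s] simp: insert_absorb)
  ultimately have "infsum ?f (A - {1}) = - 1" by (simp add: eq_neg_iff_add_eq_0 add.commute)
  then have "1 = norm (infsum ?f (A - {1}))" by simp
  also have "\<dots> \<le> infsum (\<lambda>n. norm (?f n)) (A - {1})"
    by (rule norm_infsum_bound) (unfold n, rule gs)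
  also have "\<dots> = infsum ?g (A - {1})" unfolding n ..
  also have "\<dots> \<le> infsum ?g {N..}"
    by (rule infsum_mono2[OF gs gs sub]) simp
  also have "\<dots> = infsum (\<lambda>i. ?g (i + N)) UNIV"
  proof -
    have "{N..} = (\<lambda>i. i + N) ` UNIV" by (auto simp: image_iff) (metis add.commute le_Suc_ex)
    then show ?thesis by (simp only:) (subst infsum_reindex, auto simp: o_def)
  qed
  also have "\<dots> = (\<Sum>i. ?g (i + N))"
  proof (rule sums_unique[OF has_sum_imp_sums[OF has_sum_infsum]])
    show "(\<lambda>i. ?g (i + N)) summable_on UNIV"
      using summable_ignore_initial_segment[OF \<open>summable ?g\<close>, of N]
      by (intro norm_summable_imp_summable_on) simp
  qed
  also have "\<dots> < 1" using N by simp
  finally show False by simp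
qed

section \<open>The functional equation\<close>

text \<open>The error of the trapezoidal rule for \<open>x \<mapsto> exp (-x t)\<close> on \<open>[n, n + 1]\<close>.\<close>

definition trap_exp :: "real \<Rightarrow> real \<Rightarrow> real" where
  "trap_exp n t = (exp (- (n * t)) + exp (- ((n + 1) * t))) / 2 - (exp (- (n * t)) - exp (- ((n + 1) * t))) / t"

text \<open>The error of the trapezoidal rule for \<open>x \<mapsto> x powr (-s)\<close> on \<open>[n, n + 1]\<close>. At \<open>n = 0\<close> the convention
  \<open>0 powr a = 0\<close> is the right value, since it is used for \<open>s < 0\<close> only.\<close>

definition trap_powr :: "real \<Rightarrow> real \<Rightarrow> real" where
  "trap_powr s n = (n powr (- s) + (n + 1) powr (- s)) / 2 - ((n + 1) powr (1 - s) - n powr (1 - s)) / (1 - s)"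

text \<open>The trapezoidal error is the integral of the second derivative against the Peano kernel \<open>u (1 - u) / 2\<close>.
  Its positivity is what later permits Tonelli's theorem.\<close>

lemma trap_exp_integral:
  assumes t: "t > 0"
  shows "((\<lambda>u. u * (1 - u) / 2 * exp (- ((n + u) * t))) has_integral trap_exp n t / t ^ 2) {0..1}"
proof -
  define G where "G = (\<lambda>u. - exp (- ((n + u) * t)) * (u * (1 - u) / 2 / t + (1 - 2 * u) / 2 / t ^ 2 - 1 / t ^ 3))"
  have "((\<lambda>u. u * (1 - u) / 2 * exp (- ((n + u) * t))) has_integral G 1 - G 0) {0..1}"
  proof (rule fundamental_theorem_of_calculus)
    fix x :: real
    have "(G has_real_derivative (t * exp (- ((n + x) * t))) * (x * (1 - x) / 2 / t + (1 - 2 * x) / 2 / t ^ 2 - 1 / t ^ 3)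
       - exp (- ((n + x) * t)) * ((1 - 2 * x) / 2 / t - 1 / t ^ 2)) (at x)"
    proof -
      have e: "((\<lambda>u. - exp (- ((n + u) * t))) has_real_derivative t * exp (- ((n + x) * t))) (at x)"
        by (auto intro!: derivative_eq_intros)
      have q: "((\<lambda>u. u * (1 - u) / 2 / t) has_real_derivative (1 - 2 * x) / 2 / t) (at x)"
        by (intro DERIV_cdivide) (auto intro!: derivative_eq_intros simp: field_simps)
      have q': "((\<lambda>u. (1 - 2 * u) / 2 / t ^ 2) has_real_derivative - 1 / t ^ 2) (at x)"
        by (intro DERIV_cdivide) (auto intro!: derivative_eq_intros)
      have "T + (p + - 1 / w - 0) * - E = T - E * (p - 1 / w)" for T p w E :: real
        by (simp add: algebra_simps)
      then show ?thesis unfolding G_def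
        by (rule DERIV_cong[OF DERIV_mult[OF e DERIV_diff[OF DERIV_add[OF q q'] DERIV_const]]])
    qed
    also have "(t * exp (- ((n + x) * t))) * (x * (1 - x) / 2 / t + (1 - 2 * x) / 2 / t ^ 2 - 1 / t ^ 3)
       - exp (- ((n + x) * t)) * ((1 - 2 * x) / 2 / t - 1 / t ^ 2) = x * (1 - x) / 2 * exp (- ((n + x) * t))"
    proof -
      have "t * (q / t + q1 / t ^ 2 - 1 / t ^ 3) - (q1 / t - 1 / t ^ 2) = q" for q q1
        using t by (simp add: field_simps power2_eq_square power3_eq_cube)
      from this[of "x * (1 - x) / 2" "(1 - 2 * x) / 2"] have
        "exp (- ((n + x) * t)) * (t * (x * (1 - x) / 2 / t + (1 - 2 * x) / 2 / t ^ 2 - 1 / t ^ 3) - ((1 - 2 * x) / 2 / t - 1 / t ^ 2))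
          = exp (- ((n + x) * t)) * (x * (1 - x) / 2)" by (simp only:)
      then show ?thesis by (simp only: right_diff_distrib mult_ac)
    qed
    finally show "(G has_vector_derivative x * (1 - x) / 2 * exp (- ((n + x) * t))) (at x within {0..1})"
      by (simp add: has_real_derivative_iff_has_vector_derivative has_vector_derivative_at_within)
  qed simp
  moreover have "G 1 - G 0 = trap_exp n t / t ^ 2"
    using t by (simp add: G_def trap_exp_def field_simps power2_eq_square power3_eq_cube)
  ultimately show ?thesis by simp
qed

text \<open>The Peano representation of the trapezoidal error once more. For \<open>n = 0\<close> the second derivative is singular
  at the left end, but the zero of the kernel makes it integrable and the primitive continuous.\<close>

lemma trap_powr_integral:
  assumes s: "- 1 < s" "s < 0" and n: "n = 0 \<or> n \<ge> 1"
  shows "((\<lambda>u. u * (1 - u) / 2 * (n + u) powr (- s - 2)) has_integral trap_powr s n / (s * (s + 1))) {0..1}"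
proof -
  define G where "G = (\<lambda>u. - (u * (1 - u) / 2 * (n + u) powr (- s - 1) / (s + 1))
     - (1 - 2 * u) / 2 * (n + u) powr (- s) / (s * (s + 1)) - (n + u) powr (1 - s) / (s * (s + 1) * (1 - s)))"
  have cont1: "continuous_on {0..1} (\<lambda>u. u * (1 - u) / 2 * (n + u) powr (- s - 1))"
  proof (cases "n = 0")
    case True
    have "continuous_on {0..1} (\<lambda>u. (1 - u) / 2 * u powr (- s))"
      using s by (intro continuous_intros continuous_on_powr') auto
    then show ?thesis
    proof (rule continuous_on_eq)
      fix u :: real assume "u \<in> {0..1}"
      then show "(1 - u) / 2 * u powr (- s) = u * (1 - u) / 2 * (n + u) powr (- s - 1)"
        using True by (cases "u = 0") (auto simp: powr_diff)
    qed
  next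
    case False
    then show ?thesis using n by (intro continuous_intros continuous_on_powr) auto
  qed
  have cont: "continuous_on {0..1} G"
    unfolding G_def using s n
    by (intro continuous_on_diff continuous_on_minus continuous_on_divide cont1 continuous_on_mult
        continuous_on_powr' continuous_intros) auto
  have "((\<lambda>u. u * (1 - u) / 2 * (n + u) powr (- s - 2)) has_integral G 1 - G 0) {0..1}"
  proof (rule fundamental_theorem_of_calculus_interior)
    fix u :: real assume u: "u \<in> {0<..<1}"
    then have x: "n + u > 0" using n by auto
    have d: "((\<lambda>u. (n + u) powr a) has_real_derivative a * (n + u) powr (a - 1)) (at u)" for a
      using x by (auto intro!: derivative_eq_intros)
    have q: "((\<lambda>u. u * (1 - u) / 2) has_real_derivative (1 - 2 * u) / 2) (at u)"
      by (auto intro!: derivative_eq_intros simp: field_simps)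
    have q': "((\<lambda>u. (1 - 2 * u) / 2) has_real_derivative - 1) (at u)"
      by (auto intro!: derivative_eq_intros)
    have "(G has_real_derivative
      - (((1 - 2 * u) / 2 * (n + u) powr (- s - 1) + (- s - 1) * (n + u) powr (- s - 1 - 1) * (u * (1 - u) / 2)) / (s + 1))
      - ((- 1) * (n + u) powr (- s) + (- s) * (n + u) powr (- s - 1) * ((1 - 2 * u) / 2)) / (s * (s + 1))
      - (1 - s) * (n + u) powr (1 - s - 1) / (s * (s + 1) * (1 - s))) (at u)"
      unfolding G_def by (intro DERIV_diff DERIV_minus DERIV_cdivide DERIV_mult d q q')
    also have "- (((1 - 2 * u) / 2 * (n + u) powr (- s - 1) + (- s - 1) * (n + u) powr (- s - 1 - 1) * (u * (1 - u) / 2)) / (s + 1))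
      - ((- 1) * (n + u) powr (- s) + (- s) * (n + u) powr (- s - 1) * ((1 - 2 * u) / 2)) / (s * (s + 1))
      - (1 - s) * (n + u) powr (1 - s - 1) / (s * (s + 1) * (1 - s)) = u * (1 - u) / 2 * (n + u) powr (- s - 2)"
    proof -
      have "- ((Q * A + (- s - 1) * B * R) / (s + 1)) - ((- 1) * C + (- s) * A * Q) / (s * (s + 1))
        - (1 - s) * C / (s * (s + 1) * (1 - s)) = R * B" for Q R A B C
      proof -
        have n0: "s + 1 \<noteq> 0" "s \<noteq> 0" "1 - s \<noteq> 0" using s by auto
        have "(1 - s) * C / (s * (s + 1) * (1 - s)) = C / (s * (s + 1))" using n0 by simp
        moreover have "((- 1) * C + (- s) * A * Q) / (s * (s + 1)) = - C / (s * (s + 1)) - A * Q / (s + 1)"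
          using n0 by (simp add: divide_simps)
        moreover have "(Q * A + (- s - 1) * B * R) / (s + 1) = A * Q / (s + 1) - R * B"
          using n0 by (simp add: field_simps)
        ultimately show ?thesis by simp
      qed
      moreover have "- s - 1 - 1 = - s - 2" "1 - s - 1 = - s" by simp_all
      ultimately show ?thesis by (simp only:)
    qed
    finally show "(G has_vector_derivative u * (1 - u) / 2 * (n + u) powr (- s - 2)) (at u)"
      by (simp add: has_real_derivative_iff_has_vector_derivative)
  qed (use cont in auto)
  moreover have "G 1 - G 0 = trap_powr s n / (s * (s + 1))"
  proof -
    have n0: "s + 1 \<noteq> 0" "s \<noteq> 0" "1 - s \<noteq> 0" using s by auto
    have "- 0 - (- 1 / 2) * p / (s * (s + 1)) - P / (s * (s + 1) * (1 - s)) - (- 0 - 1 / 2 * q / (s * (s + 1)) - Q / (s * (s + 1) * (1 - s)))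
      = ((q + p) / 2 - (P - Q) / (1 - s)) / (s * (s + 1))" for p q P Q
      using n0 by (simp add: divide_simps) (simp add: algebra_simps)
    from this[of "(n + 1) powr (- s)" "(n + 1) powr (1 - s)" "n powr (- s)" "n powr (1 - s)"]
    show ?thesis by (simp add: G_def trap_powr_def)
  qed
  ultimately show ?thesis by simp
qed

lemma nn_integral_Gamma_scaled:
  fixes a c :: real
  assumes "a > 0" "c > 0"
  shows "(\<integral>\<^sup>+t. ennreal (indicator {0<..} t * (t powr (a - 1) * exp (- (c * t)))) \<partial>lborel) = ennreal (Gamma a * c powr (- a))"
proof -
  let ?I = "\<integral>\<^sup>+t. ennreal (indicator {0<..} t * (t powr (a - 1) * exp (- (c * t)))) \<partial>lborel"
  have "ennreal (Gamma a) = (\<integral>\<^sup>+t. ennreal (indicator {0..} t * t powr (a - 1) / exp t) \<partial>lborel)"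
    by (rule Gamma_conv_nn_integral_real[OF assms(1)])
  also have "\<dots> = ennreal \<bar>c\<bar> * (\<integral>\<^sup>+t. ennreal (indicator {0..} (0 + c * t) * (0 + c * t) powr (a - 1) / exp (0 + c * t)) \<partial>lborel)"
    using assms by (intro nn_integral_real_affine) auto
  also have "(\<integral>\<^sup>+t. ennreal (indicator {0..} (0 + c * t) * (0 + c * t) powr (a - 1) / exp (0 + c * t)) \<partial>lborel)
     = (\<integral>\<^sup>+t. ennreal (c powr (a - 1)) * ennreal (indicator {0<..} t * (t powr (a - 1) * exp (- (c * t)))) \<partial>lborel)"
  proof (intro nn_integral_cong_AE AE_I[of _ _ "{0}"] subsetI)
    fix t assume t: "t \<in> {t \<in> space lborel. ennreal (indicator {0..} (0 + c * t) * (0 + c * t) powr (a - 1) / exp (0 + c * t))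
       \<noteq> ennreal (c powr (a - 1)) * ennreal (indicator {0<..} t * (t powr (a - 1) * exp (- (c * t))))}"
    show "t \<in> {0}"
    proof (rule ccontr)
      assume "t \<notin> {0}"
      then consider "t > 0" | "t < 0" by force
      then show False
      proof cases
        case 1
        then show False using t assms by (simp add: ennreal_mult[symmetric] powr_mult exp_minus field_simps)
      next
        case 2
        then have "c * t < 0" using assms by (simp add: mult_pos_neg)
        then show False using t 2 by simp
      qed
    qed
  qed auto
  also have "\<dots> = ennreal (c powr (a - 1)) * ?I" by (intro nn_integral_cmult) auto
  finally have "ennreal (Gamma a) = ennreal (c * c powr (a - 1)) * ?I"
    using assms by (simp add: ennreal_mult mult.assoc)
  also have "c * c powr (a - 1) = c powr a" using assms by (simp add: powr_diff)
  finally have "ennreal (c powr (- a)) * ennreal (Gamma a) = ennreal (c powr (- a)) * (ennreal (c powr a) * ?I)" by simp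
  also have "\<dots> = ?I" using assms
    by (simp add: mult.assoc[symmetric] ennreal_mult[symmetric] flip: powr_add)
  finally show ?thesis using assms Gamma_real_pos[of a] by (simp add: ennreal_mult[symmetric] mult.commute)
qed

text \<open>Substituting \<open>w = t\<^sup>2\<close> turns the scaled Gamma integral into this one.\<close>

lemma nn_integral_Gaussian_moment:
  fixes a v :: real
  assumes a: "a > 0" and v: "v > 0"
  shows "(\<integral>\<^sup>+t. ennreal (indicator {0<..} t * (t powr (2 * a - 1) * exp (- (v * t ^ 2)))) \<partial>lborel) = ennreal (Gamma a * v powr (- a) / 2)"
proof -
  let ?f = "\<lambda>w. w powr (a - 1) * exp (- (v * w))"
  have G0: "Gamma a * v powr (- a) \<ge> 0" using Gamma_real_pos[OF a] by simp
  have "((\<lambda>t. indicator {0<..} t * ?f t) has_integral Gamma a * v powr (- a)) UNIV"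
    by (rule nn_integral_has_integral) (use nn_integral_Gamma_scaled[OF a v] G0 in auto)
  then have hi: "(?f has_integral Gamma a * v powr (- a)) {0<..}"
  proof -
    have "(\<lambda>t. indicator {0<..} t * ?f t) = (\<lambda>t. if t \<in> {0<..} then ?f t else 0)" by (auto simp: fun_eq_iff)
    with \<open>((\<lambda>t. indicator {0<..} t * ?f t) has_integral Gamma a * v powr (- a)) UNIV\<close>
    show ?thesis by (simp only: has_integral_restrict_UNIV)
  qed
  have img: "(\<lambda>x::real. x ^ 2) ` {0<..} = {0<..}"
  proof (intro equalityI subsetI)
    fix y :: real assume "y \<in> {0<..}"
    then show "y \<in> (\<lambda>x. x ^ 2) ` {0<..}" by (intro image_eqI[of _ _ "sqrt y"]) auto
  qed auto
  have "?f absolutely_integrable_on {0<..}"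
    using hi by (intro nonnegative_absolutely_integrable_1) auto
  then have "?f absolutely_integrable_on (\<lambda>x::real. x ^ 2) ` {0<..} \<and> integral ((\<lambda>x::real. x ^ 2) ` {0<..}) ?f = Gamma a * v powr (- a)"
    using hi by (simp add: img integral_unique)
  then have "(\<lambda>x. \<bar>2 * x\<bar> * ?f (x ^ 2)) absolutely_integrable_on {0<..} \<and> integral {0<..} (\<lambda>x. \<bar>2 * x\<bar> * ?f (x ^ 2)) = Gamma a * v powr (- a)"
    by (subst has_absolute_integral_change_of_variables_1'[where g = "\<lambda>x. x ^ 2"])
       (auto intro!: derivative_eq_intros simp: inj_on_def power2_eq_iff)
  then have "((\<lambda>x. \<bar>2 * x\<bar> * ?f (x ^ 2)) has_integral Gamma a * v powr (- a)) {0<..}"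
    using set_lebesgue_integral_eq_integral(1) by (blast intro: has_integral_integrable_integral[THEN iffD2])
  then have "((\<lambda>x. \<bar>2 * x\<bar> * ?f (x ^ 2) / 2) has_integral Gamma a * v powr (- a) / 2) {0<..}"
    by (rule has_integral_divide)
  then have "((\<lambda>x. x powr (2 * a - 1) * exp (- (v * x ^ 2))) has_integral Gamma a * v powr (- a) / 2) {0<..}"
  proof (rule has_integral_eq[rotated])
    fix x :: real assume x: "x \<in> {0<..}"
    have "1 + (2 * a - 2) = 2 * a - 1" by simp
    then have "x * x powr (2 * a - 2) = x powr (2 * a - 1)"
      using x powr_add[of x 1 "2 * a - 2"] by simp
    moreover have "(x ^ 2) powr (a - 1) = x powr (2 * a - 2)"
      using x powr_powr[of x 2 "a - 1"] powr_realpow[of x 2] by (simp add: right_diff_distrib)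
    ultimately show "\<bar>2 * x\<bar> * ?f (x ^ 2) / 2 = x powr (2 * a - 1) * exp (- (v * x ^ 2))" using x by simp
  qed
  from nn_integral_has_integral_lebesgue[OF _ this] show ?thesis by simp
qed

text \<open>The logarithmic derivative of the reflection formula, multiplied by \<open>sin (\<pi> z)\<close>.\<close>

lemma Digamma_reflection_cot:
  fixes z :: complex
  assumes z: "z \<notin> \<int>"
  shows "(Digamma (1 - z) - Digamma z) * sin (of_real pi * z) = of_real pi * cos (of_real pi * z)"
proof -
  have z1: "z \<notin> \<int>\<^sub>\<le>\<^sub>0" using z nonpos_Ints_Int by blast
  have "1 - z \<notin> \<int>" using z by (metis Ints_1 Ints_diff diff_diff_eq2 add_diff_cancel_left')
  then have z2: "1 - z \<notin> \<int>\<^sub>\<le>\<^sub>0" using nonpos_Ints_Int by blast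
  have "((\<lambda>w. rGamma w * rGamma (1 - w)) has_field_derivative
      (- rGamma z * Digamma z) * rGamma (1 - z) + ((- rGamma (1 - z) * Digamma (1 - z)) * (0 - 1)) * rGamma z) (at z)"
    by (intro DERIV_mult has_field_derivative_rGamma_no_nonpos_int z1
        DERIV_chain2[where f = rGamma and g = "\<lambda>w. 1 - w"] z2 DERIV_diff DERIV_const DERIV_ident)
  moreover have "((\<lambda>w. sin (of_real pi * w) / of_real pi) has_field_derivative
      cos (of_real pi * z) * of_real pi / of_real pi) (at z)"
    by (auto intro!: derivative_eq_intros)
  ultimately have "(- rGamma z * Digamma z) * rGamma (1 - z) + ((- rGamma (1 - z) * Digamma (1 - z)) * (0 - 1)) * rGamma z
     = cos (of_real pi * z) * of_real pi / of_real pi"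
    unfolding rGamma_reflection_complex by (rule DERIV_unique)
  then have "rGamma z * rGamma (1 - z) * (Digamma (1 - z) - Digamma z) = cos (of_real pi * z)"
    by (simp add: algebra_simps)
  then show ?thesis unfolding rGamma_reflection_complex by (simp add: field_simps)
qed

text \<open>At \<open>z = ia\<close> the series of \<open>\<psi>(1 + z) - \<psi>(1 - z)\<close> is, up to the factor \<open>\<i>\<close>, the one on the left, and the
  reflection formula evaluates the difference.\<close>

lemma coth_partial_fractions:
  fixes a :: real
  assumes a: "a > 0"
  shows "(\<lambda>k. 2 * a / (real (Suc k) ^ 2 + a ^ 2)) sums (pi * cosh (pi * a) / sinh (pi * a) - 1 / a)"
proof -
  define z where "z = \<i> * complex_of_real a"
  have zn: "z \<notin> \<int>" using a by (auto simp: z_def complex_is_Int_iff)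
  have zp: "1 + z \<noteq> 0" "1 - z \<noteq> 0" "z \<noteq> 0" using a by (auto simp: z_def complex_eq_iff)
  have D: "(\<lambda>k. inverse (of_nat (Suc k)) - inverse (w + of_nat k)) sums (Digamma w + euler_mascheroni)"
    if "w \<noteq> 0" for w :: complex
    using summable_sums[OF summable_Digamma[OF that]] by (simp add: Digamma_def)
  have "(\<lambda>k. (inverse (of_nat (Suc k)) - inverse ((1 + z) + of_nat k)) - (inverse (of_nat (Suc k)) - inverse ((1 - z) + of_nat k)))
     sums ((Digamma (1 + z) + euler_mascheroni) - (Digamma (1 - z) + euler_mascheroni))"
    by (intro sums_diff D zp)
  moreover have "(inverse (of_nat (Suc k)) - inverse ((1 + z) + of_nat k)) - (inverse (of_nat (Suc k)) - inverse ((1 - z) + of_nat k))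
     = \<i> * of_real (2 * a / (real (Suc k) ^ 2 + a ^ 2))" for k
  proof -
    define m where "m = complex_of_nat (Suc k)"
    have m: "m + z \<noteq> 0" "m - z \<noteq> 0" using a by (auto simp: z_def m_def complex_eq_iff)
    have "m ^ 2 + of_real a ^ 2 = (m + z) * (m - z)" by (simp add: z_def algebra_simps power2_eq_square)
    then have "inverse (m - z) - inverse (m + z) = 2 * z / (m ^ 2 + of_real a ^ 2)"
      using m by (simp add: field_simps)
    moreover have "(1 + z) + of_nat k = m + z" "(1 - z) + of_nat k = m - z" by (simp_all add: m_def)
    ultimately have "(inverse m - inverse ((1 + z) + of_nat k)) - (inverse m - inverse ((1 - z) + of_nat k))
        = 2 * z / (m ^ 2 + of_real a ^ 2)" by (simp only:) simp
    then show ?thesis by (simp add: m_def z_def)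
  qed
  ultimately have S: "(\<lambda>k. \<i> * of_real (2 * a / (real (Suc k) ^ 2 + a ^ 2))) sums (Digamma (1 + z) - Digamma (1 - z))"
    by simp
  have pa: "pi * a > 0" using a by simp
  have "Digamma (1 + z) = Digamma z + 1 / z" using Digamma_plus1[OF zp(3)] by (simp add: add.commute)
  moreover have iz: "\<i> * (of_real pi * z) = of_real (- (pi * a))" by (simp add: z_def complex_eq_iff)
  have sn: "sin (of_real pi * z) = \<i> * of_real (sinh (pi * a))"
    unfolding sin_exp_eq iz sinh_field_def of_real_minus[symmetric] exp_of_real by (simp add: field_simps)
  have cs: "cos (of_real pi * z) = of_real (cosh (pi * a))"
    unfolding cos_exp_eq iz cosh_field_def of_real_minus[symmetric] exp_of_real by (simp add: field_simps)
  have sh: "sinh (pi * a) \<noteq> 0" using a by simp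
  have "Digamma (1 - z) - Digamma z = of_real pi * of_real (cosh (pi * a)) / (\<i> * of_real (sinh (pi * a)))"
    using Digamma_reflection_cot[OF zn] sh unfolding sn cs by (simp add: eq_divide_eq)
  moreover have "1 / z = - \<i> / of_real a" using a by (simp add: z_def field_simps)
  ultimately have "Digamma (1 + z) - Digamma (1 - z) = - (of_real pi * of_real (cosh (pi * a)) / (\<i> * of_real (sinh (pi * a)))) - \<i> / of_real a"
    by (simp add: algebra_simps)
  also have "\<dots> = \<i> * of_real (pi * cosh (pi * a) / sinh (pi * a) - 1 / a)"
    using sh a by (simp add: field_simps)
  finally have "Digamma (1 + z) - Digamma (1 - z) = \<i> * of_real (pi * cosh (pi * a) / sinh (pi * a) - 1 / a)" .
  with S have "(\<lambda>k. \<i> * of_real (2 * a / (real (Suc k) ^ 2 + a ^ 2))) sums (\<i> * of_real (pi * cosh (pi * a) / sinh (pi * a) - 1 / a))"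
    by simp
  from sums_Im[OF this] show ?thesis by simp
qed

lemma trapezoid_laplace_partial_fractions:
  fixes t :: real
  assumes t: "t > 0"
  shows "(\<lambda>k. 2 * t / (t ^ 2 + (2 * pi * real (Suc k)) ^ 2)) sums (1 / (exp t - 1) + 1 / 2 - 1 / t)"
proof -
  define a where "a = t / (2 * pi)"
  have a: "a > 0" "t = 2 * pi * a" using t by (simp_all add: a_def)
  have "(\<lambda>k. (1 / (2 * pi)) * (2 * a / (real (Suc k) ^ 2 + a ^ 2))) sums ((1 / (2 * pi)) * (pi * cosh (pi * a) / sinh (pi * a) - 1 / a))"
    by (intro sums_mult coth_partial_fractions a)
  moreover have "(1 / (2 * pi)) * (2 * a / (real (Suc k) ^ 2 + a ^ 2)) = 2 * t / (t ^ 2 + (2 * pi * real (Suc k)) ^ 2)" for k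
  proof -
    have "t ^ 2 + (2 * pi * real (Suc k)) ^ 2 = 4 * pi ^ 2 * (real (Suc k) ^ 2 + a ^ 2)"
      by (simp add: a(2) power2_eq_square algebra_simps)
    moreover have "real (Suc k) ^ 2 + a ^ 2 > 0" by (intro add_pos_nonneg) auto
    ultimately show ?thesis by (simp only: a(2)) (simp add: divide_simps power2_eq_square)
  qed
  moreover have "(1 / (2 * pi)) * (pi * cosh (pi * a) / sinh (pi * a) - 1 / a) = 1 / (exp t - 1) + 1 / 2 - 1 / t"
  proof -
    define E where "E = exp (pi * a)"
    have E: "E > 1" using a by (simp add: E_def)
    have et: "exp t = E ^ 2" by (simp add: E_def a(2) power2_eq_square flip: exp_add)
    have E2: "E ^ 2 > 1" using E by (simp add: one_less_power)
    have "cosh (pi * a) / sinh (pi * a) = (E + 1 / E) / (E - 1 / E)"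
    proof -
      have "x / 2 / (y / 2) = x / y" for x y :: real by simp
      then show ?thesis
        unfolding cosh_field_def sinh_field_def exp_minus E_def[symmetric] inverse_eq_divide .
    qed
    also have "\<dots> = (E ^ 2 + 1) / (E ^ 2 - 1)"
      using E E2 by (simp add: divide_simps power2_eq_square)
    also have "\<dots> = 1 + 2 / (E ^ 2 - 1)" using E2 by (simp add: field_simps)
    finally have c: "cosh (pi * a) / sinh (pi * a) = 1 + 2 / (E ^ 2 - 1)" .
    have "(1 / (2 * pi)) * (pi * cosh (pi * a) / sinh (pi * a) - 1 / a)
       = (1 / 2) * (cosh (pi * a) / sinh (pi * a)) - 1 / (2 * pi * a)" using a by (simp add: right_diff_distrib)
    then show ?thesis unfolding et c a(2)[symmetric] by simp
  qed
  ultimately show ?thesis by simp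
qed

text \<open>Write \<open>1 / (t\<^sup>2 + c\<^sup>2)\<close> as the integral of \<open>exp (- v (t\<^sup>2 + c\<^sup>2))\<close> over \<open>v > 0\<close> and integrate over \<open>t\<close> first.\<close>

lemma nn_integral_powr_div_square:
  fixes s c :: real
  assumes s: "- 1 < s" "s < 0" and c: "c > 0"
  shows "(\<integral>\<^sup>+t. ennreal (indicator {0<..} t * (t powr s / (t ^ 2 + c ^ 2))) \<partial>lborel)
     = ennreal (Gamma ((1 + s) / 2) * Gamma ((1 - s) / 2) / 2 * c powr (s - 1))"
proof -
  let ?K = "\<lambda>t v. ennreal (indicator {0<..} t * indicator {0<..} v * (t powr s * exp (- ((t ^ 2 + c ^ 2) * v))))"
  define a where "a = (1 + s) / 2"
  have a: "a > 0" "1 - a > 0" "2 * a - 1 = s" "1 - a = (1 - s) / 2" using s by (auto simp: a_def field_simps)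
  have Ga: "Gamma a > 0" "Gamma (1 - a) > 0" using a by (auto intro: Gamma_real_pos)
  have "(\<integral>\<^sup>+t. ennreal (indicator {0<..} t * (t powr s / (t ^ 2 + c ^ 2))) \<partial>lborel)
    = (\<integral>\<^sup>+t. (\<integral>\<^sup>+v. ?K t v \<partial>lborel) \<partial>lborel)"
  proof (rule nn_integral_cong)
    fix t :: real
    have p: "t ^ 2 + c ^ 2 > 0" using c by (intro add_nonneg_pos) auto
    have "(\<integral>\<^sup>+v. ?K t v \<partial>lborel)
      = (\<integral>\<^sup>+v. ennreal (indicator {0<..} t * t powr s) * ennreal (indicator {0<..} v * (v powr (1 - 1) * exp (- ((t ^ 2 + c ^ 2) * v)))) \<partial>lborel)"
      by (intro nn_integral_cong) (auto simp: indicator_def ennreal_mult[symmetric])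
    also have "\<dots> = ennreal (indicator {0<..} t * t powr s) * ennreal (Gamma 1 * (t ^ 2 + c ^ 2) powr (- 1))"
      by (subst nn_integral_cmult) (simp_all only: nn_integral_Gamma_scaled[OF zero_less_one p], simp)
    also have "\<dots> = ennreal (indicator {0<..} t * (t powr s / (t ^ 2 + c ^ 2)))"
      using p by (auto simp: ennreal_mult[symmetric] powr_minus divide_inverse indicator_def)
    finally show "ennreal (indicator {0<..} t * (t powr s / (t ^ 2 + c ^ 2))) = (\<integral>\<^sup>+v. ?K t v \<partial>lborel)" ..
  qed
  also have "\<dots> = (\<integral>\<^sup>+v. (\<integral>\<^sup>+t. ?K t v \<partial>lborel) \<partial>lborel)"
    by (rule lborel_pair.Fubini') simp
  also have "\<dots> = (\<integral>\<^sup>+v. ennreal (Gamma a / 2) * ennreal (indicator {0<..} v * (v powr ((1 - a) - 1) * exp (- (c ^ 2 * v)))) \<partial>lborel)"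
  proof (rule nn_integral_cong)
    fix v :: real
    show "(\<integral>\<^sup>+t. ?K t v \<partial>lborel)
       = ennreal (Gamma a / 2) * ennreal (indicator {0<..} v * (v powr ((1 - a) - 1) * exp (- (c ^ 2 * v))))"
    proof (cases "v > 0")
      case True
      have "(\<integral>\<^sup>+t. ?K t v \<partial>lborel)
        = (\<integral>\<^sup>+t. ennreal (exp (- (c ^ 2 * v))) * ennreal (indicator {0<..} t * (t powr (2 * a - 1) * exp (- (v * t ^ 2)))) \<partial>lborel)"
      proof (rule nn_integral_cong)
        fix t :: real
        have "exp (- ((t ^ 2 + c ^ 2) * v)) = exp (- (c ^ 2 * v)) * exp (- (v * t ^ 2))"
          by (simp add: exp_add[symmetric] algebra_simps)
        then show "?K t v
          = ennreal (exp (- (c ^ 2 * v))) * ennreal (indicator {0<..} t * (t powr (2 * a - 1) * exp (- (v * t ^ 2))))"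
          unfolding a(3) using True by (simp add: ennreal_mult[symmetric] mult_ac)
      qed
      also have "\<dots> = ennreal (exp (- (c ^ 2 * v))) * ennreal (Gamma a * v powr (- a) / 2)"
        by (subst nn_integral_cmult) (simp_all only: nn_integral_Gaussian_moment[OF a(1) True], simp)
      finally show ?thesis using True Ga by (simp add: ennreal_mult[symmetric] mult_ac)
    qed simp
  qed
  also have "\<dots> = ennreal (Gamma a / 2) * ennreal (Gamma (1 - a) * (c ^ 2) powr (- (1 - a)))"
    using c by (subst nn_integral_cmult) (simp_all only: nn_integral_Gamma_scaled[OF a(2), of "c ^ 2"] zero_less_power, simp)
  also have "\<dots> = ennreal (Gamma ((1 + s) / 2) * Gamma ((1 - s) / 2) / 2 * c powr (s - 1))"
  proof -
    have "2 * (- (1 - a)) = s - 1" by (simp add: a_def)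
    then have "(c ^ 2) powr (- (1 - a)) = c powr (s - 1)"
      using c powr_powr[of c 2 "- (1 - a)"] powr_realpow[of c 2] by (simp only: of_nat_numeral)
    moreover have "Gamma a = Gamma ((1 + s) / 2)" "Gamma (1 - a) = Gamma ((1 - s) / 2)"
      unfolding a(4) by (simp_all add: a_def)
    ultimately show ?thesis using Ga by (simp add: ennreal_mult[symmetric] mult_ac)
  qed
  finally show ?thesis .
qed

text \<open>Summed over \<open>n\<close>, the trapezoidal sums form a geometric series and the integrals add up to \<open>1/t\<close>.\<close>

lemma trap_exp_nonneg_sums:
  assumes t: "t > 0"
  shows "trap_exp n t \<ge> 0"
    and "(\<lambda>n. trap_exp (real n) t) sums (1 / (exp t - 1) + 1 / 2 - 1 / t)"
proof -
  have "trap_exp n t / t ^ 2 \<ge> 0"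
    by (rule has_integral_nonneg[OF trap_exp_integral[OF t]]) auto
  then show "trap_exp n t \<ge> 0" using t by (simp add: zero_le_divide_iff)
  define r where "r = exp (- t)"
  have r: "r > 0" "r < 1" using t by (auto simp: r_def)
  have e: "exp (- (real n * t)) = r ^ n" for n by (simp add: r_def flip: exp_of_nat_mult)
  have e1: "exp (- ((real n + 1) * t)) = r ^ Suc n" for n
    using e[of "Suc n"] by (simp add: algebra_simps)
  have "(\<lambda>n. ((1 + r) / 2 - (1 - r) / t) * r ^ n) sums (((1 + r) / 2 - (1 - r) / t) * (1 / (1 - r)))"
    using r by (intro sums_mult geometric_sums) auto
  moreover have "((1 + r) / 2 - (1 - r) / t) * r ^ n = trap_exp (real n) t" for n
    unfolding trap_exp_def e e1 by (simp add: diff_divide_distrib add_divide_distrib algebra_simps)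
  moreover have "((1 + r) / 2 - (1 - r) / t) * (1 / (1 - r)) = 1 / (exp t - 1) + 1 / 2 - 1 / t"
  proof -
    have E: "exp t = 1 / r" by (simp add: r_def exp_minus inverse_eq_divide)
    have "1 / (1 / r - 1) = r / (1 - r)" using r by (simp add: field_simps)
    moreover have "((1 + r) / 2) * (1 / (1 - r)) = r / (1 - r) + 1 / 2" using r by (simp add: field_simps)
    moreover have "(P - (1 - r) / t) * (1 / (1 - r)) = P * (1 / (1 - r)) - 1 / t" for P
    proof -
      have "(1 - r) / t * (1 / (1 - r)) = 1 / t" using r by simp
      then show ?thesis by (simp only: left_diff_distrib)
    qed
    ultimately show ?thesis unfolding E by (simp only:)
  qed
  ultimately show "(\<lambda>n. trap_exp (real n) t) sums (1 / (exp t - 1) + 1 / 2 - 1 / t)" by simp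
qed

text \<open>Both trapezoidal errors are integrals against the same Peano kernel, and the Gamma integral carries
  \<open>t\<^sup>2 exp (-x t)\<close>, the second derivative of the exponential, to \<open>\<Gamma>(s + 2) x powr (- s - 2)\<close>.\<close>

lemma trap_powr_Laplace:
  fixes s n :: real
  assumes s: "- 1 < s" "s < 0" and n: "n = 0 \<or> n \<ge> 1"
  shows "(\<integral>\<^sup>+t. ennreal (indicator {0<..} t * (t powr (s - 1) * trap_exp n t)) \<partial>lborel)
    = ennreal (Gamma (s + 2) * (trap_powr s n / (s * (s + 1))))"
proof -
  have G: "Gamma (s + 2) > 0" using s by (intro Gamma_real_pos) auto
  let ?K = "\<lambda>t u. indicator {0<..} t * indicator {0<..<1} u * (t powr (s + 1) * (u * (1 - u) / 2 * exp (- ((n + u) * t))))"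
  have "(\<integral>\<^sup>+t. ennreal (indicator {0<..} t * (t powr (s - 1) * trap_exp n t)) \<partial>lborel)
    = (\<integral>\<^sup>+t. (\<integral>\<^sup>+u. ennreal (?K t u) \<partial>lborel) \<partial>lborel)"
  proof (rule nn_integral_cong)
    fix t :: real
    show "ennreal (indicator {0<..} t * (t powr (s - 1) * trap_exp n t)) = (\<integral>\<^sup>+u. ennreal (?K t u) \<partial>lborel)"
    proof (cases "t > 0")
      case True
      have "((\<lambda>u. u * (1 - u) / 2 * exp (- ((n + u) * t))) has_integral trap_exp n t / t ^ 2) {0<..<1}"
        using trap_exp_integral[OF True] has_integral_Icc_iff_Ioo by blast
      then have "(\<integral>\<^sup>+u. ennreal (indicator {0<..<1} u * (u * (1 - u) / 2 * exp (- ((n + u) * t)))) \<partial>lborel) = ennreal (trap_exp n t / t ^ 2)"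
        by (intro nn_integral_has_integral_lebesgue) auto
      moreover have "(\<integral>\<^sup>+u. ennreal (?K t u) \<partial>lborel) = ennreal (t powr (s + 1)) * (\<integral>\<^sup>+u. ennreal (indicator {0<..<1} u * (u * (1 - u) / 2 * exp (- ((n + u) * t)))) \<partial>lborel)"
        using True by (subst nn_integral_cmult[symmetric]) (auto intro!: nn_integral_cong simp: ennreal_mult'[symmetric] indicator_def)
      moreover have "t powr (s + 1) * (trap_exp n t / t ^ 2) = t powr (s - 1) * trap_exp n t"
        using True by (simp add: powr_add powr_diff power2_eq_square)
      ultimately show ?thesis using True by (simp add: ennreal_mult'[symmetric])
    qed simp
  qed
  also have "\<dots> = (\<integral>\<^sup>+u. (\<integral>\<^sup>+t. ennreal (?K t u) \<partial>lborel) \<partial>lborel)"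
    by (rule lborel_pair.Fubini') simp
  also have "\<dots> = (\<integral>\<^sup>+u. ennreal (Gamma (s + 2)) * ennreal (indicator {0<..<1} u * (u * (1 - u) / 2 * (n + u) powr (- s - 2))) \<partial>lborel)"
  proof (rule nn_integral_cong)
    fix u :: real
    show "(\<integral>\<^sup>+t. ennreal (?K t u) \<partial>lborel) = ennreal (Gamma (s + 2)) * ennreal (indicator {0<..<1} u * (u * (1 - u) / 2 * (n + u) powr (- s - 2)))"
    proof (cases "u \<in> {0<..<1}")
      case True
      then have nu: "n + u > 0" using n by auto
      have "(\<integral>\<^sup>+t. ennreal (?K t u) \<partial>lborel) = (\<integral>\<^sup>+t. ennreal (u * (1 - u) / 2) * ennreal (indicator {0<..} t * (t powr ((s + 2) - 1) * exp (- ((n + u) * t)))) \<partial>lborel)"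
      proof (rule nn_integral_cong)
        fix t :: real
        have "s + 2 - 1 = s + 1" by simp
        then show "ennreal (?K t u) = ennreal (u * (1 - u) / 2) * ennreal (indicator {0<..} t * (t powr ((s + 2) - 1) * exp (- ((n + u) * t))))"
          using True by (simp only:) (simp add: ennreal_mult[symmetric] mult_ac)
      qed
      also have "\<dots> = ennreal (u * (1 - u) / 2) * ennreal (Gamma (s + 2) * (n + u) powr (- (s + 2)))"
        using s by (subst nn_integral_cmult) (simp_all only: nn_integral_Gamma_scaled[OF _ nu], simp_all add: nn_integral_Gamma_scaled[OF _ nu])
      finally show ?thesis using True G by (simp add: ennreal_mult[symmetric] mult_ac)
    qed simp
  qed
  also have "\<dots> = ennreal (Gamma (s + 2)) * (\<integral>\<^sup>+u. ennreal (indicator {0<..<1} u * (u * (1 - u) / 2 * (n + u) powr (- s - 2))) \<partial>lborel)"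
    by (rule nn_integral_cmult) simp
  also have "(\<integral>\<^sup>+u. ennreal (indicator {0<..<1} u * (u * (1 - u) / 2 * (n + u) powr (- s - 2))) \<partial>lborel) = ennreal (trap_powr s n / (s * (s + 1)))"
    using trap_powr_integral[OF s n] has_integral_Icc_iff_Ioo by (intro nn_integral_has_integral_lebesgue) auto
  finally show ?thesis using G by (simp add: ennreal_mult'[symmetric])
qed

text \<open>The trapezoidal errors differ from the Euler--Maclaurin errors of third order by terms that telescope;
  for \<open>s < 0\<close> the step from \<open>0\<close> to \<open>1\<close> supplies the terms \<open>1/2 + 1/(s - 1)\<close>.\<close>

lemma zeta_trapezoid:
  assumes s: "- 1 < s" "s < 0"
  shows "(\<lambda>n. complex_of_real (trap_powr s (real n))) sums zeta (of_real s)"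
proof -
  let ?s = "complex_of_real s"
  have s1: "?s \<noteq> 1" using s by (simp add: complex_eq_iff)
  have E: "(\<lambda>k. em_term ?s (real (1 + k))) sums (zeta ?s - em_head 1 ?s)"
    using s s1 by (intro zeta_euler_maclaurin) auto
  have lim: "(\<lambda>n. complex_of_nat (Suc n) powr (- ?s - 1)) \<longlonglongrightarrow> 0"
    by (rule LIMSEQ_Suc[OF powr_of_nat_tendsto_0]) (use s in auto)
  have "(\<lambda>k. complex_of_nat (Suc (Suc k)) powr (- ?s - 1) - complex_of_nat (Suc k) powr (- ?s - 1)) sums (0 - complex_of_nat (Suc 0) powr (- ?s - 1))"
    by (rule telescope_sums[OF lim])
  from sums_diff[OF E sums_divide[OF sums_mult[OF this, of ?s], of 12]]
  have S: "(\<lambda>k. em_term ?s (real (1 + k)) - ?s * (complex_of_nat (Suc (Suc k)) powr (- ?s - 1) - complex_of_nat (Suc k) powr (- ?s - 1)) / 12)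
     sums (zeta ?s - em_head 1 ?s - ?s * (0 - complex_of_nat (Suc 0) powr (- ?s - 1)) / 12)" .
  have P: "complex_of_nat k powr of_real b = of_real (real k powr b)" for k b
    using powr_of_real[of "real k" b] by simp
  have m: "- ?s - 1 = of_real (- s - 1)" "- ?s = of_real (- s)" "1 - ?s = of_real (1 - s)" by simp_all
  have e1: "em_term ?s (real (1 + k)) - ?s * (complex_of_nat (Suc (Suc k)) powr (- ?s - 1) - complex_of_nat (Suc k) powr (- ?s - 1)) / 12
     = complex_of_real (trap_powr s (real (Suc k)))" for k
  proof -
    have "em_term ?s (real (1 + k)) - ?s * (complex_of_nat (Suc (Suc k)) powr (- ?s - 1) - complex_of_nat (Suc k) powr (- ?s - 1)) / 12
      = (complex_of_nat (Suc k) powr (- ?s) + complex_of_nat (Suc (Suc k)) powr (- ?s)) / 2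
       - (complex_of_nat (Suc (Suc k)) powr (1 - ?s) - complex_of_nat (Suc k) powr (1 - ?s)) / (1 - ?s)"
      unfolding em_term_of_nat by (simp del: of_nat_Suc)
    also have "\<dots> = complex_of_real (trap_powr s (real (Suc k)))"
      unfolding m P trap_powr_def by (simp add: add.commute)
    finally show ?thesis .
  qed
  have e2: "zeta ?s - em_head 1 ?s - ?s * (0 - complex_of_nat (Suc 0) powr (- ?s - 1)) / 12 = zeta ?s - complex_of_real (trap_powr s (real 0))"
  proof -
    have "1 / (?s - 1) = - (1 / (1 - ?s))" by (metis minus_diff_eq divide_minus_right)
    then show ?thesis using s by (simp add: em_head_def trap_powr_def)
  qed
  have "(\<lambda>k. complex_of_real (trap_powr s (real (Suc k)))) sums (zeta ?s - complex_of_real (trap_powr s (real 0)))"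
    using S unfolding e1 e2 .
  then show ?thesis by (subst (asm) sums_Suc_iff) simp
qed

text \<open>Both sides are values of \<open>\<integral> t powr (s-1) * (1/(exp t - 1) + 1/2 - 1/t)\<close>: the sequence \<open>A\<close> comes from
  expanding the bracket into trapezoidal errors, the sequence \<open>B\<close> from expanding it into partial fractions.\<close>

lemma zeta_functional_equation_real:
  assumes s: "- 1 < s" "s < 0"
  shows "of_real (Gamma s) * zeta (of_real s)
    = of_real ((2 * pi) powr (s - 1) * Gamma ((1 + s) / 2) * Gamma ((1 - s) / 2)) * zeta (1 - of_real s)"
proof -
  let ?P = "\<lambda>t k. 2 * (indicator {0<..} t * (t powr s / (t ^ 2 + (2 * pi * real (Suc k)) ^ 2)))"
  define G where "G = Gamma ((1 + s) / 2) * Gamma ((1 - s) / 2)"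
  have G0: "G > 0" using s by (auto simp: G_def intro!: mult_pos_pos Gamma_real_pos)
  have ss: "s * (s + 1) < 0" using s by (intro mult_neg_pos) auto
  have Gs: "Gamma (s + 2) = s * (s + 1) * Gamma s"
  proof -
    have "s \<notin> \<int>\<^sub>\<le>\<^sub>0" "s + 1 \<notin> \<int>\<^sub>\<le>\<^sub>0"
      using s by (auto elim!: nonpos_Ints_cases)
    then show ?thesis using Gamma_plus1[of s] Gamma_plus1[of "s + 1"] by (simp add: add.commute mult_ac)
  qed
  have G2: "Gamma (s + 2) > 0" using s by (intro Gamma_real_pos) auto
  define A where "A = (\<lambda>n. Gamma (s + 2) * (trap_powr s (real n) / (s * (s + 1))))"
  define B where "B = (\<lambda>k. G * (2 * pi * real (Suc k)) powr (s - 1))"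
  have "trap_powr s (real n) / (s * (s + 1)) \<ge> 0" for n
    by (rule has_integral_nonneg[OF trap_powr_integral[OF s]]) auto
  then have A0: "A n \<ge> 0" for n unfolding A_def using G2 by (intro mult_nonneg_nonneg) auto
  have B0: "B k \<ge> 0" for k using G0 by (simp add: B_def)
  have Aeq: "A n = Gamma s * trap_powr s (real n)" for n
    using ss by (auto simp: A_def Gs)
  have "summable (\<lambda>n. trap_powr s (real n))"
    using zeta_trapezoid[OF s] by (metis sums_summable summable_of_real_iff)
  then have As: "summable A" unfolding Aeq[abs_def] by (rule summable_mult)
  have "summable (\<lambda>n. real n powr (s - 1))" using s by (simp add: summable_real_powr_iff)
  then have "summable (\<lambda>n. real (Suc n) powr (s - 1))" by (subst summable_Suc_iff)
  then have "summable (\<lambda>n. G * (2 * pi) powr (s - 1) * real (Suc n) powr (s - 1))" by (rule summable_mult)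
  moreover have Beq: "B k = G * (2 * pi) powr (s - 1) * real (Suc k) powr (s - 1)" for k
    unfolding B_def by (subst powr_mult) auto
  then have "B = (\<lambda>k. G * (2 * pi) powr (s - 1) * real (Suc k) powr (s - 1))" by (rule ext)
  ultimately have Bs: "summable B" by simp
  have "ennreal (suminf A) = (\<Sum>n. ennreal (A n))" using A0 As by (simp add: suminf_ennreal2)
  also have "\<dots> = (\<Sum>n. \<integral>\<^sup>+t. ennreal (indicator {0<..} t * (t powr (s - 1) * trap_exp (real n) t)) \<partial>lborel)"
    unfolding A_def by (intro suminf_cong trap_powr_Laplace[OF s, symmetric]) auto
  also have "\<dots> = (\<integral>\<^sup>+t. (\<Sum>n. ennreal (indicator {0<..} t * (t powr (s - 1) * trap_exp (real n) t))) \<partial>lborel)"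
    unfolding trap_exp_def by (rule nn_integral_suminf[symmetric]) simp
  also have "\<dots> = (\<integral>\<^sup>+t. (\<Sum>k. ennreal (?P t k)) \<partial>lborel)"
  proof (rule nn_integral_cong)
    fix t :: real
    show "(\<Sum>n. ennreal (indicator {0<..} t * (t powr (s - 1) * trap_exp (real n) t)))
      = (\<Sum>k. ennreal (?P t k))"
    proof (cases "t > 0")
      case True
      let ?L = "t powr (s - 1) * (1 / (exp t - 1) + 1 / 2 - 1 / t)"
      have "(\<lambda>n. t powr (s - 1) * trap_exp (real n) t) sums ?L"
        by (intro sums_mult trap_exp_nonneg_sums(2) True)
      then have "(\<Sum>n. ennreal (t powr (s - 1) * trap_exp (real n) t)) = ennreal ?L"
        by (intro suminf_ennreal_eq) (intro mult_nonneg_nonneg trap_exp_nonneg_sums(1)[OF True] powr_ge_zero)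
      moreover have S: "(\<lambda>k. t powr (s - 1) * (2 * t / (t ^ 2 + (2 * pi * real (Suc k)) ^ 2))) sums ?L"
        by (intro sums_mult trapezoid_laplace_partial_fractions True)
      moreover have e: "t powr (s - 1) * (2 * t / D) = 2 * (t powr s / D)" for D
        using True by (simp add: powr_diff)
      have "(\<Sum>k. ennreal (2 * (t powr s / (t ^ 2 + (2 * pi * real (Suc k)) ^ 2)))) = ennreal ?L"
        by (rule suminf_ennreal_eq[OF _ S[unfolded e]]) simp
      ultimately show ?thesis using True by (simp del: of_nat_Suc)
    qed simp
  qed
  also have "\<dots> = (\<Sum>k. \<integral>\<^sup>+t. ennreal (?P t k) \<partial>lborel)"
    by (rule nn_integral_suminf) simp
  also have "\<dots> = (\<Sum>k. ennreal (B k))"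
  proof (rule suminf_cong)
    fix k
    have "(\<integral>\<^sup>+t. ennreal (?P t k) \<partial>lborel)
      = (\<integral>\<^sup>+t. ennreal 2 * ennreal (indicator {0<..} t * (t powr s / (t ^ 2 + (2 * pi * real (Suc k)) ^ 2))) \<partial>lborel)"
      by (intro nn_integral_cong ennreal_mult') simp
    also have "\<dots> = ennreal 2 * ennreal (G / 2 * (2 * pi * real (Suc k)) powr (s - 1))"
      unfolding G_def by (subst nn_integral_cmult, simp, subst nn_integral_powr_div_square[OF s]) auto
    also have "\<dots> = ennreal (B k)" using G0 by (subst ennreal_mult[symmetric]) (auto simp: B_def)
    finally show "(\<integral>\<^sup>+t. ennreal (?P t k) \<partial>lborel) = ennreal (B k)" .
  qed
  also have "\<dots> = ennreal (suminf B)" using B0 Bs by (simp add: suminf_ennreal2)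
  finally have AB: "suminf A = suminf B"
    using suminf_nonneg[OF As A0] suminf_nonneg[OF Bs B0] by simp
  have "(\<lambda>n. complex_of_real (Gamma s) * complex_of_real (trap_powr s (real n))) sums (of_real (Gamma s) * zeta (of_real s))"
    by (intro sums_mult zeta_trapezoid s)
  then have "(\<lambda>n. complex_of_real (A n)) sums (of_real (Gamma s) * zeta (of_real s))" by (simp add: Aeq)
  moreover have "(\<lambda>n. complex_of_real (A n)) sums of_real (suminf A)" using As by (intro sums_of_real summable_sums)
  ultimately have 1: "of_real (Gamma s) * zeta (of_real s) = complex_of_real (suminf A)" by (rule sums_unique2)
  have "(\<lambda>k. of_nat (Suc k) powr (- (1 - complex_of_real s))) sums zeta (1 - of_real s)"
    using s by (intro zeta_sums_powr) auto
  then have "(\<lambda>k. complex_of_real (real (Suc k) powr (s - 1))) sums zeta (1 - of_real s)"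
  proof (rule back_subst[of "\<lambda>f. f sums _"])
    have "complex_of_nat (Suc k) powr of_real (s - 1) = of_real (real (Suc k) powr (s - 1))" for k
      using powr_of_real[of "real (Suc k)" "s - 1"] by (simp del: of_nat_Suc)
    then show "(\<lambda>k. of_nat (Suc k) powr (- (1 - complex_of_real s))) = (\<lambda>k. complex_of_real (real (Suc k) powr (s - 1)))"
      by (simp del: of_nat_Suc)
  qed
  then have "(\<lambda>k. complex_of_real (G * (2 * pi) powr (s - 1)) * complex_of_real (real (Suc k) powr (s - 1))) sums (of_real (G * (2 * pi) powr (s - 1)) * zeta (1 - of_real s))"
    by (rule sums_mult)
  then have "(\<lambda>k. complex_of_real (B k)) sums (of_real (G * (2 * pi) powr (s - 1)) * zeta (1 - of_real s))"
    by (simp only: Beq of_real_mult)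
  moreover have "(\<lambda>n. complex_of_real (B n)) sums of_real (suminf B)" using Bs by (intro sums_of_real summable_sums)
  ultimately have 2: "of_real (G * (2 * pi) powr (s - 1)) * zeta (1 - of_real s) = complex_of_real (suminf B)"
    by (rule sums_unique2)
  show ?thesis using 1 2 AB by (simp add: G_def mult_ac)
qed

lemma rGamma_mult_Gamma: "z \<notin> \<int>\<^sub>\<le>\<^sub>0 \<Longrightarrow> rGamma z * Gamma z = (1 :: complex)"
  by (simp add: Gamma_def rGamma_eq_zero_iff)

text \<open>Legendre's duplication formula brings the previous identity into a shape that is symmetric under
  \<open>s \<mapsto> 1 - s\<close>. Reciprocal Gamma functions are used because they are entire.\<close>

lemma zeta_functional_equation_interval:
  assumes s: "- 1 < s" "s < 0"
  shows "zeta (of_real s) * rGamma ((1 - of_real s) / 2)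
    = exp ((of_real s - 1 / 2) * of_real (ln pi)) * zeta (1 - of_real s) * rGamma (of_real s / 2)"
proof -
  let ?z = "complex_of_real s"
  define a b where "a = Gamma (?z / 2)" and "b = Gamma (?z / 2 + 1 / 2)"
  define d where "d = Gamma ((1 - ?z) / 2)"
  have n1: "?z / 2 \<notin> \<int>\<^sub>\<le>\<^sub>0" and n2: "?z / 2 + 1 / 2 \<notin> \<int>\<^sub>\<le>\<^sub>0" and n3: "(1 - ?z) / 2 \<notin> \<int>\<^sub>\<le>\<^sub>0"
    using s by (auto elim!: nonpos_Ints_cases simp: complex_eq_iff)
  have ab: "a \<noteq> 0" "b \<noteq> 0" "d \<noteq> 0" using n1 n2 n3 by (auto simp: a_def b_def d_def Gamma_eq_zero_iff)
  have sp: "complex_of_real (sqrt pi) \<noteq> 0" by simp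
  have dup: "a * b = exp ((1 - ?z) * of_real (ln 2)) * of_real (sqrt pi) * Gamma ?z"
    using Gamma_legendre_duplication[OF n1 n2] by (simp add: a_def b_def)
  have G: "Gamma ?z = of_real (Gamma s)" by (simp add: Gamma_complex_of_real)
  have b': "b = of_real (Gamma ((1 + s) / 2))" unfolding b_def
    by (simp add: Gamma_complex_of_real[symmetric] add_divide_distrib add.commute)
  have d': "d = of_real (Gamma ((1 - s) / 2))" unfolding d_def
    by (simp add: Gamma_complex_of_real[symmetric])
  have "(2 * pi) powr (s - 1) = exp ((s - 1) * ln 2) * exp ((s - 1) * ln pi)"
    by (simp add: powr_def ln_mult distrib_left exp_add)
  then have p: "complex_of_real ((2 * pi) powr (s - 1)) = exp ((?z - 1) * of_real (ln 2)) * exp ((?z - 1) * of_real (ln pi))"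
    by (simp add: exp_of_real[symmetric])
  have "Gamma ?z * zeta ?z = exp ((?z - 1) * of_real (ln 2)) * exp ((?z - 1) * of_real (ln pi)) * b * d * zeta (1 - ?z)"
    using zeta_functional_equation_real[OF s] unfolding of_real_mult p b' d' G by (simp only: mult.assoc)
  then have "exp ((1 - ?z) * of_real (ln 2)) * of_real (sqrt pi) * (Gamma ?z * zeta ?z)
     = exp ((1 - ?z) * of_real (ln 2)) * of_real (sqrt pi) * (exp ((?z - 1) * of_real (ln 2)) * exp ((?z - 1) * of_real (ln pi)) * b * d * zeta (1 - ?z))"
    by (rule arg_cong)
  also have "exp ((1 - ?z) * of_real (ln 2)) * of_real (sqrt pi) * (Gamma ?z * zeta ?z) = b * (a * zeta ?z)"
    using dup by (simp add: mult_ac)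
  also have "exp ((1 - ?z) * of_real (ln 2)) * of_real (sqrt pi) * (exp ((?z - 1) * of_real (ln 2)) * exp ((?z - 1) * of_real (ln pi)) * b * d * zeta (1 - ?z))
     = (exp ((1 - ?z) * of_real (ln 2)) * exp ((?z - 1) * of_real (ln 2))) * (of_real (sqrt pi) * exp ((?z - 1) * of_real (ln pi))) * b * d * zeta (1 - ?z)"
    by (simp only: mult_ac)
  also have "exp ((1 - ?z) * of_real (ln 2)) * exp ((?z - 1) * of_real (ln 2)) = 1"
    by (simp add: exp_add[symmetric] algebra_simps)
  also have "of_real (sqrt pi) * exp ((?z - 1) * of_real (ln pi)) = exp ((?z - 1 / 2) * of_real (ln pi))"
  proof -
    have "sqrt pi = exp (ln pi / 2)" using powr_half_sqrt[of pi] by (simp add: powr_def)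
    then have "complex_of_real (sqrt pi) = exp (of_real (ln pi) / 2)" by (simp add: exp_of_real[symmetric])
    then show ?thesis by (simp add: exp_add[symmetric] algebra_simps)
  qed
  finally have "a * zeta ?z = exp ((?z - 1 / 2) * of_real (ln pi)) * d * zeta (1 - ?z)"
    using ab by (simp add: mult_ac)
  then have "rGamma (?z / 2) * rGamma ((1 - ?z) / 2) * (a * zeta ?z) = rGamma (?z / 2) * rGamma ((1 - ?z) / 2) * (exp ((?z - 1 / 2) * of_real (ln pi)) * d * zeta (1 - ?z))"
    by (rule arg_cong)
  moreover have "rGamma (?z / 2) * a = 1" "rGamma ((1 - ?z) / 2) * d = 1"
    unfolding a_def d_def by (rule rGamma_mult_Gamma n1 n3)+
  ultimately show ?thesis by (metis (no_types, opaque_lifting) mult.assoc mult.commute mult.left_commute mult_1)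
qed

text \<open>Both sides are holomorphic off \<open>0\<close> and \<open>1\<close> and agree on an interval.\<close>

lemma zeta_functional_equation:
  assumes s: "s \<noteq> 0" "s \<noteq> 1"
  shows "zeta s * rGamma ((1 - s) / 2) = exp ((s - 1 / 2) * of_real (ln pi)) * zeta (1 - s) * rGamma (s / 2)"
proof -
  define h where "h = (\<lambda>s. zeta s * rGamma ((1 - s) / 2) - exp ((s - 1 / 2) * of_real (ln pi)) * zeta (1 - s) * rGamma (s / 2))"
  define S where "S = - {0, 1::complex}"
  define U where "U = complex_of_real ` {-1<..<0}"
  have z1: "zeta holomorphic_on S" by (rule holomorphic_on_subset[OF zeta_holomorphic]) (auto simp: S_def)
  have "(zeta \<circ> (\<lambda>s. 1 - s)) holomorphic_on S"
    by (rule holomorphic_on_compose_gen[OF _ zeta_holomorphic]) (auto simp: S_def intro!: holomorphic_intros)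
  then have z2: "(\<lambda>s. zeta (1 - s)) holomorphic_on S" by (simp add: o_def)
  have rG: "(\<lambda>s. rGamma (g s)) holomorphic_on S" if "g holomorphic_on S" for g
    using holomorphic_on_compose_gen[OF that holomorphic_rGamma[of UNIV]] by (simp add: o_def)
  have "h holomorphic_on S"
    unfolding h_def by (intro holomorphic_on_diff holomorphic_on_mult z1 z2 rG) (auto intro!: holomorphic_intros)
  moreover have "open S" unfolding S_def by (intro open_Compl finite_imp_closed) auto
  moreover have "connected S" unfolding S_def Compl_eq_Diff_UNIV by (rule connected_open_delete_finite) auto
  moreover have "U \<subseteq> S" by (auto simp: U_def S_def)
  moreover have "- (1 / 2) \<in> S" by (simp add: S_def complex_eq_iff)
  moreover have "- (1 / 2) islimpt U"
    unfolding islimpt_approachable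
  proof (intro allI impI)
    fix e :: real assume e: "e > 0"
    define x where "x = - 1 / 2 + min (e / 2) (1 / 4)"
    have x: "x \<in> {-1<..<0}" "x \<noteq> - 1 / 2" "\<bar>x - (- 1 / 2)\<bar> < e" using e by (auto simp: x_def)
    have "complex_of_real x - - (1 / 2) = of_real (x - (- 1 / 2))" by simp
    then have "dist (complex_of_real x) (- (1 / 2)) = \<bar>x - (- 1 / 2)\<bar>"
      unfolding dist_norm by (simp only: norm_of_real)
    moreover have "complex_of_real x \<noteq> - (1 / 2)" using x(2) by (simp add: complex_eq_iff)
    ultimately show "\<exists>x'\<in>U. x' \<noteq> - (1 / 2) \<and> dist x' (- (1 / 2)) < e"
      using x by (intro bexI[of _ "of_real x"]) (auto simp: U_def)
  qed
  moreover have "h z = 0" if "z \<in> U" for z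
    using that zeta_functional_equation_interval by (auto simp: h_def U_def)
  ultimately have "h s = 0" by (rule analytic_continuation) (use s in \<open>auto simp: S_def\<close>)
  then show ?thesis by (simp add: h_def)
qed

text \<open>A zero with \<open>Re s < 0\<close> would be reflected to one with \<open>Re s > 1\<close>.\<close>

lemma nontrivial_zero_Re:
  assumes "zeta s = 0" "Im s \<noteq> 0"
  shows "0 \<le> Re s" "Re s \<le> 1"
proof -
  show "Re s \<le> 1" using zeta_nonzero_Re_gt_1[of s] assms by force
  show "0 \<le> Re s"
  proof (rule ccontr)
    assume "\<not> 0 \<le> Re s"
    then have "zeta (1 - s) \<noteq> 0" by (intro zeta_nonzero_Re_gt_1) auto
    moreover have "rGamma (s / 2) \<noteq> 0" using assms(2) by (auto simp: rGamma_eq_zero_iff elim!: nonpos_Ints_cases)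
    moreover have "s \<noteq> 0" "s \<noteq> 1" using assms(2) by auto
    ultimately show False using zeta_functional_equation[of s] assms(1) by simp
  qed
qed

lemma zeta_cnj: "zeta (cnj s) = cnj (zeta s)"
proof (cases "s = 1")
  case False
  have "cnj (zeta (cnj s)) = zeta s"
  proof (rule analytic_continuation_open[of "{s. Re s > 1}" "- {1}" "\<lambda>s. cnj (zeta (cnj s))" zeta])
    have "(2::complex) \<in> {s. Re s > 1}" by simp
    then show "{s. Re s > 1} \<noteq> {}" by blast
    show "(\<lambda>s. cnj (zeta (cnj s))) holomorphic_on - {1}"
    proof (subst holomorphic_on_open)
      show "\<forall>x\<in>- {1}. \<exists>f'. ((\<lambda>s. cnj (zeta (cnj s))) has_field_derivative f') (at x)"
      proof
        fix x :: complex assume "x \<in> - {1}"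
        then have "cnj x \<in> - {1}" by (metis ComplD ComplI complex_cnj_cnj complex_cnj_one singleton_iff)
        then have "(zeta has_field_derivative deriv zeta (cnj x)) (at (cnj x))"
          by (intro holomorphic_derivI[OF zeta_holomorphic]) auto
        then show "\<exists>f'. ((\<lambda>s. cnj (zeta (cnj s))) has_field_derivative f') (at x)"
          using has_field_derivative_cnj_cnj[of zeta "deriv zeta (cnj x)" x] by (auto simp: o_def)
      qed
    qed auto
    show "cnj (zeta (cnj z)) = zeta z" if "z \<in> {s. Re s > 1}" for z
    proof -
      have "(\<lambda>n. of_nat (Suc n) powr (- cnj z)) sums zeta (cnj z)" using that by (intro zeta_sums_powr) auto
      then have "(\<lambda>n. cnj (of_nat (Suc n) powr (- cnj z))) sums cnj (zeta (cnj z))" by (subst sums_cnj)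
      moreover have "cnj (of_nat (Suc n) powr (- cnj z)) = of_nat (Suc n) powr (- z)" for n
        by (subst cnj_powr) auto
      ultimately show ?thesis using zeta_sums_powr[of z] that sums_unique2 by fastforce
    qed
  qed (use False in \<open>auto simp: open_halfspace_Re_gt zeta_holomorphic connected_punctured_universe\<close>)
  then show ?thesis by (metis complex_cnj_cnj)
qed (simp add: zeta_1)

section \<open>Asymptotics of the digamma function\<close>

text \<open>Since \<open>(m + y)\<^sup>2 \<le> 2 (m\<^sup>2 + y\<^sup>2)\<close>, each term is at most \<open>2 / ((m + y)\<^sup>2 - 1/4)\<close> with \<open>m = x + n\<close>, which
  telescopes.\<close>

lemma sum_inverse_square_shift_bound:
  assumes "x \<ge> 0" "y \<ge> 1"
  shows "summable (\<lambda>n. 1 / ((x + real n) ^ 2 + y ^ 2))" "(\<Sum>n. 1 / ((x + real n) ^ 2 + y ^ 2)) \<le> 2 / (x + y - 1 / 2)"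
proof -
  define b where "b = x + y - 1 / 2"
  have b: "b > 0" using assms by (simp add: b_def)
  have lim: "(\<lambda>n. - (2 / (b + real n))) \<longlonglongrightarrow> - 0"
    by (intro tendsto_minus tendsto_divide_0[OF tendsto_const] filterlim_at_top_imp_at_infinity
        filterlim_tendsto_add_at_top[OF tendsto_const] filterlim_real_sequentially)
  have S: "(\<lambda>n. - (2 / (b + real (Suc n))) - - (2 / (b + real n))) sums (- 0 - - (2 / (b + real 0)))"
    by (rule telescope_sums[OF lim])
  have le: "1 / ((x + real n) ^ 2 + y ^ 2) \<le> - (2 / (b + real (Suc n))) - - (2 / (b + real n))" for n
  proof -
    define m where "m = x + real n"
    have m: "m \<ge> 0" using assms by (simp add: m_def)
    have p: "b + real n = m + y - 1/2" "b + real (Suc n) = m + y + 1/2" by (simp_all add: m_def b_def)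
    have pos: "m + y - 1/2 > 0" using m assms by simp
    have "(m + y) ^ 2 \<le> 2 * (m ^ 2 + y ^ 2)"
      using zero_le_power2[of "m - y"] by (simp add: power2_eq_square algebra_simps)
    then have q: "(m + y - 1/2) * (m + y + 1/2) \<le> 2 * (m ^ 2 + y ^ 2)"
      using m assms by (simp add: power2_eq_square algebra_simps add_divide_distrib)
    have "1 / (m ^ 2 + y ^ 2) = 2 / (2 * (m ^ 2 + y ^ 2))" using mult_divide_mult_cancel_left[of "2::real" 1 "m ^ 2 + y ^ 2"] by simp
    also have "\<dots> \<le> 2 / ((m + y - 1/2) * (m + y + 1/2))"
      using q pos by (intro divide_left_mono mult_pos_pos order.strict_trans2[OF mult_pos_pos q]) auto
    also have "\<dots> = 2 / (m + y - 1/2) - 2 / (m + y + 1/2)"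
      using pos by (simp add: field_simps)
    finally show ?thesis unfolding p m_def[symmetric] by simp
  qed
  show sm: "summable (\<lambda>n. 1 / ((x + real n) ^ 2 + y ^ 2))"
    by (rule summable_comparison_test'[OF sums_summable[OF S], of 0]) (use le in auto)
  have "(\<Sum>n. 1 / ((x + real n) ^ 2 + y ^ 2)) \<le> (\<Sum>n. - (2 / (b + real (Suc n))) - - (2 / (b + real n)))"
    by (rule suminf_le[OF le sm sums_summable[OF S]])
  also have "\<dots> = 2 / b" using sums_unique[OF S] by simp
  finally show "(\<Sum>n. 1 / ((x + real n) ^ 2 + y ^ 2)) \<le> 2 / (x + y - 1 / 2)" by (simp add: b_def)
qed

text \<open>Euler--Maclaurin summation of \<open>\<Sum> 1 / (z + n)\<close>. The fourth derivative that enters the error is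
  bounded by \<open>6 / \<bar>z + n\<bar> ^ 4\<close>, of which one factor \<open>1 / (Im z)\<^sup>2\<close> is split off before summing. The explicit
  constants matter, as the estimate also serves to locate a point numerically.\<close>

lemma Digamma_asymptotic:
  assumes z: "Re z \<ge> 0" "Im z \<ge> 1"
  shows "norm (Digamma z - (Ln z - 1 / (2 * z) - 1 / (12 * z ^ 2))) \<le> 1 / (16 * Im z ^ 2 * (Re z + Im z - 1 / 2))"
proof -
  define x y where "x = Re z" and "y = Im z"
  define a where "a = (\<lambda>w::complex. Ln w - 1 / (2 * w) - 1 / (12 * w ^ 2))"
  define D where "D = (\<lambda>n. (1 / (z + of_nat n) + 1 / (z + of_nat n + 1)) / 2 - (Ln (z + of_nat n + 1) - Ln (z + of_nat n))
     - (- 1 / (z + of_nat n + 1) ^ 2 - - 1 / (z + of_nat n) ^ 2) / 12)"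
  have Dle: "norm (D n) \<le> 1 / (32 * y ^ 2) * (1 / ((x + real n) ^ 2 + y ^ 2))" for n
  proof -
    have nz: "z + of_real u \<notin> \<real>\<^sub>\<le>\<^sub>0" for u using z by (auto simp: complex_nonpos_Reals_iff)
    have n0: "z + of_real u \<noteq> 0" for u using nz[of u] by (metis nonpos_Reals_zero_I)
    have "norm ((1 / (z + of_real (real n)) + 1 / (z + of_real (real n + 1))) / 2
       - (Ln (z + of_real (real n + 1)) - Ln (z + of_real (real n)))
     - (- 1 / (z + of_real (real n + 1)) ^ 2 - - 1 / (z + of_real (real n)) ^ 2) / 12) \<le> (6 / ((x + real n) ^ 2 + y ^ 2) ^ 2) / 192"
    proof (rule euler_maclaurin_step)
      fix u assume u: "u \<in> {real n..real n + 1}"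
      show "((\<lambda>u. Ln (z + of_real u)) has_vector_derivative 1 / (z + of_real u)) (at u)"
        by (rule has_vector_derivative_real_field) (auto intro!: derivative_eq_intros nz simp: inverse_eq_divide n0)
      show "((\<lambda>u. 1 / (z + of_real u)) has_vector_derivative - 1 / (z + of_real u) ^ 2) (at u)"
        by (rule has_vector_derivative_real_field) (auto intro!: derivative_eq_intros simp: n0 power2_eq_square)
      show "((\<lambda>u. - 1 / (z + of_real u) ^ 2) has_vector_derivative 2 / (z + of_real u) ^ 3) (at u)"
      proof (rule has_vector_derivative_real_field)
        have "((\<lambda>w. (z + w) ^ 2) has_field_derivative 2 * (z + of_real u) * (0 + 1)) (at (of_real u))"
          by (auto intro!: derivative_eq_intros)
        then have "((\<lambda>w. - 1 / (z + w) ^ 2) has_field_derivative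
            (0 * (z + of_real u) ^ 2 - - 1 * (2 * (z + of_real u) * (0 + 1))) / ((z + of_real u) ^ 2 * (z + of_real u) ^ 2)) (at (of_real u))"
          by (intro DERIV_divide DERIV_const) (use n0 in auto)
        then show "((\<lambda>w. - 1 / (z + w) ^ 2) has_field_derivative 2 / (z + of_real u) ^ 3) (at (of_real u))"
          by (rule DERIV_cong) (use n0[of u] in \<open>simp add: divide_simps power2_eq_square power3_eq_cube\<close>)
      qed
      show "((\<lambda>u. 2 / (z + of_real u) ^ 3) has_vector_derivative - 6 / (z + of_real u) ^ 4) (at u)"
      proof (rule has_vector_derivative_real_field)
        have "- (2 * (3 * w ^ 2)) / (w ^ 3 * w ^ 3) = - 6 / w ^ 4" if "w \<noteq> 0" for w :: complex
          using that by (simp add: field_simps power2_eq_square power3_eq_cube power4_eq_xxxx)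
        then show "((\<lambda>w. 2 / (z + w) ^ 3) has_field_derivative - 6 / (z + of_real u) ^ 4) (at (of_real u))"
          by (auto intro!: derivative_eq_intros simp: n0)
      qed
      have "norm (z + of_real u) ^ 2 = (x + u) ^ 2 + y ^ 2" by (simp add: cmod_power2 x_def y_def)
      then have "norm (- 6 / (z + of_real u) ^ 4) = 6 / ((x + u) ^ 2 + y ^ 2) ^ 2"
        using power_mult[of "norm (z + of_real u)" 2 2] by (simp add: norm_divide norm_power)
      also have "\<dots> \<le> 6 / ((x + real n) ^ 2 + y ^ 2) ^ 2"
        using u z by (intro divide_left_mono power_mono add_right_mono)
          (auto simp: x_def y_def intro!: mult_pos_pos add_nonneg_pos)
      finally show "norm (- 6 / (z + of_real u) ^ 4) \<le> 6 / ((x + real n) ^ 2 + y ^ 2) ^ 2" .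
    qed
    also have "(6 / ((x + real n) ^ 2 + y ^ 2) ^ 2) / 192 = 1 / (32 * ((x + real n) ^ 2 + y ^ 2) * ((x + real n) ^ 2 + y ^ 2))"
      by (simp add: power2_eq_square)
    also have "\<dots> \<le> 1 / (32 * y ^ 2 * ((x + real n) ^ 2 + y ^ 2))"
      using z by (intro divide_left_mono mult_right_mono) (auto simp: y_def intro!: mult_pos_pos add_nonneg_pos)
    finally show ?thesis by (simp add: D_def add_ac)
  qed
  note sq = sum_inverse_square_shift_bound[of x y]
  have xy: "x \<ge> 0" "y \<ge> 1" using z by (simp_all add: x_def y_def)
  have partial: "a z - (\<Sum>n<N. D n) = a (z + of_nat N) - (\<Sum>n<N. 1 / (z + of_nat n))" for N
  proof (induction N)
    case (Suc N)
    have "(p + q) / 2 - (L - M) - (- v - - u) / 12 = (M - p / 2 - u / 12) - (L - q / 2 - v / 12) + p"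
      for p q L M u v :: complex by (simp add: add_divide_distrib diff_divide_distrib)
    from this[of "1 / (z + of_nat N)" "1 / (z + of_nat N + 1)" "Ln (z + of_nat N + 1)" "Ln (z + of_nat N)"
        "1 / (z + of_nat N + 1) ^ 2" "1 / (z + of_nat N) ^ 2"]
    have "D N = a (z + of_nat N) - a (z + of_nat N + 1) + 1 / (z + of_nat N)"
      by (simp add: D_def a_def mult.commute[of 2] mult.commute[of 12])
    moreover have "a (z + of_nat (Suc N)) = a (z + of_nat N + 1)" by (simp add: add_ac)
    ultimately show ?case using Suc by (simp add: algebra_simps)
  qed simp
  have summ: "summable D"
    by (rule summable_comparison_test'[OF summable_mult[OF sq(1)[OF xy], of "1 / (32 * y ^ 2)"], of 0]) (use Dle in auto)
  have inf: "filterlim (\<lambda>N. z + of_nat N) at_infinity sequentially"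
    by (intro tendsto_add_filterlim_at_infinity[OF tendsto_const] tendsto_of_nat)
  have "(\<lambda>N. a (z + of_nat N) - of_real (ln (real N))) \<longlonglongrightarrow> 0"
  proof -
    have "(\<lambda>N. Ln (1 + z / of_nat N) - 1 / (2 * (z + of_nat N)) - 1 / (12 * (z + of_nat N) ^ 2)) \<longlonglongrightarrow> Ln (1 + 0) - 0 - 0"
      by (intro tendsto_diff tendsto_Ln tendsto_add tendsto_const lim_const_over_n tendsto_divide_0[OF tendsto_const]
           tendsto_mult_filterlim_at_infinity[OF tendsto_const] filterlim_compose[OF filterlim_power_at_infinity] inf) auto
    then have "(\<lambda>N. Ln (1 + z / of_nat N) - 1 / (2 * (z + of_nat N)) - 1 / (12 * (z + of_nat N) ^ 2)) \<longlonglongrightarrow> 0" by simp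
    then show ?thesis
    proof (rule Lim_transform_eventually)
      show "\<forall>\<^sub>F N in sequentially. Ln (1 + z / of_nat N) - 1 / (2 * (z + of_nat N)) - 1 / (12 * (z + of_nat N) ^ 2)
          = a (z + of_nat N) - of_real (ln (real N))"
        using eventually_gt_at_top[of 0]
      proof eventually_elim
        case (elim N)
        have "Im (1 + z / of_nat N) > 0" using z elim by simp
        then have "1 + z / of_nat N \<noteq> 0" by force
        then have "Ln (of_real (real N) * (1 + z / of_nat N)) = ln (real N) + Ln (1 + z / of_nat N)"
          using elim Ln_times_of_real[of "real N" "1 + z / of_nat N"] Ln_of_real[of "real N"] by simp
        moreover have "of_real (real N) * (1 + z / of_nat N) = z + of_nat N" using elim by (simp add: field_simps)
        ultimately show ?case by (simp add: a_def)
      qed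
    qed
  qed
  moreover have "z \<noteq> 0" using z by force
  ultimately have "(\<lambda>N. (a (z + of_nat N) - of_real (ln (real N))) + (of_real (ln (real N)) - (\<Sum>n<N. inverse (z + of_nat n))))
      \<longlonglongrightarrow> 0 + Digamma z"
    by (intro tendsto_add Digamma_LIMSEQ)
  then have "(\<lambda>N. a z - (\<Sum>n<N. D n)) \<longlonglongrightarrow> Digamma z" unfolding partial by (simp add: inverse_eq_divide)
  moreover have "(\<lambda>N. a z - (\<Sum>n<N. D n)) \<longlonglongrightarrow> a z - suminf D"
    using summ by (intro tendsto_diff tendsto_const summable_LIMSEQ)
  ultimately have eq: "Digamma z = a z - suminf D" using LIMSEQ_unique by blast
  have "norm (suminf D) \<le> (\<Sum>n. 1 / (32 * y ^ 2) * (1 / ((x + real n) ^ 2 + y ^ 2)))"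
    by (rule norm_suminf_le[OF Dle summable_mult[OF sq(1)[OF xy]]])
  also have "\<dots> = 1 / (32 * y ^ 2) * (\<Sum>n. 1 / ((x + real n) ^ 2 + y ^ 2))"
    by (rule suminf_mult[OF sq(1)[OF xy]])
  also have "\<dots> \<le> 1 / (32 * y ^ 2) * (2 / (x + y - 1 / 2))"
    by (rule mult_left_mono[OF sq(2)[OF xy]]) simp
  also have "\<dots> = 1 / (16 * y ^ 2 * (x + y - 1 / 2))" by simp
  finally show ?thesis by (simp add: eq a_def x_def y_def)
qed

section \<open>Logarithmic derivatives and zeros in a disc\<close>

text \<open>With \<open>g = exp h0\<close>, the function \<open>h = h0 - h0 c\<close> satisfies \<open>h c = 0\<close> and \<open>Re h \<le> ln M\<close>. The map
  \<open>h \<mapsto> h / (A - h)\<close> sends that half plane into the unit disc, so Schwarz's lemma bounds \<open>h\<close> on a smaller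
  disc, and Cauchy's inequality bounds its second derivative.\<close>

lemma borel_caratheodory_log_deriv2:
  fixes g :: "complex \<Rightarrow> complex"
  assumes "r > 0" and g: "g holomorphic_on ball c r" and nz: "\<And>z. z \<in> ball c r \<Longrightarrow> g z \<noteq> 0"
    and M: "M > 1" "\<And>z. z \<in> ball c r \<Longrightarrow> norm (g z) \<le> M * norm (g c)"
    and z: "z \<in> ball c (r / 2)"
  shows "norm (deriv (\<lambda>w. deriv g w / g w) z) \<le> 672 * ln M / r ^ 2"
proof -
  have lnM: "ln M > 0" using M by simp
  obtain h0 where h0: "h0 holomorphic_on ball c r" "\<And>z. z \<in> ball c r \<Longrightarrow> g z = exp (h0 z)"
    using contractible_imp_holomorphic_log[OF g convex_imp_contractible[OF convex_ball]] nz by metis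
  define h where "h = (\<lambda>z. h0 z - h0 c)"
  have cin: "c \<in> ball c r" using \<open>r > 0\<close> by simp
  have holh: "h holomorphic_on ball c r" unfolding h_def by (intro holomorphic_intros h0)
  have Reh: "Re (h z) \<le> ln M" if "z \<in> ball c r" for z
  proof -
    have "exp (Re (h z)) = norm (g z) / norm (g c)"
      using h0(2)[OF that] h0(2)[OF cin] by (simp add: h_def exp_diff)
    also have "\<dots> \<le> M" using M(2)[OF that] nz[OF cin] by (simp add: divide_simps)
    finally show ?thesis using M(1) by (metis ln_ge_iff[THEN iffD2] order.strict_trans zero_less_one)
  qed
  have hb: "norm (h z) \<le> 21 * ln M" if zz: "z \<in> ball c (7 * r / 8)" for z
  proof -
    \<comment> \<open>Any \<open>A > 2 ln M\<close> makes \<open>\<phi>\<close> map strictly into the unit disc.\<close>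
    define A where "A = 3 * ln M"
    define \<phi> where "\<phi> = (\<lambda>w. h (c + of_real r * w) / (of_real A - h (c + of_real r * w)))"
    have im: "c + of_real r * w \<in> ball c r" if "norm w < 1" for w :: complex
      using that \<open>r > 0\<close> by (simp add: dist_norm norm_mult)
    have pos: "Re (of_real A - h (c + of_real r * w)) > 0" if "norm w < 1" for w
      using Reh[OF im[OF that]] lnM by (simp add: A_def)
    have nz': "of_real A - h (c + of_real r * w) \<noteq> 0" if "norm w < 1" for w
      using pos[OF that] by (metis less_irrefl zero_complex.sel(1))
    have hh: "(\<lambda>w. h (c + of_real r * w)) holomorphic_on ball 0 1"
    proof -
      have "(h \<circ> (\<lambda>w. c + of_real r * w)) holomorphic_on ball 0 1"
        by (rule holomorphic_on_compose_gen[OF _ holh]) (use im in \<open>auto intro!: holomorphic_intros\<close>)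
      then show ?thesis by (simp add: o_def)
    qed
    have hol: "\<phi> holomorphic_on ball 0 1"
      unfolding \<phi>_def by (intro holomorphic_intros hh) (use nz' in auto)
    have lt: "norm (\<phi> w) < 1" if "norm w < 1" for w
    proof -
      define u where "u = h (c + of_real r * w)"
      have R: "Re u \<le> ln M" using Reh[OF im[OF that]] by (simp add: u_def)
      have "norm u ^ 2 < norm (of_real A - u) ^ 2"
        unfolding cmod_power2 using R lnM
        by (simp add: A_def power2_eq_square algebra_simps)
      then have "norm u < norm (of_real A - u)" by (rule power_less_imp_less_base) simp
      then show ?thesis unfolding \<phi>_def u_def[symmetric] norm_divide
        by (subst divide_less_eq_1_pos) (auto intro: order.strict_trans1[OF norm_ge_zero])
    qed
    have \<phi>0: "\<phi> 0 = 0" by (simp add: \<phi>_def h_def)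
    define w where "w = (z - c) / of_real r"
    have nw: "norm w < 7 / 8" using zz \<open>r > 0\<close>
      by (simp add: w_def norm_divide dist_norm norm_minus_commute field_simps)
    then have nw1: "norm w < 1" by simp
    have le: "norm (\<phi> w) \<le> norm w" by (rule Schwarz_Lemma(1)[OF hol \<phi>0 lt nw1])
    have zw: "c + of_real r * w = z" using \<open>r > 0\<close> by (simp add: w_def)
    have "\<phi> w * (of_real A - h z) = h z" using nz'[OF nw1] by (simp add: \<phi>_def zw)
    then have "norm (h z) = norm (\<phi> w) * norm (of_real A - h z)" by (metis norm_mult)
    also have "\<dots> \<le> (7 / 8) * (A + norm (h z))"
    proof (rule mult_mono)
      show "norm (of_real A - h z) \<le> A + norm (h z)"
        using norm_triangle_ineq4[of "of_real A" "h z"] lnM by (simp add: A_def)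
    qed (use le nw in auto)
    finally show ?thesis by (simp add: A_def)
  qed
  have sub: "cball z (r / 4) \<subseteq> ball c (7 * r / 8)"
  proof
    fix x assume "x \<in> cball z (r / 4)"
    then have "dist c x < r / 2 + r / 4" using z dist_triangle[of c x z] by simp
    then show "x \<in> ball c (7 * r / 8)" using \<open>r > 0\<close> by simp
  qed
  have sub': "ball c (7 * r / 8) \<subseteq> ball c r" using \<open>r > 0\<close> by (simp add: subset_ball)
  have "norm ((deriv ^^ 2) h z) \<le> fact 2 * (21 * ln M) / (r / 4) ^ 2"
  proof (rule Cauchy_inequality)
    show "h holomorphic_on ball z (r / 4)"
      by (rule holomorphic_on_subset[OF holh order.trans[OF ball_subset_cball order.trans[OF sub sub']]])
    show "continuous_on (cball z (r / 4)) h"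
      by (rule continuous_on_subset[OF holomorphic_on_imp_continuous_on[OF holh] order.trans[OF sub sub']])
    show "norm (h x) \<le> 21 * ln M" if "norm (z - x) = r / 4" for x
      using sub that by (intro hb) (auto simp: dist_norm)
  qed (use \<open>r > 0\<close> in auto)
  also have "\<dots> = 672 * ln M / r ^ 2" by (simp add: field_simps power2_eq_square)
  finally have "norm (deriv (deriv h) z) \<le> 672 * ln M / r ^ 2" by (simp add: numeral_2_eq_2)
  moreover have "deriv (deriv h) z = deriv (\<lambda>w. deriv g w / g w) z"
  proof (rule deriv_cong_ev)
    have zin: "z \<in> ball c r" using z \<open>r > 0\<close> by simp
    have "eventually (\<lambda>w. w \<in> ball c r) (nhds z)" using zin by (intro eventually_nhds_in_open) auto
    then show "eventually (\<lambda>w. deriv h w = deriv g w / g w) (nhds z)"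
    proof eventually_elim
      case (elim w)
      have d0: "(h0 has_field_derivative deriv h0 w) (at w)"
        using holomorphic_derivI[OF h0(1) open_ball elim] .
      have "(h has_field_derivative deriv h0 w) (at w)"
        unfolding h_def by (rule derivative_eq_intros d0 refl | simp)+
      then have a: "deriv h w = deriv h0 w" by (rule DERIV_imp_deriv)
      have "((\<lambda>w. exp (h0 w)) has_field_derivative exp (h0 w) * deriv h0 w) (at w)"
        by (rule derivative_eq_intros d0 refl | simp)+
      moreover have "eventually (\<lambda>w. exp (h0 w) = g w) (nhds w)"
        using eventually_nhds_in_open[OF open_ball elim] by eventually_elim (simp add: h0(2))
      ultimately have "(g has_field_derivative exp (h0 w) * deriv h0 w) (at w)"
        by (subst DERIV_cong_ev[OF refl _ refl, symmetric, where f = "\<lambda>w. exp (h0 w)"])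
      then have "deriv g w = exp (h0 w) * deriv h0 w" by (rule DERIV_imp_deriv)
      then show ?case using h0(2)[OF elim] a by simp
    qed
  qed simp
  ultimately show ?thesis by simp
qed

text \<open>Split off as many linear factors with zeros in the disc of radius \<open>R / 3\<close> as possible. On the circle of
  radius \<open>R\<close> a factor is at least twice as large as at the centre, so by the maximum principle \<open>n\<close> factors
  cost \<open>2 ^ n \<le> M\<close>; hence a maximal choice exists, and its cofactor has no zero left.\<close>

lemma zero_factorization:
  fixes f :: "complex \<Rightarrow> complex"
  assumes S: "open S" "cball c R \<subseteq> S" and R: "R > 0" and f: "f holomorphic_on S" and fc: "f c \<noteq> 0"
    and M: "\<And>z. z \<in> cball c R \<Longrightarrow> norm (f z) \<le> M * norm (f c)"
  obtains zs g where "g holomorphic_on S" "\<And>z. z \<in> S \<Longrightarrow> f z = (\<Prod>a\<leftarrow>zs. z - a) * g z"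
    "set zs \<subseteq> cball c (R / 3)" "2 ^ length zs \<le> M" "\<And>z. z \<in> cball c (R / 3) \<Longrightarrow> g z \<noteq> 0"
    "\<And>z. z \<in> cball c R \<Longrightarrow> norm (g z) \<le> M * norm (g c)"
proof -
  define P where "P = (\<lambda>zs g. g holomorphic_on S \<and> (\<forall>z\<in>S. f z = (\<Prod>a\<leftarrow>zs. z - a) * g z)
     \<and> set zs \<subseteq> cball c (R / 3))"
  have cS: "c \<in> S" using S R by auto
  have M0: "M \<ge> 0" using M[of c] fc R norm_ge_zero[of "f c"]
    by (smt (verit) centre_in_cball mult_nonneg_nonpos2 mult_less_0_iff zero_less_norm_iff)
  have key: "2 ^ length zs \<le> M \<and> (\<forall>z\<in>cball c R. norm (g z) \<le> M * norm (g c))" if "P zs g" for zs g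
  proof -
    have g: "g holomorphic_on S" and fg: "\<And>z. z \<in> S \<Longrightarrow> f z = (\<Prod>a\<leftarrow>zs. z - a) * g z"
      and zs: "set zs \<subseteq> cball c (R / 3)" using that by (auto simp: P_def)
    have gc: "g c \<noteq> 0" using fg[OF cS] fc by auto
    have up: "norm (\<Prod>a\<leftarrow>xs. c - a) \<le> (R / 3) ^ length xs" if "set xs \<subseteq> cball c (R / 3)" for xs
      using that
    proof (induction xs)
      case (Cons a xs)
      then have "norm (c - a) * norm (\<Prod>a\<leftarrow>xs. c - a) \<le> R / 3 * (R / 3) ^ length xs"
        using R by (intro mult_mono) (auto simp: dist_norm)
      then show ?case by (simp add: norm_mult)
    qed simp
    have low: "norm (\<Prod>a\<leftarrow>xs. z - a) \<ge> (2 * R / 3) ^ length xs"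
      if "set xs \<subseteq> cball c (R / 3)" "norm (z - c) = R" for xs z
      using that(1)
    proof (induction xs)
      case (Cons a xs)
      have "norm (z - c) \<le> norm (z - a) + norm (a - c)" using norm_triangle_ineq[of "z - a" "a - c"] by simp
      then have "norm (z - a) \<ge> 2 * R / 3"
        using that(2) Cons.prems by (simp add: dist_norm norm_minus_commute)
      then have "2 * R / 3 * (2 * R / 3) ^ length xs \<le> norm (z - a) * norm (\<Prod>a\<leftarrow>xs. z - a)"
        using Cons R by (intro mult_mono) auto
      then show ?case by (simp add: norm_mult)
    qed simp
    have bd: "norm (g z) \<le> M / 2 ^ length zs * norm (g c)" if z: "z \<in> cball c R" for z
    proof (rule maximum_modulus_frontier[of g "cball c R"])
      show "g holomorphic_on interior (cball c R)"
        using S(2) interior_subset by (intro holomorphic_on_subset[OF g]) auto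
      show "continuous_on (closure (cball c R)) g"
        using S(2) by (intro continuous_on_subset[OF holomorphic_on_imp_continuous_on[OF g]]) simp
      fix w assume "w \<in> frontier (cball c R)"
      then have w: "norm (w - c) = R" using R by (simp add: frontier_cball dist_norm norm_minus_commute)
      then have wc: "w \<in> cball c R" by (simp add: dist_norm norm_minus_commute)
      let ?n = "length zs"
      have "(2 * R / 3) ^ ?n * norm (g w) \<le> norm (f w)"
        using low[OF zs w] fg[OF subsetD[OF S(2) wc]] by (simp add: norm_mult mult_right_mono)
      also have "\<dots> \<le> M * norm (f c)" by (rule M[OF wc])
      also have "\<dots> \<le> M * ((R / 3) ^ ?n * norm (g c))"
        using up[OF zs] fg[OF cS] M0 by (auto simp: norm_mult intro!: mult_left_mono mult_right_mono)
      finally have "(R / 3) ^ ?n * (2 ^ ?n * norm (g w)) \<le> (R / 3) ^ ?n * (M * norm (g c))"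
        by (simp add: power_mult_distrib power_divide mult_ac)
      then have "2 ^ ?n * norm (g w) \<le> M * norm (g c)"
        using R by (subst (asm) mult_le_cancel_left_pos) auto
      then show "norm (g w) \<le> M / 2 ^ length zs * norm (g c)" by (simp add: field_simps)
    qed (use z in auto)
    have "norm (g c) \<le> M / 2 ^ length zs * norm (g c)" by (rule bd) (use R in auto)
    then have 1: "2 ^ length zs \<le> M" using gc by (simp add: field_simps)
    have "M / 2 ^ length zs \<le> M" using M0 by (simp add: field_simps mult_le_cancel_left1)
    then have "norm (g z) \<le> M * norm (g c)" if "z \<in> cball c R" for z
      using bd[OF that] mult_right_mono[of "M / 2 ^ length zs" M "norm (g c)"] by simp
    with 1 show ?thesis by blast
  qed
  define A where "A = {n. \<exists>zs g. P zs g \<and> length zs = n}"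
  have "n \<le> nat \<lceil>M\<rceil>" if "n \<in> A" for n
  proof -
    obtain zs g where "P zs g" "length zs = n" using \<open>n \<in> A\<close> by (auto simp: A_def)
    then have "2 ^ n \<le> M" using key by blast
    moreover have "real n < 2 ^ n" by simp
    ultimately show ?thesis by linarith
  qed
  then have fin: "finite A" by (meson finite_nat_set_iff_bounded_le)
  have "P [] f" using f by (simp add: P_def)
  then have "A \<noteq> {}" by (auto simp: A_def)
  then have "Max A \<in> A" using fin by simp
  then obtain zs g where Pg: "P zs g" and len: "length zs = Max A" by (auto simp: A_def)
  have "g z \<noteq> 0" if z: "z \<in> cball c (R / 3)" for z
  proof
    assume g0: "g z = 0"
    define h where "h = (\<lambda>w. if w = z then deriv g z else (g w - g z) / (w - z))"
    have "h holomorphic_on S" unfolding h_def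
      by (rule pole_lemma_open) (use Pg S in \<open>auto simp: P_def\<close>)
    moreover have gh: "g w = (w - z) * h w" for w by (simp add: h_def g0)
    moreover have "f w = (\<Prod>a\<leftarrow>z # zs. w - a) * h w" if "w \<in> S" for w
    proof -
      have "f w = (\<Prod>a\<leftarrow>zs. w - a) * ((w - z) * h w)" using Pg that gh[of w] by (simp add: P_def)
      then show ?thesis by simp
    qed
    ultimately have "P (z # zs) h" using Pg z by (simp add: P_def)
    then have "length (z # zs) \<in> A" unfolding A_def by blast
    then have "length (z # zs) \<le> Max A" by (rule Max_ge[OF fin])
    then show False using len by simp
  qed
  then show thesis using that[of g zs] Pg key[OF Pg] by (auto simp: P_def)
qed

lemma DERIV_prod_list_linear:
  fixes z :: complex
  assumes "z \<notin> set zs"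
  shows "((\<lambda>w. \<Prod>a\<leftarrow>zs. w - a) has_field_derivative (\<Prod>a\<leftarrow>zs. z - a) * (\<Sum>a\<leftarrow>zs. 1 / (z - a))) (at z)"
  using assms
proof (induction zs)
  case (Cons b zs)
  have "((\<lambda>w. (w - b) * (\<Prod>a\<leftarrow>zs. w - a)) has_field_derivative
     1 * (\<Prod>a\<leftarrow>zs. z - a) + (\<Prod>a\<leftarrow>zs. z - a) * (\<Sum>a\<leftarrow>zs. 1 / (z - a)) * (z - b)) (at z)"
    using Cons by (intro DERIV_mult) (auto intro!: derivative_eq_intros)
  moreover have "1 * P + P * Q * (z - b) = (z - b) * P * (1 / (z - b) + Q)" for P Q
    using Cons.prems by (simp add: distrib_left)
  ultimately show ?case by simp
qed simp

lemma DERIV_sum_list_inverse: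
  fixes z :: complex
  assumes "z \<notin> set zs"
  shows "((\<lambda>w. \<Sum>a\<leftarrow>zs. 1 / (w - a)) has_field_derivative (\<Sum>a\<leftarrow>zs. - 1 / (z - a) ^ 2)) (at z)"
  using assms
proof (induction zs)
  case (Cons b zs)
  have "((\<lambda>w. 1 / (w - b) + (\<Sum>a\<leftarrow>zs. 1 / (w - a))) has_field_derivative
     - 1 / (z - b) ^ 2 + (\<Sum>a\<leftarrow>zs. - 1 / (z - a) ^ 2)) (at z)"
    using Cons by (intro DERIV_add) (auto intro!: derivative_eq_intros simp: power2_eq_square)
  then show ?case by simp
qed simp

lemma norm_sum_list_bound:
  fixes h :: "'a \<Rightarrow> complex"
  assumes "\<And>a. a \<in> set zs \<Longrightarrow> norm (h a) \<le> B"
  shows "norm (\<Sum>a\<leftarrow>zs. h a) \<le> real (length zs) * B"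
  using assms
proof (induction zs)
  case (Cons a zs)
  then have "norm (h a + (\<Sum>a\<leftarrow>zs. h a)) \<le> B + real (length zs) * B"
    by (intro order.trans[OF norm_triangle_ineq] add_mono) auto
  then show ?case by (simp add: distrib_right)
qed simp

text \<open>After the factorization \<open>f'/f\<close> is \<open>\<Sum> 1 / (w - a) + g'/g\<close>. The zeros contribute at most
  \<open>1 / d\<^sup>2\<close> each, and there are at most \<open>2 ln M\<close> of them; the zero-free part is covered by the
  Borel--Caratheodory argument. The dependence on \<open>R\<close> matters: for zeta, \<open>ln M\<close> is proportional to \<open>R\<close>, so
  the first term becomes small in large discs.\<close>

lemma log_deriv_deriv_bound:
  fixes f :: "complex \<Rightarrow> complex"
  assumes S: "open S" "cball c R \<subseteq> S" and R: "R > 0" and f: "f holomorphic_on S" and fc: "f c \<noteq> 0"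
    and M: "M > 1" "\<And>z. z \<in> cball c R \<Longrightarrow> norm (f z) \<le> M * norm (f c)"
    and z: "z \<in> ball c (R / 6)" and d: "d > 0" "\<And>a. a \<in> cball c (R / 3) \<Longrightarrow> f a = 0 \<Longrightarrow> d \<le> norm (z - a)"
  shows "norm (deriv (\<lambda>w. deriv f w / f w) z) \<le> ln M * (6048 / R ^ 2 + 2 / d ^ 2)"
proof -
  obtain zs g where g: "g holomorphic_on S" and fg: "\<And>z. z \<in> S \<Longrightarrow> f z = (\<Prod>a\<leftarrow>zs. z - a) * g z"
    and zs: "set zs \<subseteq> cball c (R / 3)" and len: "2 ^ length zs \<le> M"
    and gnz: "\<And>z. z \<in> cball c (R / 3) \<Longrightarrow> g z \<noteq> 0"
    and gM: "\<And>z. z \<in> cball c R \<Longrightarrow> norm (g z) \<le> M * norm (g c)"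
    using zero_factorization[OF S R f fc M(2)] by metis
  have sub: "ball c (R / 3) \<subseteq> S" "ball c (R / 3) \<subseteq> cball c R"
    using S(2) R by (auto simp: subset_iff)
  have zer: "f a = 0" if "a \<in> set zs" for a
  proof -
    have "a \<in> cball c R" using zs that R by (auto simp: subset_iff)
    then have "a \<in> S" using S(2) by blast
    moreover have "(\<Prod>b\<leftarrow>zs. a - b) = 0" using that by (force simp: prod_list_zero_iff)
    ultimately show ?thesis using fg by simp
  qed
  have dz: "d \<le> norm (z - a)" if "a \<in> set zs" for a using d(2) zer that zs by blast
  have znz: "z \<notin> set zs" using dz d(1) by force
  have zin: "z \<in> ball c (R / 3)" using z R by simp
  have G: "norm (deriv (\<lambda>w. deriv g w / g w) z) \<le> 672 * ln M / (R / 3) ^ 2"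
  proof (rule borel_caratheodory_log_deriv2)
    show "g holomorphic_on ball c (R / 3)" by (rule holomorphic_on_subset[OF g sub(1)])
  qed (use R M z gnz gM sub in \<open>auto simp: subset_iff\<close>)
  have hg: "(\<lambda>w. deriv g w / g w) holomorphic_on ball c (R / 3)"
    using gnz sub by (intro holomorphic_intros holomorphic_deriv holomorphic_on_subset[OF g]) auto
  have ev: "\<forall>\<^sub>F w in nhds z. deriv f w / f w = (\<Sum>a\<leftarrow>zs. 1 / (w - a)) + deriv g w / g w"
  proof -
    have "eventually (\<lambda>w. w \<in> ball c (R / 3) - set zs) (nhds z)"
      using zin znz by (intro eventually_nhds_in_open open_Diff finite_imp_closed) auto
    then show ?thesis
    proof eventually_elim
      case (elim w)
      have wS: "w \<in> S" using elim sub by auto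
      have dg: "(g has_field_derivative deriv g w) (at w)" by (rule holomorphic_derivI[OF g S(1) wS])
      have "((\<lambda>w. (\<Prod>a\<leftarrow>zs. w - a) * g w) has_field_derivative
         (\<Prod>a\<leftarrow>zs. w - a) * (\<Sum>a\<leftarrow>zs. 1 / (w - a)) * g w + deriv g w * (\<Prod>a\<leftarrow>zs. w - a)) (at w)"
        using elim by (intro DERIV_mult DERIV_prod_list_linear dg) auto
      moreover have "eventually (\<lambda>w. (\<Prod>a\<leftarrow>zs. w - a) * g w = f w) (nhds w)"
        using eventually_nhds_in_open[OF S(1) wS] by eventually_elim (simp add: fg)
      ultimately have "(f has_field_derivative
         (\<Prod>a\<leftarrow>zs. w - a) * (\<Sum>a\<leftarrow>zs. 1 / (w - a)) * g w + deriv g w * (\<Prod>a\<leftarrow>zs. w - a)) (at w)"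
        by (subst DERIV_cong_ev[OF refl _ refl, symmetric, where f = "\<lambda>w. (\<Prod>a\<leftarrow>zs. w - a) * g w"])
      then have df: "deriv f w = (\<Prod>a\<leftarrow>zs. w - a) * (\<Sum>a\<leftarrow>zs. 1 / (w - a)) * g w + deriv g w * (\<Prod>a\<leftarrow>zs. w - a)"
        by (rule DERIV_imp_deriv)
      have "(\<Prod>a\<leftarrow>zs. w - a) \<noteq> 0" using elim by (auto simp: prod_list_zero_iff)
      moreover have "g w \<noteq> 0" using elim gnz by auto
      moreover have "(P * Q * b + b' * P) / (P * b) = Q + b' / b" if "P \<noteq> 0" "b \<noteq> 0" for P Q b b' :: complex
        using that by (simp add: field_simps)
      ultimately show ?case unfolding df fg[OF wS] by blast
    qed
  qed
  have "deriv (\<lambda>w. deriv f w / f w) z = deriv (\<lambda>w. (\<Sum>a\<leftarrow>zs. 1 / (w - a)) + deriv g w / g w) z"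
    by (rule deriv_cong_ev[OF ev refl])
  also have "\<dots> = (\<Sum>a\<leftarrow>zs. - 1 / (z - a) ^ 2) + deriv (\<lambda>w. deriv g w / g w) z"
    by (intro DERIV_imp_deriv DERIV_add DERIV_sum_list_inverse znz holomorphic_derivI[OF hg open_ball zin])
  finally have "norm (deriv (\<lambda>w. deriv f w / f w) z) \<le> norm (\<Sum>a\<leftarrow>zs. - 1 / (z - a) ^ 2) + 672 * ln M / (R / 3) ^ 2"
    using G norm_triangle_ineq[of "\<Sum>a\<leftarrow>zs. - 1 / (z - a) ^ 2" "deriv (\<lambda>w. deriv g w / g w) z"]
    by (simp del: norm_triangle_ineq)
  also have "norm (\<Sum>a\<leftarrow>zs. - 1 / (z - a) ^ 2) \<le> real (length zs) * (1 / d ^ 2)"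
  proof (rule norm_sum_list_bound)
    fix a assume "a \<in> set zs"
    then show "norm (- 1 / (z - a) ^ 2) \<le> 1 / d ^ 2"
      using dz[of a] d(1) by (simp add: norm_divide norm_power frac_le power_mono)
  qed
  finally have A: "norm (deriv (\<lambda>w. deriv f w / f w) z) \<le> real (length zs) * (1 / d ^ 2) + 672 * ln M / (R / 3) ^ 2"
    by simp
  have "real (length zs) * ln 2 = ln (2 ^ length zs)" by (simp add: ln_realpow)
  also have "\<dots> \<le> ln M" using len M(1) by (subst ln_le_cancel_iff) auto
  finally have "real (length zs) * ln 2 \<le> ln M" .
  moreover have "real (length zs) * (1 / 2) \<le> real (length zs) * ln 2"
    using ln2_ge_two_thirds by (intro mult_left_mono) auto
  ultimately have "real (length zs) \<le> 2 * ln M" by linarith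
  then have "real (length zs) * (1 / d ^ 2) \<le> 2 * ln M * (1 / d ^ 2)"
    by (rule mult_right_mono) simp
  also have "2 * ln M * (1 / d ^ 2) + 672 * ln M / (R / 3) ^ 2 = ln M * (6048 / R ^ 2 + 2 / d ^ 2)"
    by (simp add: power_divide algebra_simps)
  finally show ?thesis using A by simp
qed

section \<open>The completed zeta function\<close>

definition completed_zeta :: "complex \<Rightarrow> complex" where
  "completed_zeta s = exp (- (s / 2) * of_real (ln pi)) * Gamma (s / 2) * zeta s"

lemma not_nonpos_Int_of_Im: "Im z \<noteq> 0 \<Longrightarrow> z \<notin> \<int>\<^sub>\<le>\<^sub>0"
  by (auto elim!: nonpos_Ints_cases)

lemma completed_zeta_functional:
  assumes "Im s \<noteq> 0"
  shows "completed_zeta (1 - s) = completed_zeta s"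
proof -
  define a b where "a = Gamma (s / 2)" and "b = Gamma ((1 - s) / 2)"
  have n: "s / 2 \<notin> \<int>\<^sub>\<le>\<^sub>0" "(1 - s) / 2 \<notin> \<int>\<^sub>\<le>\<^sub>0" using assms by (auto intro!: not_nonpos_Int_of_Im)
  have "s \<noteq> 0" "s \<noteq> 1" using assms by auto
  from zeta_functional_equation[OF this]
  have "(zeta s * rGamma ((1 - s) / 2)) * (a * b) = (exp ((s - 1 / 2) * of_real (ln pi)) * zeta (1 - s) * rGamma (s / 2)) * (a * b)"
    by (rule arg_cong)
  then have "(rGamma ((1 - s) / 2) * b) * (zeta s * a) = (rGamma (s / 2) * a) * (exp ((s - 1 / 2) * of_real (ln pi)) * zeta (1 - s) * b)"
    by (simp only: mult_ac)
  then have e: "zeta s * a = exp ((s - 1 / 2) * of_real (ln pi)) * zeta (1 - s) * b"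
    unfolding a_def b_def rGamma_mult_Gamma[OF n(1)] rGamma_mult_Gamma[OF n(2)] by simp
  have "completed_zeta s = exp (- (s / 2) * of_real (ln pi)) * (zeta s * a)"
    by (simp add: completed_zeta_def a_def mult_ac)
  also have "\<dots> = (exp (- (s / 2) * of_real (ln pi)) * exp ((s - 1 / 2) * of_real (ln pi))) * zeta (1 - s) * b"
    unfolding e by (simp only: mult.assoc)
  also have "exp (- (s / 2) * of_real (ln pi)) * exp ((s - 1 / 2) * of_real (ln pi)) = exp (- ((1 - s) / 2) * of_real (ln pi))"
    by (simp add: exp_add[symmetric] algebra_simps diff_divide_distrib)
  finally show ?thesis by (simp add: completed_zeta_def b_def mult_ac)
qed

lemma completed_zeta_cnj: "completed_zeta (cnj s) = cnj (completed_zeta s)"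
  by (simp add: completed_zeta_def zeta_cnj cnj_Gamma exp_cnj)

lemma completed_zeta_eq_0_iff: "Im s \<noteq> 0 \<Longrightarrow> completed_zeta s = 0 \<longleftrightarrow> zeta s = 0"
  using not_nonpos_Int_of_Im[of "s / 2"] by (simp add: completed_zeta_def Gamma_eq_zero_iff)

lemma completed_zeta_deriv:
  assumes "Im s \<noteq> 0"
  shows "(completed_zeta has_field_derivative
     (exp (- (s / 2) * of_real (ln pi)) * Gamma (s / 2)) *
       ((- of_real (ln pi) / 2 + Digamma (s / 2) / 2) * zeta s + deriv zeta s)) (at s)"
proof -
  have n: "s / 2 \<notin> \<int>\<^sub>\<le>\<^sub>0" using assms by (auto intro!: not_nonpos_Int_of_Im)
  have "s \<noteq> 1" using assms by auto
  then have z: "(zeta has_field_derivative deriv zeta s) (at s)"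
    by (intro holomorphic_derivI[OF zeta_holomorphic]) auto
  have e: "((\<lambda>s. exp (- (s / 2) * of_real (ln pi))) has_field_derivative
      exp (- (s / 2) * of_real (ln pi)) * (- (1 / 2) * of_real (ln pi))) (at s)"
    by (auto intro!: derivative_eq_intros)
  have g: "((\<lambda>s. Gamma (s / 2)) has_field_derivative (Gamma (s / 2) * Digamma (s / 2)) * (1 / 2)) (at s)"
    by (rule DERIV_chain2[where f = Gamma]) (use n in \<open>auto intro!: derivative_eq_intros\<close>)
  have "(completed_zeta has_field_derivative
      (exp (- (s / 2) * of_real (ln pi)) * (- (1 / 2) * of_real (ln pi)) * Gamma (s / 2)
       + (Gamma (s / 2) * Digamma (s / 2)) * (1 / 2) * exp (- (s / 2) * of_real (ln pi))) * zeta s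
      + deriv zeta s * (exp (- (s / 2) * of_real (ln pi)) * Gamma (s / 2))) (at s)"
    unfolding completed_zeta_def[abs_def] by (intro DERIV_mult e g z)
  then show ?thesis by (rule DERIV_cong) (simp add: algebra_simps)
qed

lemma completed_zeta_holomorphic: "completed_zeta holomorphic_on {s. Im s > 0}"
  unfolding holomorphic_on_def
proof
  fix s :: complex assume "s \<in> {s. Im s > 0}"
  then have "Im s \<noteq> 0" by simp
  note has_field_derivative_at_within[OF completed_zeta_deriv[OF this]]
  then show "completed_zeta field_differentiable at s within {s. Im s > 0}"
    unfolding field_differentiable_def by (rule exI)
qed

lemma completed_zeta_log_deriv:
  assumes "Im s \<noteq> 0" "zeta s \<noteq> 0"
  shows "deriv completed_zeta s / completed_zeta s = - of_real (ln pi) / 2 + Digamma (s / 2) / 2 + deriv zeta s / zeta s"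
proof -
  have "Gamma (s / 2) \<noteq> 0" using not_nonpos_Int_of_Im[of "s / 2"] assms by (simp add: Gamma_eq_zero_iff)
  moreover have "c * (a * z + z') / (c * z) = a + z' / z" if "c \<noteq> 0" "z \<noteq> 0" for c a z z' :: complex
    using that by (simp add: field_simps)
  ultimately show ?thesis
    unfolding DERIV_imp_deriv[OF completed_zeta_deriv[OF assms(1)]] completed_zeta_def using assms by simp
qed

text \<open>On the critical line \<open>1 - s\<close> is the conjugate of \<open>s\<close>, so \<open>\<xi>\<close> is real there; its derivative along the line is
  \<open>\<i> \<xi>'\<close>, which is then real too.\<close>

lemma completed_zeta_log_deriv_critical:
  assumes "Im s > 0" "Re s = 1 / 2"
  shows "Re (deriv completed_zeta s / completed_zeta s) = 0"
proof -
  define t where "t = Im s"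
  have s: "s = Complex (1 / 2) t" using assms by (simp add: complex_eq_iff t_def)
  have real: "Im (completed_zeta (Complex (1 / 2) u)) = 0" if "u \<noteq> 0" for u
  proof -
    have "1 - Complex (1 / 2) u = cnj (Complex (1 / 2) u)" by (simp add: complex_eq_iff)
    then have "cnj (completed_zeta (Complex (1 / 2) u)) = completed_zeta (Complex (1 / 2) u)"
      using completed_zeta_functional[of "Complex (1 / 2) u"] completed_zeta_cnj[of "Complex (1 / 2) u"] that by simp
    then show ?thesis by (simp add: complex_eq_iff)
  qed
  have d: "(completed_zeta has_field_derivative deriv completed_zeta s) (at s)"
    using assms by (intro holomorphic_derivI[OF completed_zeta_holomorphic open_halfspace_Im_gt]) auto
  have "((\<lambda>z. completed_zeta (1 / 2 + \<i> * z)) has_field_derivative deriv completed_zeta s * \<i>) (at (of_real t))"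
  proof (rule DERIV_chain2[where f = completed_zeta])
    have "1 / 2 + \<i> * of_real t = s" by (simp add: s complex_eq_iff)
    then show "(completed_zeta has_field_derivative deriv completed_zeta s) (at (1 / 2 + \<i> * of_real t))" using d by simp
  qed (auto intro!: derivative_eq_intros)
  then have "((\<lambda>u. completed_zeta (1 / 2 + \<i> * of_real u)) has_vector_derivative deriv completed_zeta s * \<i>) (at t)"
    by (rule has_vector_derivative_real_field)
  then have d1: "((\<lambda>u. Im (completed_zeta (1 / 2 + \<i> * of_real u))) has_real_derivative Im (deriv completed_zeta s * \<i>)) (at t)"
    unfolding has_real_derivative_iff_has_vector_derivative
    by (rule bounded_linear.has_vector_derivative[OF bounded_linear_Im])
  have d2: "((\<lambda>u. Im (completed_zeta (1 / 2 + \<i> * of_real u))) has_real_derivative 0) (at t)"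
  proof (rule has_field_derivative_transform_within_open[OF DERIV_const[of 0]])
    show "open {0<..<t + 1}" "t \<in> {0<..<t + 1}" using assms by (auto simp: t_def)
    fix u assume "u \<in> {0<..<t + 1}"
    moreover have "1 / 2 + \<i> * of_real u = Complex (1 / 2) u" by (simp add: complex_eq_iff)
    ultimately show "0 = Im (completed_zeta (1 / 2 + \<i> * of_real u))" using real[of u] by simp
  qed
  have "Im (deriv completed_zeta s * \<i>) = 0" by (rule DERIV_unique[OF d1 d2])
  then have "Re (deriv completed_zeta s) = 0" by simp
  moreover have "Im (completed_zeta s) = 0" 
  proof -
    have "t \<noteq> 0" using assms(1) by (simp add: t_def)
    then show ?thesis using real[of t] by (simp add: s[symmetric])
  qed
  ultimately show ?thesis by (simp add: Re_divide)
qed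

text \<open>A crude form of the asymptotic formula, sufficient for large heights.\<close>

lemma Digamma_Ln_bound:
  assumes "Re z \<ge> 0" "Im z \<ge> 1"
  shows "norm (Digamma z - Ln z) \<le> 1"
proof -
  have z1: "norm z \<ge> 1" using assms abs_Im_le_cmod[of z] by linarith
  then have z0: "z \<noteq> 0" by force
  have z2: "norm z ^ 2 \<ge> 1" using z1 by simp
  have "norm (1 / (2 * z)) \<le> 1 / 2" using z1 by (simp add: norm_divide norm_mult divide_simps)
  moreover have "norm (1 / (12 * z ^ 2)) \<le> 1 / 12"
    using z2 by (simp add: norm_divide norm_mult norm_power divide_simps)
  moreover have "norm (Digamma z - (Ln z - 1 / (2 * z) - 1 / (12 * z ^ 2))) \<le> 1 / 8"
  proof (rule order.trans[OF Digamma_asymptotic[OF assms]])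
    have "1 * (1 / 2) \<le> Im z ^ 2 * (Re z + Im z - 1 / 2)"
      using assms by (intro mult_mono) (auto simp: one_le_power)
    then have "8 \<le> 16 * Im z ^ 2 * (Re z + Im z - 1 / 2)" by (simp only: mult.assoc)
    then show "1 / (16 * Im z ^ 2 * (Re z + Im z - 1 / 2)) \<le> 1 / 8"
      using frac_le[of 1 1 8 "16 * Im z ^ 2 * (Re z + Im z - 1 / 2)"] by simp
  qed
  moreover have "norm (D - L) \<le> norm (D - (L - a - b)) + norm a + norm b" for D L a b :: complex
  proof -
    have "D - L = (D - (L - a - b)) - a - b" by simp
    then have "norm (D - L) = norm ((D - (L - a - b)) - a - b)" by simp
    also have "\<dots> \<le> norm (D - (L - a - b)) + norm a + norm b"
      by (rule order.trans[OF norm_triangle_ineq4 add_right_mono[OF norm_triangle_ineq4]])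
    finally show ?thesis .
  qed
  note this[of "Digamma z" "Ln z" "1 / (2 * z)" "1 / (12 * z ^ 2)"]
  ultimately show ?thesis by linarith
qed

text \<open>Any polynomial bound will do, as the exponent only has to be bounded by a multiple of the radius below.\<close>

lemma norm_zeta_le_cube:
  assumes s: "Re s \<ge> 1 / 2" "Im s \<ge> 1"
  shows "norm (zeta s) \<le> (norm s + 2) ^ 3"
proof -
  have s1: "s \<noteq> 1" using s by auto
  have E: "(\<lambda>k. em_term s (real (1 + k))) sums (zeta s - em_head 1 s)"
    using s s1 by (intro zeta_euler_maclaurin) auto
  define P where "P = norm (s * (s + 1) * (s + 2))"
  have sq: "(\<lambda>k. 1 / real (k + 1) ^ 2) sums (pi ^ 2 / 6)" using inverse_squares_sums by (simp add: add.commute)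
  have b: "norm (em_term s (real (1 + k))) \<le> P / 192 * (1 / real (k + 1) ^ 2)" for k
  proof -
    have "norm (em_term s (real (1 + k))) \<le> P * real (1 + k) powr (- Re s - 3) / 192"
      unfolding P_def using s s1 by (intro em_term_bound) auto
    also have "\<dots> \<le> P * real (1 + k) powr (- 2) / 192"
      using s by (intro divide_right_mono mult_left_mono powr_mono) (auto simp: P_def)
    also have "real (1 + k) powr (- 2) = 1 / real (k + 1) ^ 2"
      by (simp add: powr_minus divide_inverse add.commute)
    finally show ?thesis by simp
  qed
  have "norm (zeta s - em_head 1 s) = norm (\<Sum>k. em_term s (real (1 + k)))" using sums_unique[OF E] by simp
  also have "\<dots> \<le> (\<Sum>k. P / 192 * (1 / real (k + 1) ^ 2))"
    by (rule norm_suminf_le[OF b summable_mult[OF sums_summable[OF sq]]])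
  also have "\<dots> = P / 192 * (pi ^ 2 / 6)" using sums_unique[OF sums_mult[OF sq, of "P / 192"]] by simp
  also have "\<dots> \<le> P / 192 * 2"
  proof (rule mult_left_mono)
    have "pi ^ 2 \<le> 3.2 ^ 2" using pi_less_4 pi_approx by (intro power_mono) auto
    then show "pi ^ 2 / 6 \<le> 2" by (simp add: power2_eq_square)
  qed (simp add: P_def)
  finally have 1: "norm (zeta s - em_head 1 s) \<le> P / 96" by simp
  have "norm (s - 1) \<ge> 1" using abs_Im_le_cmod[of "s - 1"] s by simp
  then have "norm (1 / (s - 1)) \<le> 1" by (simp add: norm_divide divide_simps)
  moreover have "em_head 1 s = 1 / 2 + 1 / (s - 1) + s / 12" by (simp add: em_head_def)
  moreover have "norm (1 / 2 + 1 / (s - 1) + s / 12) \<le> norm (1 / 2 :: complex) + norm (1 / (s - 1)) + norm (s / 12)"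
    by (rule order.trans[OF norm_triangle_ineq add_right_mono[OF norm_triangle_ineq]])
  ultimately have 2: "norm (em_head 1 s) \<le> 2 + norm s" using norm_ge_zero[of s] by (simp add: norm_divide del: norm_ge_zero)
  have "P \<le> (norm s + 2) * (norm s + 2) * (norm s + 2)"
    unfolding P_def norm_mult using norm_triangle_ineq[of s 1] norm_triangle_ineq[of s 2]
    by (intro mult_mono) auto
  then have P3: "P \<le> (norm s + 2) ^ 3" by (simp add: power3_eq_cube)
  have "(norm s + 2) * 2 ^ 2 \<le> (norm s + 2) * (norm s + 2) ^ 2"
    by (intro mult_left_mono power_mono) auto
  then have h: "4 * (norm s + 2) \<le> (norm s + 2) ^ 3" by (simp add: power3_eq_cube power2_eq_square)
  have "norm (zeta s) \<le> norm (zeta s - em_head 1 s) + norm (em_head 1 s)"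
    using norm_triangle_ineq[of "zeta s - em_head 1 s" "em_head 1 s"] by simp
  also have "\<dots> \<le> (norm s + 2) ^ 3" 
  proof -
    have "a + b \<le> q" if "a \<le> P / 96" "b \<le> 2 + n" "P \<le> q" "4 * (n + 2) \<le> q" "0 \<le> n" for a b q n
    proof -
      have "96 * a \<le> q" using that(1,3) by simp
      moreover have "4 * b \<le> q" using that(2,4) by simp
      moreover have "0 \<le> q" using that(4,5) by simp
      ultimately show ?thesis by simp
    qed
    from this[OF 1 2 P3 h norm_ge_zero] show ?thesis .
  qed
  finally show ?thesis .
qed

text \<open>The terms with \<open>n \<ge> 2\<close> add up to at most \<open>\<pi>\<^sup>2/6 - 1 < 3/4\<close> in modulus.\<close>

lemma norm_zeta_2_line: "norm (zeta (Complex 2 t)) \<ge> 1 / 4"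
proof -
  let ?s = "Complex 2 t"
  have S: "(\<lambda>n. of_nat (Suc n) powr (- ?s)) sums zeta ?s" by (rule zeta_sums_powr) simp
  then have S1: "(\<lambda>n. of_nat (Suc (Suc n)) powr (- ?s)) sums (zeta ?s - 1)"
    by (subst sums_Suc_iff) simp
  have sq: "(\<lambda>k. 1 / real (k + 1) ^ 2) sums (pi ^ 2 / 6)" using inverse_squares_sums by (simp add: add.commute)
  then have sq1: "(\<lambda>k. 1 / real (Suc k + 1) ^ 2) sums (pi ^ 2 / 6 - 1)"
    by (subst sums_Suc_iff) simp
  have "norm (of_nat (Suc (Suc n)) powr (- ?s)) \<le> 1 / real (Suc n + 1) ^ 2" for n
    using norm_Suc_powr[of "Suc n" "- ?s"] by (simp add: powr_minus divide_inverse add.commute)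
  then have "norm (zeta ?s - 1) \<le> pi ^ 2 / 6 - 1"
    unfolding sums_unique[OF S1] sums_unique[OF sq1] by (intro norm_suminf_le sums_summable[OF sq1])
  also have "\<dots> \<le> 3 / 4"
  proof -
    have "pi ^ 2 \<le> 3.2 ^ 2" using pi_less_4 pi_approx by (intro power_mono) auto
    then show ?thesis by (simp add: power2_eq_square)
  qed
  finally show ?thesis using norm_triangle_ineq2[of 1 "1 - zeta ?s"] by (simp add: norm_minus_commute)
qed

text \<open>Moving by at most \<open>R\<close> changes \<open>ln \<Gamma>(s/2)\<close> by at most \<open>R ln T\<close>, because \<open>\<psi> = O(ln T)\<close> on the way; the other
  factors are estimated directly.\<close>

lemma completed_zeta_growth_right:
  assumes T: "T \<ge> exp 5" "T \<ge> R + 4" and R: "R \<ge> 5"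
    and s: "norm (s - Complex 2 T) \<le> R" "Re s \<ge> 1 / 2"
  shows "norm (completed_zeta s) \<le> exp (3 * R * ln T) * norm (completed_zeta (Complex 2 T))"
proof -
  define c where "c = Complex 2 T"
  have T0: "T > 0" using T(1) exp_gt_zero[of "5::real"] by linarith
  have lnT: "ln T \<ge> 5" using T(1) T0 by (simp add: ln_ge_iff)
  have T1: "T \<ge> 9" using T R by simp
  have im: "Im w \<ge> 4 \<and> norm w \<le> T + R + 2" if "norm (w - c) \<le> R" for w
  proof -
    have "\<bar>Im (w - c)\<bar> \<le> R" using abs_Im_le_cmod[of "w - c"] that by linarith
    then have "Im w \<ge> T - R" unfolding minus_complex.sel c_def complex.sel by linarith
    moreover have "norm c \<le> 2 + T" using cmod_le[of c] T0 by (simp add: c_def)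
    moreover have "norm w \<le> norm c + norm (w - c)" using norm_triangle_ineq[of c "w - c"] by simp
    ultimately show ?thesis using that T by linarith
  qed
  have sR: "norm (s - c) \<le> R" using s by (simp add: c_def)
  define K where "K = {z. Re z \<ge> 1 / 4} \<inter> cball (c / 2) (R / 2)"
  have K: "Re z \<ge> 1 / 4 \<and> Im z \<ge> 2 \<and> norm z \<le> T" if "z \<in> K" for z
  proof -
    have "2 * z - c = 2 * (z - c / 2)" by simp
    then have "norm (2 * z - c) = 2 * norm (z - c / 2)" by (simp only: norm_mult) simp
    also have "\<dots> \<le> R" using that by (simp add: K_def dist_norm norm_minus_commute)
    finally have "Im (2 * z) \<ge> 4 \<and> norm (2 * z) \<le> T + R + 2" by (rule im)
    then have "Im z \<ge> 2" "norm z \<le> T" using T by (simp_all add: norm_mult)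
    then show ?thesis using that by (simp add: K_def)
  qed
  have "norm (ln_Gamma (s / 2) - ln_Gamma (c / 2)) \<le> (2 * ln T) * norm (s / 2 - c / 2)"
  proof (rule field_differentiable_bound)
    show "convex K" unfolding K_def
      by (intro convex_Int convex_cball convex_halfspace_Re_ge)
    fix z assume z: "z \<in> K"
    show "(ln_Gamma has_field_derivative Digamma z) (at z within K)"
      by (rule has_field_derivative_at_within[OF has_field_derivative_ln_Gamma_complex])
         (use K[OF z] in \<open>auto simp: complex_nonpos_Reals_iff\<close>)
    have z1: "1 \<le> norm z" using K[OF z] abs_Im_le_cmod[of z] by linarith
    then have z0: "z \<noteq> 0" by force
    have "norm (Ln z) \<le> \<bar>Re (Ln z)\<bar> + \<bar>Im (Ln z)\<bar>" by (rule cmod_le)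
    also have "\<bar>Re (Ln z)\<bar> \<le> ln T" using z1 K[OF z] z0 T0 by (simp add: Re_Ln)
    also have "\<bar>Im (Ln z)\<bar> \<le> pi" using Im_Ln_le_pi[OF z0] mpi_less_Im_Ln[OF z0] by linarith
    also have "pi \<le> 4" using pi_less_4 by simp
    finally have "norm (Ln z) \<le> ln T + 4" by simp
    moreover have "norm (Digamma z - Ln z) \<le> 1" using K[OF z] by (intro Digamma_Ln_bound) auto
    moreover have "norm (Digamma z) \<le> norm (Digamma z - Ln z) + norm (Ln z)"
      using norm_triangle_ineq[of "Digamma z - Ln z" "Ln z"] by simp
    ultimately show "norm (Digamma z) \<le> 2 * ln T" using lnT by linarith
  next
    show "s / 2 \<in> K" using s sR by (simp add: K_def dist_norm norm_minus_commute norm_divide flip: diff_divide_distrib)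
    show "c / 2 \<in> K" using R by (simp add: K_def c_def)
  qed
  also have "norm (s / 2 - c / 2) = norm (s - c) / 2" by (simp add: norm_divide flip: diff_divide_distrib)
  also have "2 * ln T * (norm (s - c) / 2) \<le> R * ln T" using sR lnT by (simp add: mult_right_mono mult.commute)
  finally have lg: "norm (ln_Gamma (s / 2) - ln_Gamma (c / 2)) \<le> R * ln T" .
  have ims: "Im s \<ge> 4" "norm s \<le> T + R + 2" using im[OF sR] by auto
  have nn: "s / 2 \<notin> \<int>\<^sub>\<le>\<^sub>0" "c / 2 \<notin> \<int>\<^sub>\<le>\<^sub>0" using ims T0 by (auto intro!: not_nonpos_Int_of_Im simp: c_def)
  have "Gamma (s / 2) = exp (ln_Gamma (s / 2) - ln_Gamma (c / 2)) * Gamma (c / 2)"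
    using nn by (simp add: Gamma_complex_altdef exp_add[symmetric])
  then have "norm (Gamma (s / 2)) = exp (Re (ln_Gamma (s / 2) - ln_Gamma (c / 2))) * norm (Gamma (c / 2))"
    by (simp only: norm_mult norm_exp_eq_Re)
  moreover have "Re (ln_Gamma (s / 2) - ln_Gamma (c / 2)) \<le> R * ln T"
    by (rule order.trans[OF complex_Re_le_cmod lg])
  ultimately have G: "norm (Gamma (s / 2)) \<le> exp (R * ln T) * norm (Gamma (c / 2))"
    by (simp add: mult_right_mono)
  have lnpi: "0 \<le> ln pi" "ln pi \<le> ln T" using pi_gt3 pi_less_4 T1 T0 by (auto simp: ln_ge_zero)
  have E: "norm (exp (- (s / 2) * of_real (ln pi))) \<le> exp (R * ln T) * norm (exp (- (c / 2) * of_real (ln pi)))"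
  proof -
    have "\<bar>Re (s - c)\<bar> \<le> R" using abs_Re_le_cmod[of "s - c"] sR by linarith
    then have "- Re s \<le> R - 2" unfolding minus_complex.sel c_def complex.sel by linarith
    then have "(- Re s / 2) * ln pi \<le> (R / 2 - 1) * ln pi" using lnpi by (intro mult_right_mono) auto
    also have "\<dots> = R / 2 * ln pi + (- (Re c / 2) * ln pi)" by (simp add: c_def algebra_simps)
    also have "R / 2 * ln pi \<le> R * ln T" using R lnpi by (intro mult_mono) auto
    finally show ?thesis by (simp add: norm_exp_eq_Re exp_add[symmetric])
  qed
  have Z: "norm (zeta s) \<le> exp (5 * ln T) * norm (zeta c)"
  proof -
    have "norm (zeta s) \<le> (norm s + 2) ^ 3" using s ims by (intro norm_zeta_le_cube) auto
    also have "\<dots> \<le> (2 * T) ^ 3" using ims T by (intro power_mono) auto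
    also have "\<dots> = 32 * T ^ 3 * (1 / 4)" by (simp add: power_mult_distrib)
    also have "\<dots> \<le> T ^ 2 * T ^ 3 * (1 / 4)"
    proof -
      have "9 ^ 2 \<le> T ^ 2" using T1 by (intro power_mono) auto
      then show ?thesis using T0 by (intro mult_right_mono) auto
    qed
    also have "T ^ 2 * T ^ 3 = exp (5 * ln T)"
      using T0 exp_of_nat_mult[of 5 "ln T"] by (simp add: power_add[symmetric])
    also have "exp (5 * ln T) * (1 / 4) \<le> exp (5 * ln T) * norm (zeta c)"
      using norm_zeta_2_line[of T] by (simp add: c_def)
    finally show ?thesis .
  qed
  have "norm (completed_zeta s) \<le> (exp (R * ln T) * norm (exp (- (c / 2) * of_real (ln pi)))) * (exp (R * ln T) * norm (Gamma (c / 2))) * (exp (5 * ln T) * norm (zeta c))"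
    unfolding completed_zeta_def norm_mult by (intro mult_mono E G Z mult_nonneg_nonneg) auto
  also have "\<dots> = exp ((2 * R + 5) * ln T) * norm (completed_zeta c)"
  proof -
    have e: "exp ((2 * R + 5) * ln T) = exp (R * ln T) * exp (R * ln T) * exp (5 * ln T)"
      by (simp add: exp_add[symmetric] algebra_simps)
    show ?thesis unfolding completed_zeta_def norm_mult e by (simp only: mult_ac)
  qed
  also have "\<dots> \<le> exp (3 * R * ln T) * norm (completed_zeta c)"
    using R lnT by (intro mult_right_mono) (auto intro!: mult_right_mono)
  finally show ?thesis by (simp add: c_def)
qed

text \<open>Points left of the critical line are reflected in it, which preserves \<open>\<bar>\<xi>\<bar>\<close> and only brings them closer
  to the centre.\<close>

lemma completed_zeta_growth:
  assumes T: "T \<ge> exp 5" "T \<ge> R + 4" and R: "R \<ge> 5"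
    and s: "norm (s - Complex 2 T) \<le> R"
  shows "norm (completed_zeta s) \<le> exp (3 * R * ln T) * norm (completed_zeta (Complex 2 T))"
proof (cases "Re s \<ge> 1 / 2")
  case False
  have "\<bar>Im (s - Complex 2 T)\<bar> \<le> R" using abs_Im_le_cmod[of "s - Complex 2 T"] s by linarith
  then have "Im s > 0" using T by (simp add: abs_le_iff)
  then have "completed_zeta (1 - s) = completed_zeta s" by (intro completed_zeta_functional) auto
  then have "completed_zeta (1 - cnj s) = cnj (completed_zeta s)"
    using completed_zeta_cnj[of "1 - s"] by simp
  then have e: "norm (completed_zeta s) = norm (completed_zeta (1 - cnj s))" by simp
  have "norm (1 - cnj s - Complex 2 T) \<le> norm (s - Complex 2 T)"
  proof -
    have "(Re (1 - cnj s - Complex 2 T)) ^ 2 + (Im (1 - cnj s - Complex 2 T)) ^ 2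
      \<le> (Re (s - Complex 2 T)) ^ 2 + (Im (s - Complex 2 T)) ^ 2"
      using False by (simp add: power2_eq_square algebra_simps)
    then show ?thesis unfolding cmod_def by (rule real_sqrt_le_mono)
  qed
  then have "norm (completed_zeta (1 - cnj s)) \<le> exp (3 * R * ln T) * norm (completed_zeta (Complex 2 T))"
    using False s by (intro completed_zeta_growth_right[OF T R]) auto
  with e show ?thesis by simp
qed (use completed_zeta_growth_right[OF T R s] in simp)

text \<open>The bound on \<open>L'\<close> is integrated along the horizontal segment from the critical line, where \<open>Re L = 0\<close>.
  All points of the segment have height \<open>T\<close>, so the gap between the ordinates bounds their distance to the
  zeros.\<close>

lemma log_deriv_Re_bound:
  assumes T: "T \<ge> exp 5" "T \<ge> R + 4" and R: "R \<ge> 5" and x: "\<bar>x\<bar> + 3 / 2 < R / 6"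
    and d: "d > 0" "\<And>a. a \<in> cball (Complex 2 T) (R / 3) \<Longrightarrow> zeta a = 0 \<Longrightarrow> d \<le> \<bar>Im a - T\<bar>"
  shows "\<bar>Re (deriv completed_zeta (Complex (1 / 2 + x) T) / completed_zeta (Complex (1 / 2 + x) T))\<bar>
     \<le> \<bar>x\<bar> * (ln T * (18144 / R + 6 * R / d ^ 2))"
proof -
  define c where "c = Complex 2 T"
  define L where "L = (\<lambda>w. deriv completed_zeta w / completed_zeta w)"
  define S where "S = {s. Im s > 0}"
  have T0: "T > 0" using T(1) exp_gt_zero[of "5::real"] by linarith
  have lnT: "ln T \<ge> 5" using T(1) T0 by (simp add: ln_ge_iff)
  have oS: "open S" unfolding S_def by (rule open_halfspace_Im_gt)
  have sub: "cball c R \<subseteq> S"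
  proof
    fix w assume "w \<in> cball c R"
    then have "norm (w - c) \<le> R" by (simp add: dist_norm norm_minus_commute)
    then have "\<bar>Im (w - c)\<bar> \<le> R" using abs_Im_le_cmod[of "w - c"] by linarith
    then have "Im w \<ge> T - R" unfolding minus_complex.sel c_def complex.sel by linarith
    then show "w \<in> S" using T by (simp add: S_def)
  qed
  have hol: "completed_zeta holomorphic_on S" unfolding S_def by (rule completed_zeta_holomorphic)
  have fc: "completed_zeta c \<noteq> 0"
    using completed_zeta_eq_0_iff[of c] zeta_nonzero_Re_gt_1[of c] T0 by (simp add: c_def)
  define M where "M = exp (3 * R * ln T)"
  have M1: "M > 1" using R lnT by (simp add: M_def)
  have M: "norm (completed_zeta w) \<le> M * norm (completed_zeta c)" if "w \<in> cball c R" for w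
    unfolding M_def c_def using that by (intro completed_zeta_growth[OF T R]) (simp add: c_def dist_norm norm_minus_commute)
  have zd: "d \<le> \<bar>Im a - T\<bar>" if "a \<in> cball c (R / 3)" "completed_zeta a = 0" for a
  proof -
    have "a \<in> cball c R" using that R by (auto simp: subset_iff)
    then have "Im a > 0" using sub by (auto simp: S_def)
    then show ?thesis using d(2)[of a] that completed_zeta_eq_0_iff[of a] by (simp add: c_def)
  qed
  define K where "K = closed_segment (Complex (1 / 2) T) (Complex (1 / 2 + x) T)"
  have inball: "Complex (1 / 2 + y) T \<in> ball c (R / 6)" if "\<bar>y\<bar> \<le> \<bar>x\<bar>" for y
  proof -
    have "c - Complex (1 / 2 + y) T = of_real (3 / 2 - y)" by (simp add: c_def complex_eq_iff)
    then have "norm (c - Complex (1 / 2 + y) T) = \<bar>3 / 2 - y\<bar>" by (simp only: norm_of_real)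
    then show ?thesis using that x unfolding mem_ball dist_norm by linarith
  qed
  have Kball: "K \<subseteq> ball c (R / 6)" unfolding K_def
    using inball[of 0] inball[of x] by (intro closed_segment_subset convex_ball) auto
  have KT: "Im w = T" if "w \<in> K" for w
  proof -
    have "\<exists>u. w = (1 - u) *\<^sub>R Complex (1 / 2) T + u *\<^sub>R Complex (1 / 2 + x) T"
      using that unfolding K_def in_segment by metis
    then obtain u where "w = (1 - u) *\<^sub>R Complex (1 / 2) T + u *\<^sub>R Complex (1 / 2 + x) T" ..
    then have "Im w = (1 - u) * T + u * T" by simp
    then show ?thesis by (simp add: algebra_simps)
  qed
  have Lb: "norm (deriv L w) \<le> ln T * (18144 / R + 6 * R / d ^ 2)" if "w \<in> K" for w
  proof -
    have "norm (deriv L w) \<le> ln M * (6048 / R ^ 2 + 2 / d ^ 2)" unfolding L_def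
    proof (rule log_deriv_deriv_bound[OF oS sub _ hol fc M1 M])
      show "w \<in> ball c (R / 6)" using that Kball by blast
      show "d \<le> norm (w - a)" if "a \<in> cball c (R / 3)" "completed_zeta a = 0" for a
        using zd[OF that] KT[OF \<open>w \<in> K\<close>] abs_Im_le_cmod[of "w - a"] by (simp add: abs_minus_commute)
    qed (use R d in auto)
    also have "\<dots> = ln T * (18144 / R + 6 * R / d ^ 2)"
      using R by (simp add: M_def power2_eq_square distrib_left mult_ac)
    finally show ?thesis .
  qed
  have nz: "completed_zeta w \<noteq> 0" if "w \<in> K" for w
  proof
    assume "completed_zeta w = 0"
    moreover have "w \<in> cball c (R / 3)" using Kball that R by (auto simp: subset_iff)
    ultimately show False using zd[of w] KT[OF that] d(1) by simp
  qed
  have KS: "K \<subseteq> S" using KT T0 by (auto simp: S_def)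
  have dL: "(L has_field_derivative deriv L w) (at w within K)" if "w \<in> K" for w
  proof -
    have "L field_differentiable at w" unfolding L_def
      using that nz KS oS hol
      by (intro field_differentiable_divide holomorphic_on_imp_differentiable_at[OF _ oS] holomorphic_deriv) auto
    then show ?thesis by (simp add: DERIV_deriv_iff_field_differentiable has_field_derivative_at_within)
  qed
  have "norm (L (Complex (1 / 2 + x) T) - L (Complex (1 / 2) T)) \<le> ln T * (18144 / R + 6 * R / d ^ 2) * norm (Complex (1 / 2 + x) T - Complex (1 / 2) T)"
    by (rule field_differentiable_bound[OF _ dL Lb]) (auto simp: K_def)
  also have "Complex (1 / 2 + x) T - Complex (1 / 2) T = of_real x" by (simp add: complex_eq_iff)
  finally have b: "norm (L (Complex (1 / 2 + x) T) - L (Complex (1 / 2) T)) \<le> \<bar>x\<bar> * (ln T * (18144 / R + 6 * R / d ^ 2))"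
    by (simp add: mult.commute)
  have "Re (L (Complex (1 / 2) T)) = 0" unfolding L_def
    by (rule completed_zeta_log_deriv_critical) (use T0 in auto)
  then have "Re (L (Complex (1 / 2 + x) T)) = Re (L (Complex (1 / 2 + x) T) - L (Complex (1 / 2) T))" by simp
  then have "\<bar>Re (L (Complex (1 / 2 + x) T))\<bar> \<le> norm (L (Complex (1 / 2 + x) T) - L (Complex (1 / 2) T))"
    by (simp only: abs_Re_le_cmod)
  with b show ?thesis by (simp add: L_def)
qed

section \<open>Large ordinates\<close>

text \<open>The Gamma factor makes \<open>Re L\<close> about \<open>(ln (Im s)) / 2\<close>, up to the contribution of \<open>\<zeta>'/\<zeta>\<close>.\<close>

lemma Re_completed_zeta_log_deriv_lower:
  assumes s: "Re s \<ge> 0" "Im s \<ge> 2" and nz: "zeta s \<noteq> 0"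
  shows "2 * Re (deriv completed_zeta s / completed_zeta s) \<ge> ln (Im s) - 4 + 2 * Re (deriv zeta s / zeta s)"
proof -
  have L: "deriv completed_zeta s / completed_zeta s = - of_real (ln pi) / 2 + Digamma (s / 2) / 2 + deriv zeta s / zeta s"
    using nz s by (intro completed_zeta_log_deriv) auto
  have "norm (Digamma (s / 2) - Ln (s / 2)) \<le> 1" using s by (intro Digamma_Ln_bound) auto
  then have "Re (Digamma (s / 2)) \<ge> Re (Ln (s / 2)) - 1"
    using abs_Re_le_cmod[of "Digamma (s / 2) - Ln (s / 2)"] unfolding minus_complex.sel by linarith
  moreover have "Re (Ln (s / 2)) \<ge> ln (Im s / 2)"
  proof -
    have "s / 2 \<noteq> 0" using s by (auto simp: complex_eq_iff)
    moreover have "Im s / 2 \<le> norm (s / 2)" using abs_Im_le_cmod[of "s / 2"] s by simp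
    ultimately show ?thesis using s by (simp add: Re_Ln del: norm_divide)
  qed
  moreover have "ln (Im s / 2) = ln (Im s) - ln 2" using s by (simp add: ln_div)
  moreover have "ln 2 \<le> (1::real)" using ln_le_minus_one[of "2::real"] by simp
  moreover have "ln pi \<le> 2"
    using ln_le_minus_one[of "pi / 2"] ln_div[of pi 2] pi_less_4 \<open>ln 2 \<le> (1::real)\<close> by simp
  moreover have "2 * Re (deriv completed_zeta s / completed_zeta s) = Re (Digamma (s / 2)) - ln pi + 2 * Re (deriv zeta s / zeta s)"
    unfolding L by simp
  ultimately show ?thesis by linarith
qed

text \<open>If the disc were free of zeros, \<open>log_deriv_Re_bound\<close> could be applied with \<open>x = 3/2\<close> and \<open>d = R\<close>, which
  makes \<open>Re L (2 + iT)\<close> at most a small multiple of \<open>ln T\<close>. But \<open>\<zeta>'/\<zeta>\<close> is bounded on that line, so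
  \<open>Re L\<close> is about \<open>(ln T)/2\<close>.\<close>

lemma uniform_gap:
  obtains R T0 :: real where "R \<ge> 13" "T0 \<ge> exp 5" "T0 \<ge> R + 4"
    "\<And>T. T \<ge> T0 \<Longrightarrow> \<exists>a \<in> cball (Complex 2 T) (R / 3). zeta a = 0"
proof -
  \<comment> \<open>Large enough for \<open>(3/2) * (18144 + 6) / R < 1/4\<close>.\<close>
  define R :: real where "R = 120000"
  define B where "B = (\<Sum>n. real (Suc n) powr (- (3 / 2)))"
  have "summable (\<lambda>n. real n powr (- (3 / 2)))" by (simp add: summable_real_powr_iff)
  then have sB: "summable (\<lambda>n. real (Suc n) powr (- (3 / 2)))" by (subst summable_Suc_iff)
  have zB: "norm (zeta s) \<le> B" if "Re s \<ge> 3 / 2" for s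
  proof -
    have S: "(\<lambda>n. of_nat (Suc n) powr (- s)) sums zeta s" using that by (intro zeta_sums_powr) auto
    show ?thesis unfolding sums_unique[OF S] B_def
    proof (rule norm_suminf_le[OF _ sB])
      fix n
      show "norm (of_nat (Suc n) powr (- s) :: complex) \<le> real (Suc n) powr (- (3 / 2))"
        unfolding norm_Suc_powr using that by (intro powr_mono) auto
    qed
  qed
  have dz: "norm (deriv zeta (Complex 2 T)) \<le> 2 * B" if "T \<noteq> 0" for T
  proof -
    have sub: "cball (Complex 2 T) (1 / 2) \<subseteq> {s. Re s \<ge> 3 / 2}"
    proof
      fix w assume "w \<in> cball (Complex 2 T) (1 / 2)"
      then have "\<bar>Re (Complex 2 T - w)\<bar> \<le> 1 / 2"
        using abs_Re_le_cmod[of "Complex 2 T - w"] unfolding mem_cball dist_norm by linarith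
      then have "\<bar>2 - Re w\<bar> \<le> 1 / 2" by simp
      then have "Re w \<ge> 3 / 2" by linarith
      then show "w \<in> {s. Re s \<ge> 3 / 2}" by simp
    qed
    then have sub1: "cball (Complex 2 T) (1 / 2) \<subseteq> - {1}" by auto
    have "norm ((deriv ^^ 1) zeta (Complex 2 T)) \<le> fact 1 * B / (1 / 2) ^ 1"
    proof (rule Cauchy_inequality)
      show "zeta holomorphic_on ball (Complex 2 T) (1 / 2)"
        using sub1 by (intro holomorphic_on_subset[OF zeta_holomorphic]) auto
      show "continuous_on (cball (Complex 2 T) (1 / 2)) zeta"
        by (rule continuous_on_subset[OF holomorphic_on_imp_continuous_on[OF zeta_holomorphic] sub1])
      show "norm (zeta x) \<le> B" if "norm (Complex 2 T - x) = 1 / 2" for x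
      proof (rule zB)
        have "x \<in> cball (Complex 2 T) (1 / 2)" using that by (simp add: dist_norm)
        then show "Re x \<ge> 3 / 2" using sub by blast
      qed
    qed simp
    then show ?thesis by simp
  qed
  define T0 where "T0 = max (exp 5) (max (R + 4) (exp ((8 * B + 4) / (1 / 4))))"
  have "\<exists>a \<in> cball (Complex 2 T) (R / 3). zeta a = 0" if T: "T \<ge> T0" for T
  proof (rule ccontr)
    assume no: "\<not> ?thesis"
    have T5: "T \<ge> exp 5" "T \<ge> R + 4" "T \<ge> exp ((8 * B + 4) / (1 / 4))" using T by (auto simp: T0_def)
    have Tpos: "T > 120000" using T5(2) by (simp add: R_def)
    have lnT: "ln T \<ge> (8 * B + 4) / (1 / 4)" using T5(3) Tpos by (simp add: ln_ge_iff)
    have B0: "B \<ge> 0" using zB[of 2] norm_ge_zero[of "zeta 2"] by (simp del: norm_ge_zero)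
    let ?c = "Complex 2 T"
    let ?L = "deriv completed_zeta ?c / completed_zeta ?c"
    have e: "Complex (1 / 2 + 3 / 2) T = ?c" by simp
    have "\<bar>Re ?L\<bar> \<le> \<bar>3 / 2\<bar> * (ln T * (18144 / R + 6 * R / R ^ 2))"
      using log_deriv_Re_bound[OF T5(1,2), of "3 / 2" R] no unfolding e by (auto simp: R_def)
    also have "\<dots> \<le> (1 / 4) * ln T"
      using lnT B0 by (simp add: R_def field_simps)
    finally have up: "Re ?L \<le> (1 / 4) * ln T" by simp
    have zc: "norm (zeta ?c) \<ge> 1 / 4" by (rule norm_zeta_2_line)
    then have zc0: "zeta ?c \<noteq> 0" by force
    have "norm (deriv zeta ?c / zeta ?c) \<le> 2 * B / (1 / 4)"
      unfolding norm_divide using zc dz[of T] Tpos B0 by (intro frac_le) auto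
    then have "norm (deriv zeta ?c / zeta ?c) \<le> 8 * B" by simp
    then have r: "Re (deriv zeta ?c / zeta ?c) \<ge> - (8 * B)"
      using abs_Re_le_cmod[of "deriv zeta ?c / zeta ?c"] by linarith
    have "2 * Re ?L \<ge> ln T - 4 - 16 * B"
      using Re_completed_zeta_log_deriv_lower[of ?c] zc0 Tpos r by simp
    moreover have "4 * Re ?L \<le> ln T" using up by simp
    moreover have "ln T \<ge> 32 * B + 16" using lnT by simp
    ultimately show False by linarith
  qed
  moreover have "R \<ge> 13" "T0 \<ge> exp 5" "T0 \<ge> R + 4" by (auto simp: R_def T0_def)
  ultimately show thesis using that[of R T0] by blast
qed

text \<open>At a zero of \<open>\<zeta>'\<close> the lower bound \<open>(ln T)/4 \<le> Re L\<close> meets the upper bound \<open>\<bar>x\<bar> (A + A / d\<^sup>2) ln T\<close>.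
  Multiplying by \<open>d\<^sup>2\<close> and using that \<open>d\<close> is bounded gives the claim.\<close>

lemma large_ordinates:
  obtains C T0 D :: real where "C > 0" "T0 > 0"
    "\<And>T. T \<ge> T0 \<Longrightarrow> \<exists>\<rho> \<in> nontrivial_zeta_zeros. \<bar>Im \<rho> - T\<bar> \<le> D"
    "\<And>x T d. T \<ge> T0 \<Longrightarrow> \<bar>x\<bar> \<le> 1 / 2 \<Longrightarrow> deriv zeta (Complex (1 / 2 + x) T) = 0 \<Longrightarrow>
       (\<And>\<rho>. \<rho> \<in> nontrivial_zeta_zeros \<Longrightarrow> d \<le> \<bar>Im \<rho> - T\<bar>) \<Longrightarrow> d > 0 \<Longrightarrow> d ^ 2 \<le> C * \<bar>x\<bar>"
proof -
  obtain R T1 :: real where R: "R \<ge> 13" and T1: "T1 \<ge> exp 5" "T1 \<ge> R + 4"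
    and gap: "\<And>T. T \<ge> T1 \<Longrightarrow> \<exists>a \<in> cball (Complex 2 T) (R / 3). zeta a = 0"
    using uniform_gap by metis
  define T0 where "T0 = max T1 (exp 16)"
  have T0: "T0 \<ge> T1" "T0 \<ge> exp 16" by (auto simp: T0_def)
  have imp: "a \<in> nontrivial_zeta_zeros \<and> \<bar>Im a - T\<bar> \<le> R / 3" if "T \<ge> T1" "a \<in> cball (Complex 2 T) (R / 3)" "zeta a = 0" for a T
  proof -
    have "norm (Complex 2 T - a) \<le> R / 3" using that(2) by (simp add: dist_norm)
    then have i: "\<bar>Im (Complex 2 T - a)\<bar> \<le> R / 3" using abs_Im_le_cmod[of "Complex 2 T - a"] by linarith
    then have "\<bar>T - Im a\<bar> \<le> R / 3" by simp
    then have "Im a > 0" using that(1) T1 R by linarith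
    then have "Im a \<noteq> 0" "a \<noteq> 1" by auto
    then show ?thesis using nontrivial_zero_Re[OF that(3)] that(3) i
      by (auto simp: nontrivial_zeta_zeros_def abs_minus_commute)
  qed
  have near: "\<exists>\<rho> \<in> nontrivial_zeta_zeros. \<bar>Im \<rho> - T\<bar> \<le> R / 3" if "T \<ge> T0" for T
  proof -
    have "T \<ge> T1" using that T0 by simp
    then obtain a where "a \<in> cball (Complex 2 T) (R / 3)" "zeta a = 0" using gap by blast
    then show ?thesis using imp[OF \<open>T \<ge> T1\<close>] by blast
  qed
  define A where "A = max (18144 / R) (6 * R)"
  define C where "C = 4 * A * ((R / 3) ^ 2 + 1)"
  have A: "A > 0" using R by (simp add: A_def less_max_iff_disj)
  have main: "d ^ 2 \<le> C * \<bar>x\<bar>"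
    if T: "T \<ge> T0" and x: "\<bar>x\<bar> \<le> 1 / 2" and z': "deriv zeta (Complex (1 / 2 + x) T) = 0"
      and d: "\<And>\<rho>. \<rho> \<in> nontrivial_zeta_zeros \<Longrightarrow> d \<le> \<bar>Im \<rho> - T\<bar>" "d > 0" for x T d
  proof -
    have TT: "T \<ge> T1" "T \<ge> exp 16" using T T0 by auto
    have T5: "T \<ge> exp 5" "T \<ge> R + 4" using TT T1 by auto
    have Tp: "T > 2" using T5 R by simp
    have lnT: "ln T \<ge> 16" using TT(2) Tp by (simp add: ln_ge_iff)
    have "d \<le> R / 3"
    proof -
      obtain \<rho> where "\<rho> \<in> nontrivial_zeta_zeros" "\<bar>Im \<rho> - T\<bar> \<le> R / 3" using near[OF T] by blast
      then show ?thesis using d(1)[of \<rho>] by linarith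
    qed
    then have dR: "d ^ 2 \<le> (R / 3) ^ 2" using d(2) by (intro power_mono) auto
    let ?s = "Complex (1 / 2 + x) T"
    let ?L = "deriv completed_zeta ?s / completed_zeta ?s"
    have zs: "zeta ?s \<noteq> 0"
    proof
      assume "zeta ?s = 0"
      then have "?s \<in> nontrivial_zeta_zeros" using x Tp by (auto simp: nontrivial_zeta_zeros_def abs_le_iff complex_eq_iff)
      then show False using d(1)[of ?s] d(2) by simp
    qed
    have "\<bar>Re ?L\<bar> \<le> \<bar>x\<bar> * (ln T * (18144 / R + 6 * R / d ^ 2))"
    proof (rule log_deriv_Re_bound[OF T5])
      show "d \<le> \<bar>Im a - T\<bar>" if "a \<in> cball (Complex 2 T) (R / 3)" "zeta a = 0" for a
        using imp[OF TT(1) that] d(1) by blast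
    qed (use R x d(2) in auto)
    also have "\<dots> \<le> \<bar>x\<bar> * (ln T * (A + A / d ^ 2))"
      using lnT by (intro mult_left_mono add_mono divide_right_mono) (auto simp: A_def)
    finally have up: "Re ?L \<le> \<bar>x\<bar> * (ln T * (A + A / d ^ 2))" by simp
    have "2 * Re ?L \<ge> ln T - 4"
      using Re_completed_zeta_log_deriv_lower[of ?s] zs z' x Tp by (simp add: abs_le_iff)
    then have "4 * Re ?L \<ge> ln T" using lnT by linarith
    then have "ln T * (1 / 4) \<le> \<bar>x\<bar> * (ln T * (A + A / d ^ 2))" using up by linarith
    then have "ln T * (1 / 4) \<le> ln T * (\<bar>x\<bar> * (A + A / d ^ 2))" by (simp only: mult.left_commute)
    then have "1 / 4 \<le> \<bar>x\<bar> * (A + A / d ^ 2)" using lnT by (subst (asm) mult_le_cancel_left_pos) auto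
    then have "1 / 4 * d ^ 2 \<le> \<bar>x\<bar> * (A + A / d ^ 2) * d ^ 2" by (rule mult_right_mono) simp
    also have "\<dots> = \<bar>x\<bar> * (A * (d ^ 2 + 1))" using d(2) by (simp add: field_simps)
    also have "\<dots> \<le> \<bar>x\<bar> * (A * ((R / 3) ^ 2 + 1))" using A dR by (intro mult_left_mono) auto
    finally show ?thesis by (simp add: C_def mult_ac)
  qed
  have "C > 0" "T0 > 0" using A T1 R by (auto simp: C_def T0_def intro!: mult_pos_pos add_nonneg_pos)
  then show thesis using near main by (rule that)
qed

section \<open>The stationary point of the Gamma factor on the critical line\<close>

text \<open>Each term of the series \<open>\<Sum> 1 / (k + 1) - 1 / (z + k)\<close> has a real part that increases with \<open>Im z\<close>.\<close>

lemma Re_Digamma_mono_Im: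
  assumes "Re z = Re w" "Re z > 0" "0 \<le> Im z" "Im z \<le> Im w"
  shows "Re (Digamma z) \<le> Re (Digamma w)"
proof -
  have S: "(\<lambda>k. Re (inverse (of_nat (Suc k)) - inverse (v + of_nat k))) sums Re (Digamma v + euler_mascheroni)"
    if "v \<noteq> 0" for v :: complex
    using summable_sums[OF summable_Digamma[OF that]] by (intro sums_Re) (simp add: Digamma_def)
  have nz: "z \<noteq> 0" "w \<noteq> 0" using assms by auto
  have le: "Re (inverse (of_nat (Suc k)) - inverse (z + of_nat k)) \<le> Re (inverse (of_nat (Suc k)) - inverse (w + of_nat k))" for k
  proof -
    have p: "Re z + real k > 0" using assms by simp
    have "(Im z) ^ 2 \<le> (Im w) ^ 2" using assms by (intro power_mono) auto
    then have "(Re z + real k) / ((Re z + real k) ^ 2 + (Im w) ^ 2) \<le> (Re z + real k) / ((Re z + real k) ^ 2 + (Im z) ^ 2)"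
      using p by (intro divide_left_mono mult_pos_pos add_pos_nonneg) auto
    then show ?thesis using assms(1) by simp
  qed
  have "Re (Digamma z + euler_mascheroni) \<le> Re (Digamma w + euler_mascheroni)"
    by (rule sums_le[OF le S[OF nz(1)] S[OF nz(2)]])
  then show ?thesis by simp
qed

lemma Re_Digamma_quarter_estimate:
  assumes y: "y \<ge> 1"
  defines "m \<equiv> 1 / 16 + y ^ 2"
  shows "\<bar>Re (Digamma (Complex (1 / 4) y)) - (ln m / 2 - 1 / (8 * m) - (1 / 16 - y ^ 2) / (12 * m ^ 2))\<bar>
     \<le> 1 / (16 * y ^ 2 * (y - 1 / 4))"
proof -
  let ?z = "Complex (1 / 4) y"
  have z0: "?z \<noteq> 0" by (simp add: complex_eq_iff)
  have m0: "m > 0" unfolding m_def by (intro add_pos_nonneg) auto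
  have "norm ?z ^ 2 = m" by (simp only: cmod_power2 complex.sel) (simp add: m_def power2_eq_square)
  note m = m0 this
  have "ln m = 2 * ln (norm ?z)" unfolding m(2)[symmetric] using z0 by (subst ln_realpow) auto
  then have L: "Re (Ln ?z) = ln m / 2" using z0 by (simp add: Re_Ln)
  have "Re (1 / (2 * ?z)) = 1 / (8 * m)"
    using m(1) by (simp add: Re_divide m_def field_simps power2_eq_square)
  moreover have "Re (1 / (12 * ?z ^ 2)) = (1 / 16 - y ^ 2) / (12 * m ^ 2)"
  proof -
    have sq: "?z ^ 2 = Complex (1 / 16 - y ^ 2) (y / 2)"
      by (simp add: complex_eq_iff power2_eq_square)
    have "(1 / 16 - y ^ 2) ^ 2 + (y / 2) ^ 2 = m ^ 2"
      unfolding m_def by (simp add: power2_eq_square algebra_simps)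
    then have "Re (1 / Complex (1 / 16 - y ^ 2) (y / 2)) = (1 / 16 - y ^ 2) / m ^ 2"
      by (simp add: Re_divide)
    moreover have e: "1 / (12 * Complex (1 / 16 - y ^ 2) (y / 2)) = (1 / Complex (1 / 16 - y ^ 2) (y / 2)) / 12" by simp
    ultimately show ?thesis unfolding sq e Re_divide_numeral by simp
  qed
  ultimately have "Re (Ln ?z - 1 / (2 * ?z) - 1 / (12 * ?z ^ 2)) = ln m / 2 - 1 / (8 * m) - (1 / 16 - y ^ 2) / (12 * m ^ 2)"
    using L by simp
  moreover have "norm (Digamma ?z - (Ln ?z - 1 / (2 * ?z) - 1 / (12 * ?z ^ 2))) \<le> 1 / (16 * y ^ 2 * (y - 1 / 4))"
    using Digamma_asymptotic[of ?z] y by (simp add: add.commute)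
  ultimately show ?thesis
    using order.trans[OF abs_Re_le_cmod] by fastforce
qed

text \<open>By monotonicity it suffices to compare the two ends with \<open>ln \<pi>\<close>. With \<open>y = t/2\<close> the solution is close
  to \<open>\<pi>\<close>, because \<open>Re \<psi>(1/4 + iy)\<close> is about \<open>ln y\<close>.\<close>

lemma Re_Digamma_critical_location:
  assumes t: "t > 0" and eq: "Re (Digamma (Complex (1 / 4) (t / 2))) = ln pi"
  shows "\<bar>t - 6.29\<bar> \<le> 0.03"
proof -
  have pi: "3.1415 < pi" "pi < 3.1416" using pi_approx by auto
  have lo: "Re (Digamma (Complex (1 / 4) 3.13)) < ln pi"
  proof -
    define m :: real where "m = 1 / 16 + 3.13 ^ 2"
    have "3.1415 ^ 2 \<le> pi ^ 2" using pi by (intro power_mono) auto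
    then have "m \<le> pi ^ 2" by (simp add: m_def power2_eq_square)
    then have "ln m \<le> ln (pi ^ 2)" by (subst ln_le_cancel_iff) (auto simp: m_def intro!: add_pos_nonneg)
    also have "\<dots> = 2 * ln pi" by (subst ln_realpow) auto
    finally have "ln m / 2 \<le> ln pi" by simp
    moreover have "- 1 / (8 * m) - (1 / 16 - 3.13 ^ 2) / (12 * m ^ 2) + 1 / (16 * 3.13 ^ 2 * (3.13 - 1 / 4)) < (0::real)"
      by (simp add: m_def power2_eq_square)
    ultimately show ?thesis using Re_Digamma_quarter_estimate[of "3.13"] unfolding m_def[symmetric] by (simp add: abs_le_iff)
  qed
  have hi: "Re (Digamma (Complex (1 / 4) 3.16)) > ln pi"
  proof -
    define m :: real where "m = 1 / 16 + 3.16 ^ 2"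
    have m0: "m > 0" unfolding m_def by (intro add_pos_nonneg) auto
    have "pi ^ 2 \<le> 3.1416 ^ 2" using pi by (intro power_mono) auto
    then have "pi ^ 2 / m \<le> 3.1416 ^ 2 / m" using m0 by (intro divide_right_mono) auto
    moreover have "ln (pi ^ 2 / m) \<le> pi ^ 2 / m - 1" using m0 by (intro ln_le_minus_one) auto
    moreover have "ln (pi ^ 2 / m) = 2 * ln pi - ln m" using m0 by (subst ln_div) (auto simp: ln_realpow)
    ultimately have "ln m / 2 \<ge> ln pi + (1 - 3.1416 ^ 2 / m) / 2" by (simp add: field_simps)
    moreover have "(1 - 3.1416 ^ 2 / m) / 2 - 1 / (8 * m) - (1 / 16 - 3.16 ^ 2) / (12 * m ^ 2) - 1 / (16 * 3.16 ^ 2 * (3.16 - 1 / 4)) > (0::real)"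
      by (simp add: m_def power2_eq_square)
    moreover have "\<bar>Re (Digamma (Complex (1 / 4) 3.16)) - (ln m / 2 - 1 / (8 * m) - (1 / 16 - 3.16 ^ 2) / (12 * m ^ 2))\<bar>
      \<le> 1 / (16 * 3.16 ^ 2 * (3.16 - 1 / 4))"
      using Re_Digamma_quarter_estimate[of "3.16"] unfolding m_def[symmetric] by simp
    ultimately show ?thesis by linarith
  qed
  have "t / 2 > 3.13"
  proof (rule ccontr)
    assume "\<not> ?thesis"
    then have "Re (Digamma (Complex (1 / 4) (t / 2))) \<le> Re (Digamma (Complex (1 / 4) 3.13))"
      using t by (intro Re_Digamma_mono_Im) auto
    then show False using lo eq by simp
  qed
  moreover have "t / 2 < 3.16"
  proof (rule ccontr)
    assume "\<not> ?thesis"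
    then have "Re (Digamma (Complex (1 / 4) 3.16)) \<le> Re (Digamma (Complex (1 / 4) (t / 2)))"
      using t by (intro Re_Digamma_mono_Im) auto
    then show False using hi eq by simp
  qed
  ultimately show ?thesis by linarith
qed

text \<open>Each step costs at most \<open>291 / (192 n ^ 3)\<close>: in the bound for the fourth derivative, \<open>ln u \<le> (3/4) \<surd>u\<close> lets
  the logarithm be absorbed by the factor \<open>u powr (-1/2)\<close>. Then \<open>1 / n ^ 3 \<le> 1 / ((n - 1) n (n + 1))\<close>
  telescopes to \<open>1/24\<close>.\<close>

lemma zeta_deriv_remainder_bound:
  assumes t: "6 \<le> t" "t \<le> 6.32"
  shows "norm (- deriv zeta (Complex (1 / 2) t) - em_head_ln 4 (Complex (1 / 2) t)) \<le> 0.0635"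
proof -
  let ?s = "Complex (1 / 2) t"
  have s1: "?s \<noteq> 1" using t by (simp add: complex_eq_iff)
  have E: "(\<lambda>k. em_term_ln ?s (real (4 + k))) sums (- deriv zeta ?s - em_head_ln 4 ?s)"
    using s1 by (intro zeta_euler_maclaurin) auto
  have nb: "norm (Complex a t) \<le> b" if "a ^ 2 + 39.9424 \<le> b ^ 2" "b \<ge> 0" for a b
  proof -
    have "t ^ 2 \<le> 6.32 ^ 2" using t by (intro power_mono) auto
    then have "a ^ 2 + t ^ 2 \<le> b ^ 2" using that(1) by (simp add: power2_eq_square)
    then show ?thesis using that(2) by (simp add: cmod_def real_le_lsqrt)
  qed
  have n0: "norm ?s \<le> 6.34" by (rule nb) (auto simp: power2_eq_square)
  have "?s + 1 = Complex (3 / 2) t" "?s + 2 = Complex (5 / 2) t" by (simp_all add: complex_eq_iff)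
  then have n12: "norm (?s + 1) \<le> 6.5" "norm (?s + 2) \<le> 6.8" using nb[of "3 / 2" "6.5"] nb[of "5 / 2" "6.8"] by (auto simp: power2_eq_square)
  have P: "norm (?s * (?s + 1) * (?s + 2)) \<le> 280.3"
  proof -
    have "norm (?s * (?s + 1) * (?s + 2)) \<le> 6.34 * 6.5 * 6.8"
      unfolding norm_mult using n0 n12 by (intro mult_mono) auto
    then show ?thesis by simp
  qed
  have Q: "norm (3 * ?s ^ 2 + 6 * ?s + 2) \<le> 161"
  proof -
    have "norm (3 * ?s ^ 2 + 6 * ?s + 2) \<le> norm (3 * ?s ^ 2) + norm (6 * ?s) + norm (2 :: complex)"
      by (rule order.trans[OF norm_triangle_ineq add_right_mono[OF norm_triangle_ineq]])
    also have "\<dots> = 3 * norm ?s ^ 2 + 6 * norm ?s + 2" by (simp add: norm_mult norm_power)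
    also have "\<dots> \<le> 3 * 6.34 ^ 2 + 6 * 6.34 + 2" using n0 by (intro add_mono mult_left_mono power_mono) auto
    also have "\<dots> \<le> 161" by (simp add: power2_eq_square)
    finally show ?thesis .
  qed
  have b: "norm (em_term_ln ?s (real (4 + k))) \<le> (291 / 192) * (1 / (real (k + 3) * real (k + 4) * real (k + 5)))" for k
  proof -
    have "norm (em_term_ln ?s (real (4 + k))) \<le> (291 / real (4 + k) ^ 3) / 192"
    proof (rule em_term_ln_bound)
      fix u assume u: "u \<in> {real (4 + k)..real (4 + k) + 1}"
      then have u4: "u \<ge> 4" by auto
      define v where "v = sqrt u"
      have v: "v \<ge> 2" "v ^ 2 = u" using u4 by (auto simp: v_def real_le_rsqrt)
      have "ln (v / exp 1) \<le> v / exp 1 - 1" using v by (intro ln_le_minus_one) auto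
      then have "ln v \<le> v / exp 1" using v by (simp add: ln_div)
      also have "\<dots> \<le> v / (8 / 3)"
      proof (rule divide_left_mono)
        have "(\<Sum>k<5. 1 / fact k) \<le> exp (1::real)"
        proof -
          have S: "(\<lambda>k. 1 / fact k) sums exp (1::real)" using exp_converges[of "1::real"] by (simp add: divide_inverse)
          have "(\<Sum>k<5. 1 / fact k) \<le> (\<Sum>k. 1 / fact k :: real)"
            by (rule sum_le_suminf[OF sums_summable[OF S]]) auto
          then show ?thesis using sums_unique[OF S] by simp
        qed
        then show "8 / 3 \<le> exp (1::real)" by (simp add: eval_nat_numeral)
      qed (use v in auto)
      finally have "ln v \<le> v * (3 / 8)" by simp
      moreover have "ln u = 2 * ln v" using v by (simp add: ln_realpow flip: v(2))
      ultimately have "ln u \<le> v * (3 / 4)" by linarith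
      moreover have "0 \<le> ln u" using u4 by (intro ln_ge_zero) auto
      ultimately have lnu: "0 \<le> ln u" "ln u \<le> v * (3 / 4)" by auto
      have pw: "u powr (- Re ?s - 3) = 1 / (v * u ^ 3)"
      proof -
        have "u powr (- Re ?s - 3) = u powr (- (1 / 2)) * u powr (- 3)" by (simp add: powr_add[symmetric])
        also have "u powr (- (1 / 2)) = 1 / v" unfolding v_def using u4 powr_half_sqrt[of u] powr_minus_divide[of u "1 / 2"] by simp
        also have "u powr (- 3) = 1 / u ^ 3" using u4 powr_minus_divide[of u 3] by simp
        finally show ?thesis by simp
      qed
      have "norm (3 * ?s ^ 2 + 6 * ?s + 2) + norm (?s * (?s + 1) * (?s + 2)) * \<bar>ln u\<bar> \<le> 161 + 280.3 * (v * (3 / 4))"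
        using P Q lnu by (intro add_mono mult_mono) auto
      also have "\<dots> \<le> 291 * v" using v by simp
      finally have "u powr (- Re ?s - 3) * (norm (3 * ?s ^ 2 + 6 * ?s + 2) + norm (?s * (?s + 1) * (?s + 2)) * \<bar>ln u\<bar>)
          \<le> 1 / (v * u ^ 3) * (291 * v)"
        unfolding pw using v u4 by (intro mult_left_mono) auto
      also have "\<dots> = 291 / u ^ 3" using v by simp
      also have "\<dots> \<le> 291 / real (4 + k) ^ 3" using u by (intro divide_left_mono power_mono mult_pos_pos) auto
      finally show "u powr (- Re ?s - 3) * (norm (3 * ?s ^ 2 + 6 * ?s + 2) + norm (?s * (?s + 1) * (?s + 2)) * \<bar>ln u\<bar>)
          \<le> 291 / real (4 + k) ^ 3" .
    qed (use s1 in auto)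
    also have "\<dots> = (291 / 192) * (1 / real (4 + k) ^ 3)" by simp
    also have "\<dots> \<le> (291 / 192) * (1 / (real (k + 3) * real (k + 4) * real (k + 5)))"
    proof (intro mult_left_mono divide_left_mono mult_pos_pos)
      define x where "x = real (k + 4)"
      have x: "real (k + 3) = x - 1" "real (k + 4) = x" "real (k + 5) = x + 1" "real (4 + k) = x" "x \<ge> 4" by (auto simp: x_def)
      show "real (k + 3) * real (k + 4) * real (k + 5) \<le> real (4 + k) ^ 3"
        unfolding x(1-4) using x(5) by (simp add: power3_eq_cube algebra_simps)
    qed auto
    finally show ?thesis .
  qed
  have S: "(\<lambda>k. 1 / (real (k + 3) * real (k + 4) * real (k + 5))) sums (1 / 24)"
  proof -
    have lim: "(\<lambda>k. - (1 / (2 * (real k + 3) * (real k + 4)))) \<longlonglongrightarrow> - 0"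
      by real_asymp
    have "(\<lambda>k. - (1 / (2 * (real (Suc k) + 3) * (real (Suc k) + 4))) - - (1 / (2 * (real k + 3) * (real k + 4))))
       sums (- 0 - - (1 / (2 * (real 0 + 3) * (real 0 + 4))))"
      by (rule telescope_sums[OF lim])
    moreover have "- (1 / (2 * (real (Suc k) + 3) * (real (Suc k) + 4))) - - (1 / (2 * (real k + 3) * (real k + 4)))
       = 1 / (real (k + 3) * real (k + 4) * real (k + 5))" for k
    proof -
      define x where "x = real k + 4"
      have x: "real (Suc k) + 3 = x" "real (Suc k) + 4 = x + 1" "real k + 3 = x - 1" "real k + 4 = x"
        "real (k + 3) = x - 1" "real (k + 4) = x" "real (k + 5) = x + 1" "x > 1" by (auto simp: x_def)
      have "x \<noteq> 0" "x - 1 \<noteq> 0" "x + 1 \<noteq> 0" using x(8) by auto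
      then show ?thesis unfolding x(1-7) by (simp add: divide_simps) (simp add: algebra_simps)?
    qed
    ultimately show ?thesis by simp
  qed
  have "norm (- deriv zeta ?s - em_head_ln 4 ?s) \<le> (291 / 192) * (1 / 24)"
    unfolding sums_unique[OF E] sums_unique[OF sums_mult[OF S, of "291 / 192"]]
    by (rule norm_suminf_le[OF b sums_summable[OF sums_mult[OF S]]])
  also have "\<dots> \<le> 0.0635" by simp
  finally show ?thesis .
qed

lemma ln_2_3_bounds:
  "(693 / 1000) \<le> ln (2::real)" "ln (2::real) \<le> (6932 / 10000)" "(10984 / 10000) \<le> ln (3::real)" "ln (3::real) \<le> (10987 / 10000)"
proof -
  show l2: "(693 / 1000) \<le> ln (2::real)" "ln (2::real) \<le> (6932 / 10000)"
    using ln_approx_bounds[of 2 3, simplified, simplified eval_nat_numeral, simplified] by (simp_all add: power_divide)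
  have l32: "(4054 / 10000) \<le> ln (3/2::real)" "ln (3/2::real) \<le> (4055 / 10000)"
    using ln_approx_bounds[of "3/2" 3, simplified, simplified eval_nat_numeral, simplified] by (simp_all add: power_divide)
  have "ln (3/2::real) = ln 3 - ln 2" using ln_div[of 3 "2::real"] by simp
  with l2 l32 have "(10984 / 10000) \<le> ln (3::real) \<and> ln (3::real) \<le> (10987 / 10000)" by linarith
  then show "(10984 / 10000) \<le> ln (3::real)" "ln (3::real) \<le> (10987 / 10000)" by blast+
qed

lemma norm_cis_diff_le: "norm (cis a - cis b) \<le> \<bar>a - b\<bar>"
proof -
  have "cis a - cis b = cis b * (exp (\<i> * of_real (a - b)) - 1)"
    by (simp add: right_diff_distrib cis_conv_exp exp_add[symmetric] algebra_simps)
  then have "norm (cis a - cis b) = 2 * \<bar>sin ((a - b) / 2)\<bar>"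
    by (simp only: norm_mult norm_cis dist_exp_i_1)
  also have "\<dots> \<le> 2 * \<bar>(a - b) / 2\<bar>" by (intro mult_left_mono abs_sin_x_le_abs_x) auto
  finally show ?thesis by simp
qed

lemma cis_taylor:
  "norm (cis x - Complex (1 - x ^ 2 / 2 + x ^ 4 / 24) (x - x ^ 3 / 6 + x ^ 5 / 120)) \<le> \<bar>x\<bar> ^ 6 / 120"
proof -
  have "norm (exp (\<i> * of_real x) - (\<Sum>k\<le>5. (\<i> * of_real x) ^ k / fact k)) \<le> exp \<bar>Re (\<i> * of_real x)\<bar> * norm (\<i> * of_real x) ^ Suc 5 / fact 5"
    by (rule Taylor_exp)
  moreover have "(\<Sum>k\<le>5. (\<i> * of_real x) ^ k / fact k) = Complex (1 - x ^ 2 / 2 + x ^ 4 / 24) (x - x ^ 3 / 6 + x ^ 5 / 120)"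
    by (simp add: complex_eq_iff eval_nat_numeral fact_numeral)
  moreover have "fact 5 = (120 :: real)" by (simp add: fact_numeral)
  ultimately show ?thesis by (simp add: cis_conv_exp norm_mult)
qed

text \<open>A value of \<open>cis\<close> is compared with a rational point by way of a rational angle \<open>x\<close> and its Taylor
  polynomial.\<close>

lemma cis_near:
  assumes "\<bar>a - x\<bar> \<le> e" "\<bar>x\<bar> ^ 6 / 120 \<le> (1 / 1000)"
    "\<bar>1 - x ^ 2 / 2 + x ^ 4 / 24 - p\<bar> \<le> (1 / 1000)" "\<bar>x - x ^ 3 / 6 + x ^ 5 / 120 - q\<bar> \<le> (1 / 1000)"
  shows "norm (cis a - Complex p q) \<le> e + (3 / 1000)"
proof -
  let ?P = "Complex (1 - x ^ 2 / 2 + x ^ 4 / 24) (x - x ^ 3 / 6 + x ^ 5 / 120)"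
  have "norm (?P - Complex p q) \<le> (2 / 1000)"
    using cmod_le[of "?P - Complex p q"] assms(3,4) by simp
  moreover have "norm (cis x - ?P) \<le> (1 / 1000)" using cis_taylor[of x] assms(2) by linarith
  moreover have "norm (cis a - cis x) \<le> e" using norm_cis_diff_le[of a x] assms(1) by linarith
  moreover have "norm (cis a - Complex p q) \<le> norm (cis a - cis x) + norm (cis x - ?P) + norm (?P - Complex p q)"
    using norm_triangle_ineq[of "cis a - cis x" "cis x - ?P"] norm_triangle_ineq[of "cis a - ?P" "?P - Complex p q"] by simp
  ultimately show ?thesis by linarith
qed

lemma norm_mult_diff_le:
  fixes x y x0 y0 :: complex
  shows "norm (x * y - x0 * y0) \<le> norm (x - x0) * norm y + norm x0 * norm (y - y0)"
proof -
  have "x * y - x0 * y0 = (x - x0) * y + x0 * (y - y0)" by (simp add: algebra_simps)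
  then have "norm (x * y - x0 * y0) \<le> norm ((x - x0) * y) + norm (x0 * (y - y0))"
    using norm_triangle_ineq[of "(x - x0) * y" "x0 * (y - y0)"] by (simp only:)
  then show ?thesis by (simp only: norm_mult)
qed

lemma norm_add3_le: "norm (a + b + c :: complex) \<le> norm a + norm b + norm c"
  by (rule order.trans[OF norm_triangle_ineq add_right_mono[OF norm_triangle_ineq]])

lemma norm_add4_le: "norm (a + b + c + d :: complex) \<le> norm a + norm b + norm c + norm d"
  by (rule order.trans[OF norm_triangle_ineq add_right_mono[OF norm_add3_le]])

lemma of_nat_powr_critical:
  assumes "n > 0"
  shows "of_nat n powr (- Complex (1 / 2) t) = cis (- (t * ln (real n))) / of_real (sqrt (real n))"
proof -
  have "complex_of_nat n powr (- Complex (1 / 2) t) = exp (- Complex (1 / 2) t * of_real (ln (real n)))"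
    using assms by (simp add: powr_def Ln_of_nat)
  also have "- Complex (1 / 2) t * of_real (ln (real n)) = of_real (- (ln (real n) / 2)) + \<i> * of_real (- (t * ln (real n)))"
    by (simp add: complex_eq_iff)
  also have "exp \<dots> = of_real (exp (- (ln (real n) / 2))) * cis (- (t * ln (real n)))"
    by (simp only: exp_add cis_conv_exp exp_of_real)
  also have "exp (- (ln (real n) / 2)) = 1 / sqrt (real n)"
  proof -
    have "sqrt (real n) = exp (ln (real n) / 2)" using assms powr_half_sqrt[of "real n"] by (simp add: powr_def)
    then show ?thesis by (simp only: exp_minus inverse_eq_divide)
  qed
  finally show ?thesis by simp
qed

text \<open>With \<open>N = 4\<close> only \<open>2 powr (-s)\<close> and \<open>3 powr (-s)\<close> are transcendental, as \<open>4 powr (-s)\<close> is a square. On the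
  critical line they are \<open>cis\<close> of real angles up to square roots.\<close>

lemma em_head_ln_4_critical:
  fixes t :: real
  defines "s \<equiv> Complex (1 / 2) t" and "u \<equiv> cis (- (t * ln 2))" and "v \<equiv> cis (- (t * ln 3))"
    and "L \<equiv> complex_of_real (ln 2)"
  shows "em_head_ln 4 s = of_real (ln 2 / sqrt 2) * u + of_real (ln 3 / sqrt 3) * v
     + u ^ 2 * (L / 2 + 4 * L * (1 / (s - 1)) + 2 * (1 / (s - 1)) ^ 2 + (2 * s * L - 1) / 96)"
proof -
  have p2: "2 powr (- s) = u / of_real (sqrt 2)" using of_nat_powr_critical[of 2 t] by (simp add: s_def u_def)
  have p3: "3 powr (- s) = v / of_real (sqrt 3)" using of_nat_powr_critical[of 3 t] by (simp add: s_def v_def)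
  have l4: "ln 4 = 2 * ln (2::real)" using ln_realpow[of 2 2] by simp
  have p4: "4 powr (- s) = u ^ 2 / 2"
  proof -
    have "4 powr (- s) = cis (- (t * ln 4)) / 2" using of_nat_powr_critical[of 4 t] by (simp add: s_def)
    also have "cis (- (t * ln 4)) = u ^ 2" unfolding u_def l4 by (simp add: power2_eq_square cis_mult mult_ac)
    finally show ?thesis .
  qed
  have q1: "4 powr (1 - s) = 2 * u ^ 2" using p4 powr_add[of "4::complex" 1 "- s"] by (simp add: mult.commute)
  have q2: "4 powr (- s - 1) = u ^ 2 / 8" 
  proof -
    have "4 powr (- s - 1) = 4 powr (- s) / 4" using powr_diff[of "4::complex" "- s" 1] by simp
    then show ?thesis unfolding p4 by simp
  qed
  have set: "{1..<4} = {1, 2, 3::nat}" by auto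
  have "em_head_ln 4 s = u / of_real (sqrt 2) * L + v / of_real (sqrt 3) * of_real (ln 3)
     + u ^ 2 / 2 * (2 * L) / 2 + 2 * u ^ 2 * (2 * L / (s - 1) + 1 / (s - 1) ^ 2) + u ^ 2 / 8 * (s * (2 * L) - 1) / 12"
    unfolding em_head_ln_def set by (simp add: p2 p3 p4 q1 q2 l4 L_def)
  moreover have "u / x * L + v / y * l + u ^ 2 / 2 * (2 * L) / 2 + 2 * u ^ 2 * (2 * L / w + 1 / w ^ 2) + u ^ 2 / 8 * (s * (2 * L) - 1) / 12
     = L / x * u + l / y * v + u ^ 2 * (L / 2 + 4 * L * (1 / w) + 2 * (1 / w) ^ 2 + (2 * s * L - 1) / 96)" for x y l w
  proof -
    have "2 * u ^ 2 * (2 * L / w + 1 / w ^ 2) = u ^ 2 * (4 * L * (1 / w)) + u ^ 2 * (2 * (1 / w) ^ 2)"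
      by (simp add: distrib_left power_one_over mult_ac)
    moreover have "u ^ 2 / 8 * (s * (2 * L) - 1) / 12 = u ^ 2 * ((2 * s * L - 1) / 96)" by simp
    moreover have "u ^ 2 / 2 * (2 * L) / 2 = u ^ 2 * (L / 2)" by simp
    ultimately show ?thesis by (simp only: distrib_left) (simp add: mult_ac)
  qed
  ultimately show ?thesis by (simp add: L_def)
qed

text \<open>At \<open>t = 6.29\<close> the value is near \<open>-0.073 + 0.178 \<i>\<close>. All ingredients are replaced by the rational
  approximations \<open>u0, v0, r0, B0\<close>, with errors that also cover the variation of \<open>t\<close>; the total error
  stays below \<open>0.08\<close>, while the imaginary part of the approximation exceeds \<open>0.17\<close>.\<close>

lemma norm_em_head_ln_4_lower:
  assumes t: "\<bar>t - (629 / 100)\<bar> \<le> (3 / 100)"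
  shows "norm (em_head_ln 4 (Complex (1 / 2) t)) > (635 / 10000)"
proof -
  define s where "s = Complex (1 / 2) t"
  define u v where "u = cis (- (t * ln 2))" and "v = cis (- (t * ln 3))"
  define l where "l = ln (2::real)"
  define r where "r = 1 / (s - 1)"
  define B where "B = of_real l / 2 + 4 * of_real l * r + 2 * r ^ 2 + (2 * s * of_real l - 1) / 96"
  define u0 v0 B0 r0 where "u0 = Complex (-(345 / 1000)) (939 / 1000)" and "v0 = Complex (81 / 100) (-(587 / 1000))"
    and "B0 = Complex (259 / 1000) (-(339 / 1000))" and "r0 = Complex (-(126 / 10000)) (-(158 / 1000))"
  have tb: "(626 / 100) \<le> t" "t \<le> (632 / 100)" using t by linarith+
  have pi: "(31415 / 10000) < pi" "pi < (31416 / 10000)" using pi_approx by auto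
  note lnb = ln_2_3_bounds
  have t2: "(626 / 100) * (693 / 1000) \<le> t * ln 2" by (rule mult_mono) (use tb lnb in auto)
  have t2': "t * ln 2 \<le> (632 / 100) * (6932 / 10000)" by (rule mult_mono) (use tb lnb in auto)
  have t3: "(626 / 100) * (10984 / 10000) \<le> t * ln 3" by (rule mult_mono) (use tb lnb in auto)
  have t3': "t * ln 3 \<le> (632 / 100) * (10987 / 10000)" by (rule mult_mono) (use tb lnb in auto)
  have u: "norm (u - u0) \<le> (26 / 1000)"
  proof -
    have "norm (cis (3 * pi / 2 - t * ln 2) - Complex (939 / 1000) (345 / 1000)) \<le> (23 / 1000) + (3 / 1000)"
    \<comment> \<open>\<open>6.29 ln 2\<close> is about \<open>3\<pi>/2 - 0.3525\<close>.\<close>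
    proof (rule cis_near[of _ "(3525 / 10000)"])
      show "\<bar>3 * pi / 2 - t * ln 2 - (3525 / 10000)\<bar> \<le> (23 / 1000)" using t2 t2' pi by linarith
    qed (simp_all add: abs_le_iff power_divide)
    moreover have "u - u0 = \<i> * (cis (3 * pi / 2 - t * ln 2) - Complex (939 / 1000) (345 / 1000))"
    proof -
      have "cis (- (t * ln 2)) = cis (- (3 * pi / 2)) * cis (3 * pi / 2 - t * ln 2)" by (simp add: cis_mult)
      also have "cis (- (3 * pi / 2)) = \<i>"
      proof -
        have "- (3 * pi / 2) = pi / 2 - 2 * pi" by simp
        then have "cis (- (3 * pi / 2)) = cis (pi / 2) / cis (2 * pi)" by (simp only: cis_divide)
        then show ?thesis by simp
      qed
      finally show ?thesis by (simp add: u_def u0_def complex_eq_iff)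
    qed
    ultimately show ?thesis by (simp add: norm_mult)
  qed
  have v: "norm (v - v0) \<le> (38 / 1000)"
  proof -
    have "norm (cis (2 * pi - t * ln 3) - Complex (81 / 100) (-(587 / 1000))) \<le> (35 / 1000) + (3 / 1000)"
    \<comment> \<open>\<open>6.29 ln 3\<close> is about \<open>2\<pi> + 0.627\<close>.\<close>
    proof (rule cis_near[of _ "-(627 / 1000)"])
      show "\<bar>2 * pi - t * ln 3 - - (627 / 1000)\<bar> \<le> (35 / 1000)" using t3 t3' pi by linarith
    qed (simp_all add: abs_le_iff power_divide)
    moreover have "cis (2 * pi - t * ln 3) = v" by (simp add: v_def complex_eq_iff cos_diff sin_diff)
    ultimately show ?thesis by (simp add: v0_def)
  qed
  have nu: "norm u = 1" "norm v = 1" by (simp_all add: u_def v_def)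
  have nu0: "norm u0 \<le> (1002 / 1000)" "norm v0 \<le> (1002 / 1000)" "norm B0 \<le> (43 / 100)" "norm r0 \<le> (16 / 100)"
    unfolding cmod_def u0_def v0_def B0_def r0_def by (rule real_le_lsqrt; simp add: power_divide)+
  have s1: "norm (s - 1) \<ge> (626 / 100)" using abs_Im_le_cmod[of "s - 1"] tb by (simp add: s_def)
  then have s10: "s - 1 \<noteq> 0" by force
  have nr: "norm r \<le> (16 / 100)" using s1 by (simp add: r_def norm_divide divide_simps)
  have rr: "norm (r - r0) \<le> (1 / 1000)"
  proof -
    have "r - r0 = (1 - r0 * (s - 1)) / (s - 1)" using s10 by (simp add: r_def field_simps)
    moreover have "norm (1 - r0 * (s - 1)) \<le> (6 / 1000)"
    proof -
      have "1 - r0 * (s - 1) = Complex (1 - ((63 / 10000) + (158 / 1000) * t)) (- ((79 / 1000) - (126 / 10000) * t))"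
        by (simp add: r0_def s_def complex_eq_iff)
      then have "norm (1 - r0 * (s - 1)) \<le> \<bar>1 - ((63 / 10000) + (158 / 1000) * t)\<bar> + \<bar>- ((79 / 1000) - (126 / 10000) * t)\<bar>"
        using cmod_le[of "1 - r0 * (s - 1)"] by simp
      also have "\<dots> \<le> (6 / 1000)" using t by linarith
      finally show ?thesis .
    qed
    ultimately have "norm (r - r0) \<le> (6 / 1000) / (626 / 100)" 
      by (simp only: norm_divide) (rule frac_le; use s1 in simp)
    then show ?thesis by simp
  qed
  have BB: "norm (B - B0) \<le> (8 / 1000)"
  proof -
    define l0 where "l0 = complex_of_real (6931 / 10000)"
    have ll: "norm (of_real l - l0) \<le> (1 / 10000)" "norm (complex_of_real l) \<le> (7 / 10)"
    proof -
      have "of_real l - l0 = complex_of_real (l - (6931 / 10000))" by (simp add: l0_def)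
      then have "norm (of_real l - l0) = \<bar>l - (6931 / 10000)\<bar>" by (simp only: norm_of_real)
      then show "norm (of_real l - l0) \<le> (1 / 10000)" unfolding l_def using lnb by linarith
      show "norm (complex_of_real l) \<le> (7 / 10)" using lnb by (simp add: l_def)
    qed
    define s0 where "s0 = Complex (1 / 2) (629 / 100)"
    have "s - s0 = \<i> * of_real (t - (629 / 100))" by (simp add: s_def s0_def complex_eq_iff)
    then have ss: "norm (s - s0) \<le> (3 / 100)" using t by (simp only: norm_mult norm_of_real) simp
    have ns0: "norm s0 \<le> (64 / 10)" unfolding cmod_def s0_def by (rule real_le_lsqrt) (simp_all add: power_divide)
    have nl0: "norm l0 \<le> (7 / 10)" by (simp add: l0_def)
    have a1: "norm (r * of_real l - r0 * l0) \<le> (1 / 1000) * (7 / 10) + (16 / 100) * (1 / 10000)"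
      by (rule order.trans[OF norm_mult_diff_le]) (intro add_mono mult_mono rr ll nu0; simp)
    have a2: "norm (r * r - r0 * r0) \<le> (1 / 1000) * (16 / 100) + (16 / 100) * (1 / 1000)"
      by (rule order.trans[OF norm_mult_diff_le]) (intro add_mono mult_mono rr nr nu0; simp)
    have a3: "norm (s * of_real l - s0 * l0) \<le> (3 / 100) * (7 / 10) + (64 / 10) * (1 / 10000)"
      by (rule order.trans[OF norm_mult_diff_le]) (intro add_mono mult_mono ss ns0 ll; simp)
    define Bc where "Bc = l0 / 2 + 4 * (r0 * l0) + 2 * (r0 * r0) + (2 * (s0 * l0) - 1) / 96"
    have "B - Bc = (of_real l - l0) / 2 + 4 * (r * of_real l - r0 * l0) + 2 * (r * r - r0 * r0) + 2 * (s * of_real l - s0 * l0) / 96"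
      unfolding B_def Bc_def by (simp add: power2_eq_square algebra_simps diff_divide_distrib add_divide_distrib)
    then have "norm (B - Bc) \<le> norm ((of_real l - l0) / 2) + norm (4 * (r * of_real l - r0 * l0)) + norm (2 * (r * r - r0 * r0)) + norm (2 * (s * of_real l - s0 * l0) / 96)"
      by (simp only: norm_add4_le)
    also have "\<dots> = norm (of_real l - l0) / 2 + 4 * norm (r * of_real l - r0 * l0) + 2 * norm (r * r - r0 * r0) + 2 * norm (s * of_real l - s0 * l0) / 96"
      by (simp only: norm_divide norm_mult norm_numeral)
    also have "\<dots> \<le> (6 / 1000)" using ll a1 a2 a3 by linarith
    finally have "norm (B - Bc) \<le> (6 / 1000)" .
    moreover have "norm (Bc - B0) \<le> (2 / 1000)"
    proof (rule order.trans[OF cmod_le])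
      show "\<bar>Re (Bc - B0)\<bar> + \<bar>Im (Bc - B0)\<bar> \<le> (2 / 1000)"
        by (simp add: Bc_def B0_def l0_def r0_def s0_def)
    qed
    ultimately show ?thesis using norm_triangle_ineq[of "B - Bc" "Bc - B0"] by simp
  qed
  have nB: "norm B \<le> (44 / 100)" using BB nu0(3) norm_triangle_ineq[of "B - B0" B0] by simp
  define h where "h = of_real (l / sqrt 2) * u + of_real (ln 3 / sqrt 3) * v + u ^ 2 * B"
  have heq: "em_head_ln 4 (Complex (1 / 2) t) = h"
    unfolding em_head_ln_4_critical h_def B_def r_def u_def v_def s_def l_def by simp
  define h0 where "h0 = of_real (49 / 100) * u0 + of_real (634 / 1000) * v0 + u0 ^ 2 * B0"
  have sq2: "(1414 / 1000) \<le> sqrt 2" "sqrt 2 \<le> (14145 / 10000)"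
    by (rule real_le_rsqrt, simp add: power_divide) (rule real_le_lsqrt; simp add: power_divide)
  have sq3: "(1732 / 1000) \<le> sqrt 3" "sqrt 3 \<le> (17325 / 10000)"
    by (rule real_le_rsqrt, simp add: power_divide) (rule real_le_lsqrt; simp add: power_divide)
  have c1: "norm (complex_of_real (l / sqrt 2) - of_real (49 / 100)) \<le> (1 / 1000)"
  proof -
    have "(693 / 1000) / (14145 / 10000) \<le> l / sqrt 2" "l / sqrt 2 \<le> (6932 / 10000) / (1414 / 1000)"
      unfolding l_def by (rule frac_le; use lnb sq2 in simp)+
    then have "\<bar>l / sqrt 2 - (49 / 100)\<bar> \<le> (1 / 1000)" unfolding abs_le_iff by simp
    then show ?thesis by (simp only: of_real_diff[symmetric] norm_of_real)
  qed
  have c2: "norm (complex_of_real (ln 3 / sqrt 3) - of_real (634 / 1000)) \<le> (1 / 1000)"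
  proof -
    have "(10984 / 10000) / (17325 / 10000) \<le> ln 3 / sqrt 3" "ln 3 / sqrt 3 \<le> (10987 / 10000) / (1732 / 1000)"
      by (rule frac_le; use lnb sq3 in simp)+
    then have "\<bar>ln 3 / sqrt 3 - (634 / 1000)\<bar> \<le> (1 / 1000)" unfolding abs_le_iff by simp
    then show ?thesis by (simp only: of_real_diff[symmetric] norm_of_real)
  qed
  have d1: "norm (of_real (l / sqrt 2) * u - of_real (49 / 100) * u0) \<le> (1 / 1000) * 1 + (49 / 100) * (26 / 1000)"
    by (rule order.trans[OF norm_mult_diff_le]) (intro add_mono mult_mono c1 u; simp add: nu)
  have d2: "norm (of_real (ln 3 / sqrt 3) * v - of_real (634 / 1000) * v0) \<le> (1 / 1000) * 1 + (634 / 1000) * (38 / 1000)"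
    by (rule order.trans[OF norm_mult_diff_le]) (intro add_mono mult_mono c2 v; simp add: nu)
  have d3: "norm (u * u - u0 * u0) \<le> (26 / 1000) * 1 + (1002 / 1000) * (26 / 1000)"
    by (rule order.trans[OF norm_mult_diff_le]) (intro add_mono mult_mono u nu0; simp add: nu)
  have nu2: "norm (u0 * u0) \<le> (1002 / 1000) * (1002 / 1000)" unfolding norm_mult by (intro mult_mono nu0) auto
  have d4: "norm ((u * u) * B - (u0 * u0) * B0) \<le> ((26 / 1000) * 1 + (1002 / 1000) * (26 / 1000)) * (44 / 100) + ((1002 / 1000) * (1002 / 1000)) * (8 / 1000)"
    by (rule order.trans[OF norm_mult_diff_le]) (intro add_mono mult_mono d3 nu2 nB BB; simp)
  have "h - h0 = (of_real (l / sqrt 2) * u - of_real (49 / 100) * u0) + (of_real (ln 3 / sqrt 3) * v - of_real (634 / 1000) * v0) + ((u * u) * B - (u0 * u0) * B0)"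
    by (simp only: h_def h0_def power2_eq_square) simp
  then have "norm (h - h0) \<le> norm (of_real (l / sqrt 2) * u - of_real (49 / 100) * u0) + norm (of_real (ln 3 / sqrt 3) * v - of_real (634 / 1000) * v0) + norm ((u * u) * B - (u0 * u0) * B0)"
    by (simp only: norm_add3_le)
  also have "\<dots> \<le> (8 / 100)" using d1 d2 d4 by simp
  finally have "norm (h - h0) \<le> (8 / 100)" .
  moreover have "norm h0 \<ge> (17 / 100)"
  proof -
    have "Im h0 \<ge> (17 / 100)" by (simp add: h0_def u0_def v0_def B0_def power2_eq_square)
    then show ?thesis using abs_Im_le_cmod[of h0] by linarith
  qed
  ultimately have "norm h \<ge> (9 / 100)" using norm_triangle_ineq[of h "h0 - h"] by (simp add: norm_minus_commute)
  then show ?thesis by (simp add: heq)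
qed

lemma zeta_deriv_nonzero_near:
  assumes "\<bar>t - (629 / 100)\<bar> \<le> (3 / 100)"
  shows "deriv zeta (Complex (1 / 2) t) \<noteq> 0"
proof
  assume "deriv zeta (Complex (1 / 2) t) = 0"
  then have "norm (em_head_ln 4 (Complex (1 / 2) t)) \<le> (635 / 10000)"
  proof -
    have "6 \<le> t" "t \<le> (632 / 100)" using assms by linarith+
    then have "6 \<le> t" "t \<le> 6.32" by simp_all
    then show ?thesis using zeta_deriv_remainder_bound[of t] \<open>deriv zeta _ = 0\<close> by simp
  qed
  then show False using norm_em_head_ln_4_lower[OF assms] by simp
qed

section \<open>Assembling the bound\<close>

lemma deriv_zeta_cnj:
  assumes "s \<noteq> 1"
  shows "deriv zeta (cnj s) = cnj (deriv zeta s)"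
proof -
  have "(zeta has_field_derivative deriv zeta s) (at s)"
    using assms by (intro holomorphic_derivI[OF zeta_holomorphic]) auto
  then have "(cnj \<circ> zeta \<circ> cnj has_field_derivative cnj (deriv zeta s)) (at (cnj s))"
    using has_field_derivative_cnj_cnj[of zeta "deriv zeta s" "cnj s"] by simp
  moreover have "cnj \<circ> zeta \<circ> cnj = zeta" by (auto simp: zeta_cnj)
  ultimately show ?thesis by (simp add: DERIV_imp_deriv)
qed

text \<open>If \<open>\<zeta>\<close> did not vanish, \<open>Re L = 0\<close> would force \<open>Re \<psi>(1/4 + it/2) = ln \<pi>\<close>, so \<open>t\<close> would be close to
  \<open>6.29\<close>, where \<open>\<zeta>'\<close> has no zero.\<close>

lemma deriv_zeta_critical_line:
  assumes t: "t > 0" and z': "deriv zeta (Complex (1 / 2) t) = 0"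
  shows "zeta (Complex (1 / 2) t) = 0"
proof (rule ccontr)
  let ?s = "Complex (1 / 2) t"
  assume nz: "zeta ?s \<noteq> 0"
  have h: "?s / 2 = Complex (1 / 4) (t / 2)" by (simp add: complex_eq_iff)
  have "deriv completed_zeta ?s / completed_zeta ?s = - of_real (ln pi) / 2 + Digamma (?s / 2) / 2 + deriv zeta ?s / zeta ?s"
    using t nz by (intro completed_zeta_log_deriv) auto
  moreover have "Re (deriv completed_zeta ?s / completed_zeta ?s) = 0"
    using t by (intro completed_zeta_log_deriv_critical) auto
  ultimately have "Re (- of_real (ln pi) / 2 + Digamma (Complex (1 / 4) (t / 2)) / 2) = 0" by (simp add: z' h)
  then have "Re (Digamma (Complex (1 / 4) (t / 2))) = ln pi" by simp
  from Re_Digamma_critical_location[OF t this] have "\<bar>t - 629 / 100\<bar> \<le> 3 / 100" by simp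
  from zeta_deriv_nonzero_near[OF this] z' show False by simp
qed

text \<open>Removing the pole gives an entire function; this controls \<open>\<zeta>'\<close> near \<open>1\<close> as well.\<close>

lemma zeta_times_linear_entire:
  obtains F where "F holomorphic_on UNIV" "\<And>s. s \<noteq> 1 \<Longrightarrow> F s = (s - 1) * zeta s"
proof -
  obtain F where F: "F holomorphic_on UNIV" "\<And>s. Re s > 1 \<Longrightarrow> F s = (s - 1) * dirichlet_zeta s"
    using dirichlet_zeta_extend by blast
  have dz: "dirichlet_zeta s = zeta s" if "Re s > 1" for s
    using dirichlet_zeta_sums[OF that] zeta_sums_powr[OF that] by (rule sums_unique2)
  have eq: "F s = (s - 1) * zeta s" if "s \<noteq> 1" for s
  proof (rule analytic_continuation_open[of "{s. Re s > 1}" "- {1}" F "\<lambda>s. (s - 1) * zeta s"])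
    have "(2::complex) \<in> {s. Re s > 1}" by simp
    then show "{s. Re s > 1} \<noteq> {}" by blast
    show "(\<lambda>s. (s - 1) * zeta s) holomorphic_on - {1}" by (intro holomorphic_intros zeta_holomorphic)
    show "F holomorphic_on - {1}" by (rule holomorphic_on_subset[OF F(1)]) simp
    show "F z = (z - 1) * zeta z" if "z \<in> {s. Re s > 1}" for z using F(2)[of z] dz[of z] that by simp
  qed (use that in \<open>auto simp: open_halfspace_Re_gt connected_punctured_universe\<close>)
  show thesis by (rule that[OF F(1) eq])
qed

text \<open>The zeros of \<open>\<zeta>'\<close> are zeros of the entire function \<open>G = (s - 1)\<^sup>2 \<zeta>'\<close>. It cannot vanish identically, since
  \<open>\<zeta>'(1/2 + 6.29 \<i>) \<noteq> 0\<close>.\<close>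

lemma finite_deriv_zeta_zeros:
  assumes "compact K"
  shows "finite {s \<in> K. s \<noteq> 1 \<and> deriv zeta s = 0}"
proof -
  obtain F where F: "F holomorphic_on UNIV" "\<And>s. s \<noteq> 1 \<Longrightarrow> F s = (s - 1) * zeta s"
    using zeta_times_linear_entire by metis
  define G where "G = (\<lambda>s. (s - 1) * deriv F s - F s)"
  have G: "G holomorphic_on UNIV" unfolding G_def by (intro holomorphic_intros holomorphic_deriv F(1)) auto
  have Gz: "G s = (s - 1) ^ 2 * deriv zeta s" if "s \<noteq> 1" for s
  proof -
    have dz: "(zeta has_field_derivative deriv zeta s) (at s)"
      using that by (intro holomorphic_derivI[OF zeta_holomorphic]) auto
    have "((\<lambda>s. (s - 1) * zeta s) has_field_derivative (1 - 0) * zeta s + deriv zeta s * (s - 1)) (at s)"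
      by (intro DERIV_mult DERIV_diff DERIV_ident DERIV_const dz)
    then have "(F has_field_derivative (1 - 0) * zeta s + deriv zeta s * (s - 1)) (at s)"
      by (rule has_field_derivative_transform_within_open[of _ _ _ "- {1}"]) (use that F(2) in auto)
    then have dF: "deriv F s = zeta s + deriv zeta s * (s - 1)" by (simp add: DERIV_imp_deriv)
    show ?thesis unfolding G_def F(2)[OF that] dF by (simp add: power2_eq_square algebra_simps)
  qed
  have sub: "{s \<in> K. s \<noteq> 1 \<and> deriv zeta s = 0} \<subseteq> {z \<in> K. G z = 0}" using Gz by auto
  have "finite {z \<in> K. G z = 0}"
  proof (cases "G constant_on UNIV")
    case True
    then obtain c where c: "\<And>s. G s = c" unfolding constant_on_def by auto
    have "Complex (1 / 2) (629 / 100) \<noteq> 1" by (simp add: complex_eq_iff)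
    moreover have "deriv zeta (Complex (1 / 2) (629 / 100)) \<noteq> 0" by (rule zeta_deriv_nonzero_near) simp
    ultimately have "c \<noteq> 0" using Gz[of "Complex (1 / 2) (629 / 100)"] c by simp
    then show ?thesis using c by simp
  next
    case False
    show ?thesis by (rule holomorphic_compact_finite_zeros[OF G _ _ assms _ False]) auto
  qed
  then show ?thesis by (rule rev_finite_subset[OF _ sub])
qed

lemma nearest_ordinate_distance_le:
  assumes "nearest_ordinate t \<gamma>" "\<rho> \<in> nontrivial_zeta_zeros"
  shows "\<bar>\<gamma> - t\<bar> \<le> \<bar>Im \<rho> - t\<bar>"
  using assms by (auto simp: nearest_ordinate_def)

lemma nontrivial_zeta_zeros_cnj: "\<rho> \<in> nontrivial_zeta_zeros \<Longrightarrow> cnj \<rho> \<in> nontrivial_zeta_zeros"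
  by (auto simp: nontrivial_zeta_zeros_def zeta_cnj complex_eq_iff)

lemma nearest_ordinate_uminus:
  assumes "nearest_ordinate t \<gamma>"
  shows "nearest_ordinate (- t) (- \<gamma>)"
proof -
  obtain \<rho> where \<rho>: "\<rho> \<in> nontrivial_zeta_zeros" "\<gamma> = Im \<rho>" using assms by (auto simp: nearest_ordinate_def)
  have "- \<gamma> \<in> Im ` nontrivial_zeta_zeros"
    using nontrivial_zeta_zeros_cnj[OF \<rho>(1)] \<rho>(2) by (intro image_eqI[of _ _ "cnj \<rho>"]) auto
  moreover have "\<bar>- \<gamma> - - t\<bar> \<le> \<bar>\<gamma>' - - t\<bar>" if g: "\<gamma>' \<in> Im ` nontrivial_zeta_zeros" for \<gamma>'
  proof -
    obtain \<rho>' where "\<rho>' \<in> nontrivial_zeta_zeros" "\<gamma>' = Im \<rho>'" using g by auto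
    then have "\<bar>\<gamma> - t\<bar> \<le> \<bar>- \<gamma>' - t\<bar>"
      using nearest_ordinate_distance_le[OF assms nontrivial_zeta_zeros_cnj[of \<rho>']] by simp
    then show ?thesis by linarith
  qed
  ultimately show ?thesis by (simp add: nearest_ordinate_def)
qed

text \<open>Let \<open>m\<close> be the smallest positive distance to the critical line among the finitely many zeros of \<open>\<zeta>'\<close> in the
  critical strip below \<open>T0\<close>, or \<open>1/2\<close> if that is smaller. Zeros at distance at least \<open>m\<close> are covered by
  the uniform bound for gaps, the others lie above \<open>T0\<close> or on the critical line itself.\<close>

lemma ordinate_distance_upper_half_plane:
  obtains C :: real where "C > 0"
    "\<And>\<beta> t \<gamma>. deriv zeta (Complex \<beta> t) = 0 \<Longrightarrow> t > 0 \<Longrightarrow> nearest_ordinate t \<gamma> \<Longrightarrow> \<bar>\<gamma> - t\<bar> \<le> C * sqrt \<bar>\<beta> - 1 / 2\<bar>"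
proof -
  obtain C0 T0 D :: real where C0: "C0 > 0" and T0: "T0 > 0"
    and near: "\<And>T. T \<ge> T0 \<Longrightarrow> \<exists>\<rho> \<in> nontrivial_zeta_zeros. \<bar>Im \<rho> - T\<bar> \<le> D"
    and large: "\<And>x T d. T \<ge> T0 \<Longrightarrow> \<bar>x\<bar> \<le> 1 / 2 \<Longrightarrow> deriv zeta (Complex (1 / 2 + x) T) = 0 \<Longrightarrow>
       (\<And>\<rho>. \<rho> \<in> nontrivial_zeta_zeros \<Longrightarrow> d \<le> \<bar>Im \<rho> - T\<bar>) \<Longrightarrow> d > 0 \<Longrightarrow> d ^ 2 \<le> C0 * \<bar>x\<bar>"
    using large_ordinates by metis
  define K where "K = cbox (Complex 0 0) (Complex 1 T0)"
  define Z where "Z = {s \<in> K. s \<noteq> 1 \<and> deriv zeta s = 0}"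
  have "finite Z" unfolding Z_def K_def by (intro finite_deriv_zeta_zeros compact_cbox)
  \<comment> \<open>The element \<open>1/2\<close> keeps \<open>M\<close> nonempty and confines the remaining cases to the critical strip.\<close>
  define M where "M = insert (1 / 2) ((\<lambda>s. \<bar>Re s - 1 / 2\<bar>) ` {s \<in> Z. Re s \<noteq> 1 / 2})"
  define m where "m = Min M"
  have M: "finite M" "M \<noteq> {}" using \<open>finite Z\<close> by (auto simp: M_def)
  have m0: "m > 0" unfolding m_def using M by (subst Min_gr_iff) (auto simp: M_def)
  have m_half: "m \<le> 1 / 2" unfolding m_def by (rule Min_le[OF M(1)]) (simp add: M_def)
  have m_le: "m \<le> \<bar>Re s - 1 / 2\<bar>" if "s \<in> Z" "Re s \<noteq> 1 / 2" for s
    unfolding m_def using that by (intro Min_le[OF M(1)]) (auto simp: M_def)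
  obtain \<rho>1 where \<rho>1: "\<rho>1 \<in> nontrivial_zeta_zeros" "\<bar>Im \<rho>1 - T0\<bar> \<le> D" using near[of T0] by auto
  define D1 where "D1 = D + T0"
  have D1: "D1 > 0" using \<rho>1(2) T0 by (simp add: D1_def)
  have bounded: "\<bar>\<gamma> - t\<bar> \<le> D1" if "t > 0" "nearest_ordinate t \<gamma>" for t \<gamma>
  proof (cases "t \<ge> T0")
    case True
    then obtain \<rho> where "\<rho> \<in> nontrivial_zeta_zeros" "\<bar>Im \<rho> - t\<bar> \<le> D" using near by blast
    then show ?thesis using nearest_ordinate_distance_le[OF that(2), of \<rho>] T0 by (simp add: D1_def)
  next
    case False
    then show ?thesis using nearest_ordinate_distance_le[OF that(2) \<rho>1(1)] \<rho>1(2) that(1) T0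
      unfolding D1_def by linarith
  qed
  define C where "C = max (D1 / sqrt m) (sqrt C0)"
  have C: "C > 0" using C0 by (simp add: C_def less_max_iff_disj)
  have main: "\<bar>\<gamma> - t\<bar> \<le> C * sqrt \<bar>\<beta> - 1 / 2\<bar>"
    if z': "deriv zeta (Complex \<beta> t) = 0" and t: "t > 0" and n: "nearest_ordinate t \<gamma>" for \<beta> t \<gamma>
  proof -
    define x where "x = \<beta> - 1 / 2"
    have \<beta>: "\<beta> = 1 / 2 + x" by (simp add: x_def)
    consider "m \<le> \<bar>x\<bar>" | "\<bar>x\<bar> < m" "t \<ge> T0" | "\<bar>x\<bar> < m" "t < T0" by linarith
    then have "\<bar>\<gamma> - t\<bar> \<le> C * sqrt \<bar>x\<bar>"
    proof cases
      case 1
      have "\<bar>\<gamma> - t\<bar> \<le> D1 / sqrt m * sqrt m" using bounded[OF t n] m0 by simp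
      also have "\<dots> \<le> C * sqrt \<bar>x\<bar>"
        using 1 m0 D1 C by (intro mult_mono) (auto simp: C_def)
      finally show ?thesis .
    next
      case 2
      show ?thesis
      proof (cases "\<gamma> = t")
        case False
        have "\<bar>\<gamma> - t\<bar> ^ 2 \<le> C0 * \<bar>x\<bar>"
        proof (rule large[OF 2(2)])
          show "\<bar>x\<bar> \<le> 1 / 2" using 2(1) m_half by linarith
          show "deriv zeta (Complex (1 / 2 + x) t) = 0" using z' by (simp add: \<beta>)
        qed (use False nearest_ordinate_distance_le[OF n] in auto)
        then have "\<bar>\<gamma> - t\<bar> \<le> sqrt (C0 * \<bar>x\<bar>)" by (rule real_le_rsqrt)
        also have "\<dots> = sqrt C0 * sqrt \<bar>x\<bar>" by (rule real_sqrt_mult)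
        also have "\<dots> \<le> C * sqrt \<bar>x\<bar>" by (intro mult_right_mono) (auto simp: C_def)
        finally show ?thesis .
      qed (use C in simp)
    next
      case 3
      let ?s = "Complex \<beta> t"
      have "\<bar>x\<bar> < 1 / 2" using 3(1) m_half by linarith
      then have "0 < \<beta>" "\<beta> < 1" unfolding \<beta> by linarith+
      then have sZ: "?s \<in> Z" using t 3(2) z' by (auto simp: Z_def K_def in_cbox_complex_iff complex_eq_iff)
      have half: "\<beta> = 1 / 2"
      proof (rule ccontr)
        assume "\<beta> \<noteq> 1 / 2"
        then have "m \<le> \<bar>x\<bar>" using m_le[OF sZ] by (simp add: x_def)
        then show False using 3(1) by simp
      qed
      have "zeta ?s = 0" using deriv_zeta_critical_line[OF t] z' unfolding half by blast
      then have "?s \<in> nontrivial_zeta_zeros"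
        using \<open>0 < \<beta>\<close> \<open>\<beta> < 1\<close> by (auto simp: nontrivial_zeta_zeros_def complex_eq_iff)
      then have "\<bar>\<gamma> - t\<bar> \<le> 0" using nearest_ordinate_distance_le[OF n, of ?s] by simp
      then show ?thesis using C by (simp add: order.trans)
    qed
    then show ?thesis by (simp add: x_def)
  qed
  show thesis by (rule that[OF C main])
qed

theorem theorem2:
  shows "\<exists>C::real. C > 0 \<and>
    (\<forall>\<beta>' \<gamma>' \<gamma>\<^sub>c :: real.
       deriv zeta (Complex \<beta>' \<gamma>') = 0 \<longrightarrow> \<gamma>' \<noteq> 0 \<longrightarrow> nearest_ordinate \<gamma>' \<gamma>\<^sub>c \<longrightarrow>
       \<bar>\<gamma>\<^sub>c - \<gamma>'\<bar> \<le> C * \<bar>\<beta>' - 1 / 2\<bar> powr (1 / 2))"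
proof -
  obtain C :: real where C: "C > 0"
    and pos: "\<And>\<beta> t \<gamma>. deriv zeta (Complex \<beta> t) = 0 \<Longrightarrow> t > 0 \<Longrightarrow> nearest_ordinate t \<gamma> \<Longrightarrow> \<bar>\<gamma> - t\<bar> \<le> C * sqrt \<bar>\<beta> - 1 / 2\<bar>"
    using ordinate_distance_upper_half_plane by metis
  have "\<bar>\<gamma> - t\<bar> \<le> C * \<bar>\<beta> - 1 / 2\<bar> powr (1 / 2)"
    if z': "deriv zeta (Complex \<beta> t) = 0" and t: "t \<noteq> 0" and n: "nearest_ordinate t \<gamma>" for \<beta> t \<gamma>
  proof -
    have "\<bar>\<gamma> - t\<bar> \<le> C * sqrt \<bar>\<beta> - 1 / 2\<bar>"
    proof (cases "t > 0")
      case False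
      have "Complex \<beta> t \<noteq> 1" using t by (simp add: complex_eq_iff)
      then have "deriv zeta (Complex \<beta> (- t)) = 0"
        using deriv_zeta_cnj[of "Complex \<beta> t"] z' by (simp add: complex_cnj)
      then have "\<bar>- \<gamma> - - t\<bar> \<le> C * sqrt \<bar>\<beta> - 1 / 2\<bar>"
        using False t by (intro pos nearest_ordinate_uminus n) auto
      then show ?thesis by (simp add: abs_minus_commute)
    qed (use pos z' n in blast)
    then show ?thesis by (simp add: powr_half_sqrt)
  qed
  then show ?thesis using C by blast
qed


end
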